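(* Let $C \subset \mathbb{P}^{2}_{\mathbb{C}}$ be an irreducible MK-curve of degree $n=2m$, and let $C^{\vee}$ be its dual curve. Then $$\deg (C^{\vee}) <\frac{2m^2}{3}.$$
   Context: The dual curve $C^\vee\subset(\mathbb{P}^2_{\mathbb{C}})^\vee$ of an irreducible plane curve $C$ is the closure of the set of tangent lines to $C$ at its smooth points. ADE singularities of plane curves are those locally analytically equivalent to $A_k: x^2+y^{k+1}=0$ ($k\ge 1$), $D_k: x^2y+y^{k-1}=0$ ($k\geq 4$), $E_6: x^3+y^4=0$, $E_7: x^3+xy^3=0$, $E_8: x^3+y^5=0$. Let $C$ be a reduced plane curve of even degree with only ADE singularities, and let $X$ be the double cover of $\mathbb{P}^2_{\mathbb{C}}$ branched along $C$. Over each $p\in \mathrm{Sing}(C)$, $X$ has a rational double point of the same type. The Miyaoka-Kobayashi number of $p$ is $m(p)=3\left(e(E_p)-\frac{1}{\mathrm{ord}(G_p)}\right)-K(E_p)^2$, where $E_p$ is the exceptional curve over $p$ in the minimal resolution of $X$, $e$ is the topological Euler characteristic, $G_p$ is the associated small group, and $K(E_p)$ is the local canonical divisor (which is zero for rational double points). Explicitly, $m(A_k)=3(k+1)-\frac{3}{k+1}$ for $k\ge 1$, $m(D_k)=3(k+1)-\frac{3}{4(k-2)}$ for $k\ge 4$, $m(E_6)=\frac{167}{8}$, $m(E_7)=\frac{383}{16}$, $m(E_8)=\frac{1079}{40}$. Put $m(C)=\sum_{p\in \mathrm{Sing}(C)}m(p)$. MK-curve: a reduced curve $C\subset\mathbb{P}^2_{\mathbb{C}}$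 of even degree $n\geq 6$ with only ADE singularities such that $m(C)=\frac{n}{2}(5n-6)$. *)

theory Defs
  imports
    "HOL-Analysis.Analysis"
    "HOL-Computational_Algebra.Computational_Algebra"
begin

section \<open>Ternary forms\<close>

text \<open>A polynomial in \<open>x, y, z\<close> is an element of \<open>\<complex>[x][y][z]\<close>: the outermost variable is
  \<open>z\<close> and the innermost one is \<open>x\<close>. The coordinates \<open>x, y, z\<close> of a vector \<open>v\<close>
  are \<open>v $ 1, v $ 2, v $ 3\<close>.\<close>

type_synonym poly3 = "complex poly poly poly"

definition coeff3 :: "poly3 \<Rightarrow> nat \<Rightarrow> nat \<Rightarrow> nat \<Rightarrow> complex" where
  "coeff3 F i j k = coeff (coeff (coeff F k) j) i"

definition eval3 :: "poly3 \<Rightarrow> complex^3 \<Rightarrow> complex" where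
  "eval3 F v = poly (poly (poly F [:[:v $ 3:]:]) [:v $ 2:]) (v $ 1)"

definition form :: "nat \<Rightarrow> poly3 \<Rightarrow> bool" where
  "form n F \<longleftrightarrow> F \<noteq> 0 \<and> (\<forall>i j k. coeff3 F i j k \<noteq> 0 \<longrightarrow> i + j + k = n)"

definition gradient :: "poly3 \<Rightarrow> complex^3 \<Rightarrow> complex^3" where
  "gradient F v = vector
    [eval3 (map_poly (map_poly pderiv) F) v, eval3 (map_poly pderiv F) v, eval3 (pderiv F) v]"


section \<open>Plane curves and their duals\<close>

text \<open>Points of the projective plane are the one-dimensional subspaces of \<open>\<complex>\<^sup>3\<close>.\<close>

definition P2 :: "(complex^3) set set" where
  "P2 = {vec.span {v} | v. v \<noteq> 0}"

definition zero_locus :: "poly3 \<Rightarrow> (complex^3) set set" where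
  "zero_locus F = {p \<in> P2. \<forall>v\<in>p. eval3 F v = 0}"

definition zariski_closed :: "(complex^3) set set \<Rightarrow> bool" where
  "zariski_closed Z \<longleftrightarrow>
    (\<exists>S. (\<forall>G\<in>S. \<exists>d. form d G) \<and> Z = {p \<in> P2. \<forall>G\<in>S. p \<in> zero_locus G})"

text \<open>A reduced plane curve of degree \<open>n\<close> is given by its equation, a squarefree form
  of degree \<open>n\<close>, which is unique up to a nonzero constant.\<close>

definition reduced_curve :: "nat \<Rightarrow> poly3 \<Rightarrow> bool" where
  "reduced_curve n F \<longleftrightarrow> form n F \<and> squarefree F"

text \<open>The degree of a plane curve given as a set of points is the degree of its reduced equation.
  By the Nullstellensatz, two squarefree forms with the same zero locus are proportional.\<close>

definition curve_degree :: "(complex^3) set set \<Rightarrow> nat" where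
  "curve_degree Z = (THE d. \<exists>G. reduced_curve d G \<and> zero_locus G = Z)"

definition singular_points :: "poly3 \<Rightarrow> (complex^3) set set" where
  "singular_points F = {p \<in> zero_locus F. \<forall>v\<in>p. gradient F v = 0}"

text \<open>The line \<open>a x + b y + c z = 0\<close> is the point \<open>[a : b : c]\<close> of the dual plane, which is
  thereby identified with \<open>P2\<close>; the tangent line at a smooth point \<open>[v]\<close> is the class of the
  gradient at \<open>v\<close>.\<close>

definition tangent_lines :: "poly3 \<Rightarrow> (complex^3) set set" where
  "tangent_lines F =
    {vec.span {gradient F v} | v. v \<noteq> 0 \<and> vec.span {v} \<in> zero_locus F - singular_points F}"

definition dual_curve :: "poly3 \<Rightarrow> (complex^3) set set" where
  "dual_curve F = zariski_closed hull tangent_lines F"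


section \<open>ADE singularities\<close>

text \<open>On open sets, complex Frechet differentiability, i.e. holomorphy in two variables.\<close>

definition holomorphic2_on :: "(complex \<times> complex \<Rightarrow> complex) \<Rightarrow> (complex \<times> complex) set \<Rightarrow> bool" where
  "holomorphic2_on f U \<longleftrightarrow>
    (\<forall>z\<in>U. \<exists>a b. (f has_derivative (\<lambda>(h, k). a * h + b * k)) (at z))"

definition biholomorphism ::
  "(complex \<times> complex) set \<Rightarrow> (complex \<times> complex) set
    \<Rightarrow> (complex \<times> complex \<Rightarrow> complex \<times> complex) \<Rightarrow> bool" where
  "biholomorphism U V \<phi> \<longleftrightarrow> (\<exists>\<psi>. homeomorphism U V \<phi> \<psi> \<and>
    holomorphic2_on (fst \<circ> \<phi>) U \<and> holomorphic2_on (snd \<circ> \<phi>) U \<and>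
    holomorphic2_on (fst \<circ> \<psi>) V \<and> holomorphic2_on (snd \<circ> \<psi>) V)"

text \<open>Isomorphism of the analytic curve germs \<open>f = 0\<close> and \<open>g = 0\<close> at the origin: up to a
  holomorphic unit \<open>u\<close>, a local change of coordinates \<open>\<phi>\<close> takes one equation to the other.\<close>

definition analytically_equivalent ::
  "(complex \<times> complex \<Rightarrow> complex) \<Rightarrow> (complex \<times> complex \<Rightarrow> complex) \<Rightarrow> bool" where
  "analytically_equivalent f g \<longleftrightarrow> (\<exists>U V \<phi> u. open U \<and> open V \<and> 0 \<in> U \<and> 0 \<in> V \<and>
    biholomorphism U V \<phi> \<and> \<phi> 0 = 0 \<and> holomorphic2_on u U \<and>
    (\<forall>z\<in>U. u z \<noteq> 0 \<and> f z = u z * g (\<phi> z)))"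

datatype ade = A_type nat | D_type nat | E6 | E7 | E8

fun ade_index_ok :: "ade \<Rightarrow> bool" where
  "ade_index_ok (A_type k) \<longleftrightarrow> k \<ge> 1"
| "ade_index_ok (D_type k) \<longleftrightarrow> k \<ge> 4"
| "ade_index_ok _ \<longleftrightarrow> True"

fun ade_equation :: "ade \<Rightarrow> complex \<times> complex \<Rightarrow> complex" where
  "ade_equation (A_type k) (x, y) = x^2 + y^(k + 1)"
| "ade_equation (D_type k) (x, y) = x^2 * y + y^(k - 1)"
| "ade_equation E6 (x, y) = x^3 + y^4"
| "ade_equation E7 (x, y) = x^3 + x * y^3"
| "ade_equation E8 (x, y) = x^3 + y^5"

text \<open>The invertible matrix \<open>A\<close> is a linear change of coordinates taking \<open>[0 : 0 : 1]\<close> to \<open>p\<close>,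
  so that \<open>(s, t) \<mapsto> [A (s, t, 1)]\<close> is an affine chart of the plane centred at \<open>p\<close>. The choice of
  the chart does not matter.\<close>

definition has_ade_type :: "poly3 \<Rightarrow> (complex^3) set \<Rightarrow> ade \<Rightarrow> bool" where
  "has_ade_type F p T \<longleftrightarrow> ade_index_ok T \<and>
    (\<exists>A :: complex^3^3. invertible A \<and> p = vec.span {A *v vector [0, 0, 1]} \<and>
      analytically_equivalent (\<lambda>(s, t). eval3 F (A *v vector [s, t, 1])) (ade_equation T))"

text \<open>The types are pairwise inequivalent, so the choice below is unique for an ADE point.\<close>

definition ade_type :: "poly3 \<Rightarrow> (complex^3) set \<Rightarrow> ade" where
  "ade_type F p = (SOME T. has_ade_type F p T)"


section \<open>MK-curves\<close>

text \<open>The values of \<open>3 (e(E) - 1 / ord(G))\<close>, where \<open>E\<close> is the exceptional curve and \<open>G\<close> the small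
  group of the rational double point; here \<open>K(E) = 0\<close>.\<close>

fun mk_number :: "ade \<Rightarrow> real" where
  "mk_number (A_type k) = 3 * (real k + 1) - 3 / (real k + 1)"
| "mk_number (D_type k) = 3 * (real k + 1) - 3 / (4 * (real k - 2))"
| "mk_number E6 = 167 / 8"
| "mk_number E7 = 383 / 16"
| "mk_number E8 = 1079 / 40"

definition MK_curve :: "nat \<Rightarrow> poly3 \<Rightarrow> bool" where
  "MK_curve n F \<longleftrightarrow> reduced_curve n F \<and> even n \<and> n \<ge> 6 \<and>
    (\<forall>p\<in>singular_points F. \<exists>T. has_ade_type F p T) \<and>
    (\<Sum>p\<in>singular_points F. mk_number (ade_type F p)) = real n / 2 * (5 * real n - 6)"

end

theory Submission
  imports Defs "HOL-Computational_Algebra.Field_as_Ring" "Subresultants.Resultant_Prelim"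
    "HOL-Complex_Analysis.Complex_Analysis"
begin

text \<open>
  An equation \<open>G\<close> of the dual curve divides the discriminant of the restriction of \<open>F\<close> to a line, as a
  polynomial in the coordinates of the line. On a generic pencil of lines this discriminant is a
  polynomial of degree at most \<open>n (n - 1)\<close> in the parameter of the pencil. At the line through a singular
  point \<open>p\<close> it vanishes to order at least some real number \<open>s\<close> (\<open>ade_order\<close>), because the roots near \<open>p\<close>
  are close to each other, whereas \<open>G\<close> does not vanish there. Hence the degree of the dual curve plus the
  sum of the orders \<open>s\<close> is at most \<open>n (n - 1)\<close>. Since the Miyaoka-Kobayashi number of \<open>p\<close> is less than
  \<open>3 s\<close>, the equality defining an MK-curve gives the bound.
\<close>

text \<open>The order \<open>s\<close> is the Milnor number plus the multiplicity minus one, the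
  local correction of the generalised Pluecker formula for the class of a singular curve; that
  formula enters here as an inequality. The estimate is elementary: where the discriminant is
  nonzero, it is up to a constant the product of the derivative over the roots, and each root near
  \<open>p\<close> contributes a power of the distance read off from the gradient of the ADE normal
  form. Such powers are fractional; only their total bounds an integer order. The obstacle is the
  type D_k with k > 4, where one smooth branch has a smaller exponent than the rest: the pencil has
  to be transversal to it, so that each line meets it in at most one nearby root. That the dual has
  a single irreducible equation, dividing every polynomial that vanishes there, rests on the
  Nullstellensatz for hypersurfaces, proved by adjoining one variable at a time. The constant of the
  theorem comes from n = 2m in n(n - 1) - n(5n - 6)/6 = 2m^2/3.\<close>

no_notation fps_nth (infixl "$" 75)
no_notation Matrix.vec_index (infixl "$" 100)
no_notation Group.monoid.mult (infixl "\<otimes>\<index>" 70)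

section \<open>Sylvester determinants with prescribed degree bounds\<close>

lemma poly_eq_sum_upto:
  fixes x :: "'a :: comm_semiring_1"
  assumes "degree p \<le> n"
  shows "poly p x = (\<Sum>i\<le>n. coeff p i * x ^ i)"
  unfolding poly_altdef
  by (rule sum.mono_neutral_left) (use assms in \<open>auto simp: coeff_eq_0\<close>)

text \<open>Each row holds the coefficients of a shifted copy of \<open>p\<close> or
  \<open>q\<close>, so pairing it with the descending powers of \<open>x\<close> evaluates that
  copy. The sizes \<open>m\<close> and \<open>k\<close> are upper bounds for the degrees, which lets
  the matrix commute with a specialisation of coefficients even when a degree drops.\<close>

lemma sylvester_mat_sub_times_powers:
  fixes x :: "'a :: comm_ring_1"
  assumes "degree p \<le> m" "degree q \<le> k" "i < m + k"
  shows "(\<Sum>j<m + k. sylvester_mat_sub m k p q $$ (i, j) * x ^ (m + k - 1 - j)) =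
    (if i < k then x ^ (k - 1 - i) * poly p x else x ^ (m + k - 1 - i) * poly q x)"
proof (cases "i < k")
  case True
  have "(\<Sum>j<m + k. sylvester_mat_sub m k p q $$ (i, j) * x ^ (m + k - 1 - j)) =
      (\<Sum>j\<in>{i..i + m}. coeff p (m + i - j) * x ^ (m + k - 1 - j))"
    by (rule sum.mono_neutral_cong_right)
      (use True in \<open>auto simp: sylvester_mat_sub_index[OF assms(3)]\<close>)
  also have "\<dots> = (\<Sum>l\<le>m. coeff p l * x ^ (l + (k - 1 - i)))"
    by (rule sum.reindex_bij_witness[of _ "\<lambda>l. m + i - l" "\<lambda>j. m + i - j"])
      (use True in \<open>auto intro!: arg_cong2[where f = "(*)"] arg_cong2[where f = "(^)"]\<close>)
  also have "\<dots> = x ^ (k - 1 - i) * poly p x"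
    by (simp add: poly_eq_sum_upto[OF assms(1)] sum_distrib_left power_add mult_ac)
  finally show ?thesis using True by simp
next
  case False
  have "(\<Sum>j<m + k. sylvester_mat_sub m k p q $$ (i, j) * x ^ (m + k - 1 - j)) =
      (\<Sum>j\<in>{i - k..i}. coeff q (i - j) * x ^ (m + k - 1 - j))"
    by (rule sum.mono_neutral_cong_right)
      (use False assms(3) in \<open>auto simp: sylvester_mat_sub_index[OF assms(3)]\<close>)
  also have "\<dots> = (\<Sum>l\<le>k. coeff q l * x ^ (l + (m + k - 1 - i)))"
    by (rule sum.reindex_bij_witness[of _ "\<lambda>l. i - l" "\<lambda>j. i - j"])
      (use False assms(3) in \<open>auto intro!: arg_cong2[where f = "(*)"] arg_cong2[where f = "(^)"]\<close>)
  also have "\<dots> = x ^ (m + k - 1 - i) * poly q x"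
    by (simp add: poly_eq_sum_upto[OF assms(2)] sum_distrib_left power_add mult_ac)
  finally show ?thesis using False by simp
qed

text \<open>The vector of powers of a common root lies in the kernel; it is nonzero because its last
  entry is \<open>x ^ 0\<close>.\<close>

lemma det_sylvester_mat_sub_common_root:
  fixes p q :: "'a :: field poly"
  assumes "degree p \<le> m" "degree q \<le> k" "m + k > 0" "poly p x = 0" "poly q x = 0"
  shows "Determinant.det (sylvester_mat_sub m k p q) = 0"
proof -
  let ?S = "sylvester_mat_sub m k p q" and ?v = "Matrix.vec (m + k) (\<lambda>j. x ^ (m + k - 1 - j))"
  have "?S *\<^sub>v ?v = 0\<^sub>v (m + k)"
  proof (rule eq_vecI)
    fix i assume "i < dim_vec (0\<^sub>v (m + k) :: 'a Matrix.vec)"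
    hence i: "i < m + k" by simp
    show "Matrix.vec_index (?S *\<^sub>v ?v) i = Matrix.vec_index (0\<^sub>v (m + k)) i"
      using sylvester_mat_sub_times_powers[OF assms(1,2) i, of x] i assms(4,5)
      by (simp add: scalar_prod_def atLeast0LessThan)
  qed auto
  moreover have "?v \<noteq> 0\<^sub>v (m + k)"
  proof
    assume "?v = 0\<^sub>v (m + k)"
    from arg_cong[OF this, of "\<lambda>v. Matrix.vec_index v (m + k - 1)"] show False
      using assms(3) by simp
  qed
  ultimately show ?thesis
    by (subst det_0_iff_vec_prod_zero_field[OF sylvester_mat_sub_carrier]) (auto intro!: exI[of _ ?v])
qed

text \<open>A kernel vector of the transposed matrix lists the coefficients of a polynomial of
  degree below \<open>n\<close> with \<open>n\<close> distinct roots.\<close>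

lemma det_vandermonde_nonzero:
  fixes z :: "nat \<Rightarrow> 'a :: field"
  assumes "inj_on z {..<n}"
  shows "Determinant.det (Matrix.mat n n (\<lambda>(i, j). z j ^ (n - 1 - i))) \<noteq> 0"
proof
  let ?V = "Matrix.mat n n (\<lambda>(i, j). z j ^ (n - 1 - i))"
  let ?W = "Matrix.mat n n (\<lambda>(i, j). z i ^ (n - 1 - j))"
  assume "Determinant.det ?V = 0"
  moreover have "?W = Matrix.transpose_mat ?V" by (rule eq_matI) auto
  ultimately have "Determinant.det ?W = 0"
    using det_transpose[of ?V n] by simp
  then obtain v where v: "v \<in> carrier_vec n" "v \<noteq> 0\<^sub>v n" "?W *\<^sub>v v = 0\<^sub>v n"
    using det_0_iff_vec_prod_zero_field[of ?W n] by auto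
  define p where "p = (\<Sum>j<n. monom (Matrix.vec_index v j) (n - 1 - j))"
  have coeff_p: "coeff p (n - 1 - j) = Matrix.vec_index v j" if "j < n" for j
  proof -
    have "coeff p (n - 1 - j) = (\<Sum>i<n. if i = j then Matrix.vec_index v i else 0)"
      unfolding p_def coeff_sum using that by (intro sum.cong) auto
    thus ?thesis using that by simp
  qed
  have "poly p (z i) = 0" if "i < n" for i
  proof -
    have "poly p (z i) = Matrix.vec_index (?W *\<^sub>v v) i"
      using that v(1) by (simp add: p_def poly_sum poly_monom scalar_prod_def mult_ac atLeast0LessThan)
    also have "\<dots> = 0" unfolding v(3) using that by simp
    finally show ?thesis .
  qed
  hence sub: "z ` {..<n} \<subseteq> {x. poly p x = 0}" by auto
  have "p = 0"
  proof (rule ccontr)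
    assume "p \<noteq> 0"
    hence "card (z ` {..<n}) \<le> card {x. poly p x = 0}"
      using sub by (intro card_mono poly_roots_finite) auto
    also have "\<dots> \<le> degree p" using card_poly_roots_bound[OF \<open>p \<noteq> 0\<close>] .
    also have "degree p \<le> n - 1"
      unfolding p_def by (rule degree_sum_le) (auto intro: order.trans[OF degree_monom_le])
    finally have "n \<le> n - 1" using card_image[OF assms] by simp
    moreover have "n > 0" using v(1,2) by (intro notI gr0I) auto
    ultimately show False by simp
  qed
  hence "v = 0\<^sub>v n" using v(1) coeff_p by (intro eq_vecI) auto
  with v(2) show False by simp
qed

text \<open>The product formula for the resultant. Completing the power vectors of the roots by unit
  vectors to a square matrix \<open>?W\<close> makes the product with the Sylvester matrix block
  triangular, and the Vandermonde determinant then cancels; this is where distinctness of the roots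
  enters.\<close>

lemma det_sylvester_mat_sub_split:
  fixes q :: "'a :: field poly"
  assumes inj: "inj_on z {..<n}" and n: "n > 0" and q: "degree q \<le> n - 1"
    and p: "p = Polynomial.smult c (\<Prod>i<n. [:- z i, 1:])"
  shows "Determinant.det (sylvester_mat_sub n (n - 1) p q) = c ^ (n - 1) * (\<Prod>i<n. poly q (z i))"
proof -
  let ?k = "n - 1"
  let ?S = "sylvester_mat_sub n ?k p q"
  let ?V = "Matrix.mat n n (\<lambda>(i, j). z j ^ (n - 1 - i))"
  let ?B = "Matrix.mat ?k n (\<lambda>(i, j). z j ^ (n + ?k - 1 - i))"
  \<comment> \<open>\<open>?B\<close> stacked on \<open>?V\<close> has the full power vectors of the
    roots as columns. The rows of \<open>p\<close> annihilate them, which produces the zero block of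
    the product; the rows of \<open>q\<close> turn them into \<open>?V * ?D\<close>.\<close>
  let ?W = "four_block_mat (1\<^sub>m ?k) ?B (0\<^sub>m n ?k) ?V"
  let ?T = "Matrix.mat ?k ?k (\<lambda>(i, j). ?S $$ (i, j))"
  let ?L = "Matrix.mat n ?k (\<lambda>(i, j). ?S $$ (?k + i, j))"
  let ?D = "Matrix.mat n n (\<lambda>(i, j). if i = j then poly q (z i) else 0)"
  have deg_p: "degree p \<le> n"
  proof -
    have "degree (\<Prod>i<n. [:- z i, 1:]) = n"
      by (subst degree_prod_eq_sum_degree) auto
    thus ?thesis unfolding p by (metis degree_smult_le)
  qed
  have coeff_n: "coeff p n = c"
  proof -
    have "degree (\<Prod>i<n. [:- z i, 1:]) = n" by (subst degree_prod_eq_sum_degree) auto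
    moreover have "lead_coeff (\<Prod>i<n. [:- z i, 1:]) = 1"
      by (subst lead_coeff_prod) auto
    ultimately show ?thesis unfolding p by simp
  qed
  have root: "poly p (z i) = 0" if "i < n" for i
    using that unfolding p by (auto simp: poly_prod)
  have W: "?W \<in> carrier_mat (n + ?k) (n + ?k)"
    using four_block_carrier_mat[of "1\<^sub>m ?k" ?k ?k ?V n n] by (simp add: add.commute)
  have SW: "?S * ?W = four_block_mat ?T (0\<^sub>m ?k n) ?L (?V * ?D)" (is "_ = ?R")
  proof (rule eq_matI)
    show "dim_row (?S * ?W) = dim_row ?R" "dim_col (?S * ?W) = dim_col ?R" by auto
    fix i j assume "i < dim_row ?R" "j < dim_col ?R"
    hence ij: "i < n + ?k" "j < n + ?k" by auto
    have e: "(?S * ?W) $$ (i, j) = (\<Sum>l<n + ?k. ?S $$ (i, l) * ?W $$ (l, j))"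
      using ij W by (subst index_mult_mat)
        (auto simp: scalar_prod_def atLeast0LessThan simp del: index_mat_four_block)
    show "(?S * ?W) $$ (i, j) = ?R $$ (i, j)"
    proof (cases "j < ?k")
      case True
      have "(?S * ?W) $$ (i, j) = (\<Sum>l<n + ?k. if l = j then ?S $$ (i, l) else 0)"
        unfolding e by (rule sum.cong) (use True in auto)
      also have "\<dots> = ?S $$ (i, j)" using ij by simp
      also have "\<dots> = ?R $$ (i, j)" using True ij by auto
      finally show ?thesis .
    next
      case False
      define r where "r = j - ?k"
      have r: "r < n" "j = ?k + r" using False ij unfolding r_def by auto
      have "(?S * ?W) $$ (i, j) = (\<Sum>l<n + ?k. ?S $$ (i, l) * z r ^ (n + ?k - 1 - l))"
        unfolding e
      proof (rule sum.cong)
        fix l assume "l \<in> {..<n + ?k}"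
        hence "?W $$ (l, j) = z r ^ (n + ?k - 1 - l)"
          using r by (cases "l < ?k") (auto intro!: arg_cong2[where f = "(^)"])
        thus "?S $$ (i, l) * ?W $$ (l, j) = ?S $$ (i, l) * z r ^ (n + ?k - 1 - l)" by simp
      qed simp
      also have "\<dots> = (if i < ?k then 0 else z r ^ (n + ?k - 1 - i) * poly q (z r))"
        using sylvester_mat_sub_times_powers[OF deg_p q ij(1), of "z r"] root[OF r(1)] by simp
      also have "\<dots> = ?R $$ (i, j)"
      proof (cases "i < ?k")
        case False
        have "(?V * ?D) $$ (i - ?k, r) = (\<Sum>l<n. if l = r then z r ^ (n - 1 - (i - ?k)) * poly q (z r) else 0)"
          using False ij r by (simp add: scalar_prod_def atLeast0LessThan if_distrib cong: if_cong)
        also have "\<dots> = z r ^ (n - 1 - (i - ?k)) * poly q (z r)" using r by simp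
        also have "n - 1 - (i - ?k) = n + ?k - 1 - i" using False ij by simp
        finally have "(?V * ?D) $$ (i - ?k, r) = z r ^ (n + ?k - 1 - i) * poly q (z r)" .
        moreover have "?R $$ (i, j) = (?V * ?D) $$ (i - ?k, r)"
          using False ij r \<open>\<not> j < ?k\<close> by (subst index_mat_four_block) (simp_all del: index_mult_mat(1))
        ultimately show ?thesis using False by simp
      qed (use r ij \<open>\<not> j < ?k\<close> in auto)
      finally show ?thesis .
    qed
  qed
  have detW: "Determinant.det ?W = Determinant.det ?V"
    by (subst det_four_block_mat_lower_left_zero[of _ ?k _ n]) auto
  have "Determinant.det (?S * ?W) = Determinant.det ?T * Determinant.det (?V * ?D)"
    unfolding SW by (rule det_four_block_mat_upper_right_zero) auto
  also have "Determinant.det ?T = c ^ ?k"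
  proof -
    have "upper_triangular ?T"
      unfolding upper_triangular_def by (auto simp: sylvester_mat_sub_index)
    moreover have "diag_mat ?T = map (\<lambda>i. c) [0..<?k]"
      unfolding diag_mat_def by (auto simp: sylvester_mat_sub_index coeff_n)
    ultimately show ?thesis
      by (subst det_upper_triangular[of _ ?k]) (auto simp: map_replicate_const)
  qed
  also have "Determinant.det (?V * ?D) = Determinant.det ?V * Determinant.det ?D"
    by (rule det_mult[of _ n]) auto
  also have "Determinant.det ?D = (\<Prod>i<n. poly q (z i))"
  proof -
    have "upper_triangular ?D" unfolding upper_triangular_def by auto
    moreover have "diag_mat ?D = map (\<lambda>i. poly q (z i)) [0..<n]"
      unfolding diag_mat_def by auto
    ultimately show ?thesis
      using prod.distinct_set_conv_list[of "[0..<n]" "\<lambda>i. poly q (z i)"]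
      by (subst det_upper_triangular[of _ n]) (auto simp: atLeast0LessThan)
  qed
  finally have "Determinant.det (?S * ?W) = c ^ ?k * (Determinant.det ?V * (\<Prod>i<n. poly q (z i)))" .
  moreover have "Determinant.det (?S * ?W) = Determinant.det ?S * Determinant.det ?V"
    using det_mult[OF sylvester_mat_sub_carrier W] detW by metis
  ultimately have "Determinant.det ?S * Determinant.det ?V =
      c ^ ?k * (\<Prod>i<n. poly q (z i)) * Determinant.det ?V"
    by (simp only: mult_ac)
  thus ?thesis using det_vandermonde_nonzero[OF inj] by simp
qed

section \<open>Elimination and Study's lemma\<close>

text \<open>Pseudo-division by an element \<open>T\<close> of least degree in the ideal of
  \<open>P\<close> and \<open>H\<close> shows that \<open>T\<close> divides every element of it up
  to a constant. Primality of \<open>P\<close> then leaves two cases: \<open>P\<close> divides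
  \<open>T\<close>, hence \<open>H\<close>, or \<open>T\<close> is constant in the outer variable.
  The resulting identity eliminates that variable.\<close>

lemma irreducible_poly_elimination:
  fixes P H :: "'a :: {factorial_ring_gcd, semiring_gcd_mult_normalize} poly"
  assumes irr: "irreducible P" and deg: "degree P > 0" and ndvd: "\<not> P dvd H"
  obtains A B r where "r \<noteq> 0" "A * P + B * H = [:r:]"
proof -
  define I where "I = {A * P + B * H | A B. True}"
  have I_diff: "x - y * z \<in> I" if xz: "x \<in> I" "z \<in> I" for x y z
  proof -
    obtain a b c d where "x = a * P + b * H" "z = c * P + d * H" using xz unfolding I_def by blast
    hence "x - y * z = (a - y * c) * P + (b - y * d) * H" by (simp add: algebra_simps)
    thus ?thesis unfolding I_def by blast
  qed
  have PI: "P \<in> I" unfolding I_def by (intro CollectI exI[of _ 1] exI[of _ 0]) simp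
  have HI: "H \<in> I" unfolding I_def by (intro CollectI exI[of _ 1] exI[of _ 0]) simp
  have smult_I: "Polynomial.smult a x \<in> I" if x: "x \<in> I" for a x
  proof -
    obtain c d where "x = c * P + d * H" using x unfolding I_def by blast
    hence "Polynomial.smult a x = Polynomial.smult a c * P + Polynomial.smult a d * H"
      by (simp add: smult_add_right)
    thus ?thesis unfolding I_def by blast
  qed
  have P0: "P \<noteq> 0" using irr by auto
  obtain T where T: "T \<in> I" "T \<noteq> 0" "\<And>x. x \<in> I \<Longrightarrow> x \<noteq> 0 \<Longrightarrow> degree T \<le> degree x"
    using ex_has_least_nat[of "\<lambda>x. x \<in> I \<and> x \<noteq> 0" P degree] PI P0 by blast
  have div: "\<exists>c Q. c \<noteq> 0 \<and> [:c:] * x = T * Q" if "x \<in> I" for x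
  proof -
    obtain c Q where cQ: "c \<noteq> 0" "Polynomial.smult c x = T * Q + pseudo_mod x T"
      using pseudo_mod(1)[OF T(2), of x] by auto
    have "pseudo_mod x T = Polynomial.smult c x - Q * T" using cQ(2) by (simp add: mult.commute)
    hence "pseudo_mod x T \<in> I" using I_diff smult_I that T(1) by metis
    moreover have "pseudo_mod x T = 0 \<or> degree (pseudo_mod x T) < degree T"
      by (rule pseudo_mod(2)[OF T(2)])
    ultimately have "pseudo_mod x T = 0" using T(3) by (meson not_le)
    thus ?thesis using cQ by auto
  qed
  have prime: "prime_elem P" using irr by (rule irreducible_imp_prime_elem)
  have not_dvd_const: "\<not> P dvd [:c:]" if "c \<noteq> 0" for c
    using dvd_imp_degree_le[of P "[:c:]"] that deg by auto
  obtain c Q where cQ: "c \<noteq> 0" "[:c:] * P = T * Q" using div[OF PI] by auto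
  have "\<not> P dvd T"
  proof
    assume "P dvd T"
    obtain c' Q' where cQ': "c' \<noteq> 0" "[:c':] * H = T * Q'" using div[OF HI] by auto
    hence "P dvd [:c':] * H" using \<open>P dvd T\<close> by (metis dvd_mult2)
    thus False using prime_elem_dvd_multD[OF prime] not_dvd_const[OF cQ'(1)] ndvd by blast
  qed
  hence "P dvd Q" using prime_elem_dvd_multD[OF prime, of T Q] cQ(2) by (metis dvd_triv_right)
  then obtain Q' where "Q = P * Q'" by (rule dvdE)
  hence "P * [:c:] = P * (T * Q')" using cQ(2) by (simp add: mult_ac)
  hence "[:c:] = T * Q'" using P0 by (metis mult_left_cancel)
  moreover from this have "T \<noteq> 0" "Q' \<noteq> 0" using cQ(1) by auto
  ultimately have "degree T + degree Q' = 0" by (metis degree_mult_eq degree_pCons_0)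
  hence "degree T = 0" by simp
  then obtain r where r: "T = [:r:]" by (metis degree_eq_zeroE)
  obtain A B where "T = A * P + B * H" using T(1) unfolding I_def by auto
  moreover have "r \<noteq> 0" using T(2) r by auto
  ultimately show ?thesis using that[of r A B] r by metis
qed

text \<open>An induction invariant for adjoining one variable: members of \<open>E\<close> are ring
  homomorphisms to the complex numbers fixing the constants \<open>\<iota> c\<close>, they separate
  elements from 0, and the Nullstellensatz holds for every irreducible element.\<close>

definition point_evaluations :: "('a :: comm_ring_1 \<Rightarrow> complex) set \<Rightarrow> (complex \<Rightarrow> 'a) \<Rightarrow> bool" where
  "point_evaluations E \<iota> \<longleftrightarrow> (\<forall>e\<in>E. comm_ring_hom e \<and> (\<forall>c. e (\<iota> c) = c)) \<and>
    (\<forall>r. r \<noteq> 0 \<longrightarrow> (\<exists>e\<in>E. e r \<noteq> 0)) \<and>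
    (\<forall>p h. irreducible p \<longrightarrow> (\<forall>e\<in>E. e p = 0 \<longrightarrow> e h = 0) \<longrightarrow> p dvd h)"

text \<open>For a nonconstant \<open>P\<close> not dividing \<open>H\<close>, elimination gives a
  nonzero \<open>r\<close> in the ideal of both, while the fundamental theorem of algebra provides a
  common zero of \<open>P\<close> and \<open>H\<close> over a point where \<open>r\<close> does not
  vanish. A constant \<open>P\<close> is compared with \<open>H\<close> coefficient by
  coefficient.\<close>

lemma point_evaluations_poly:
  fixes E :: "('a :: {factorial_ring_gcd, semiring_gcd_mult_normalize} \<Rightarrow> complex) set"
  assumes E: "point_evaluations E \<iota>"
  shows "point_evaluations ((\<lambda>(e, c) P. e (poly P (\<iota> c))) ` (E \<times> UNIV)) (\<lambda>c. [:\<iota> c:])"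
  unfolding point_evaluations_def
proof (intro conjI allI ballI impI)
  let ?E = "((\<lambda>(e, c) P. e (poly P (\<iota> c))) ` (E \<times> UNIV))"
  have hom: "comm_ring_hom e" if "e \<in> E" for e using E that unfolding point_evaluations_def by blast
  have \<iota>: "e (\<iota> c) = c" if "e \<in> E" for e c using E that unfolding point_evaluations_def by blast
  have eval: "e (poly P (\<iota> c)) = poly (map_poly e P) c" if "e \<in> E" for e c P
  proof -
    interpret comm_ring_hom e using hom[OF that] .
    show ?thesis using poly_map_poly[of P "\<iota> c"] \<iota>[OF that] by simp
  qed
  fix e' assume "e' \<in> ?E"
  then obtain e c where e: "e \<in> E" "e' = (\<lambda>P. e (poly P (\<iota> c)))" by auto
  interpret comm_ring_hom e using hom[OF e(1)] .
  show "comm_ring_hom e'" unfolding e(2) by unfold_locales (auto simp: hom_distribs)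
  show "e' [:\<iota> c':] = c'" for c' unfolding e(2) using \<iota>[OF e(1)] by simp
next
  let ?E = "((\<lambda>(e, c) P. e (poly P (\<iota> c))) ` (E \<times> UNIV))"
  have hom: "comm_ring_hom e" if "e \<in> E" for e using E that unfolding point_evaluations_def by blast
  have \<iota>: "e (\<iota> c) = c" if "e \<in> E" for e c using E that unfolding point_evaluations_def by blast
  have eval: "e (poly P (\<iota> c)) = poly (map_poly e P) c" if "e \<in> E" for e c P
  proof -
    interpret comm_ring_hom e using hom[OF that] .
    show ?thesis using poly_map_poly[of P "\<iota> c"] \<iota>[OF that] by simp
  qed
  have coeff_e: "coeff (map_poly e P) i = e (coeff P i)" if "e \<in> E" for e P i
  proof -
    interpret comm_ring_hom e using hom[OF that] .
    show ?thesis by (simp add: coeff_map_poly)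
  qed
  have sep: "\<exists>e\<in>E. e r \<noteq> 0" if "r \<noteq> 0" for r using E that unfolding point_evaluations_def by blast
  have zero: "map_poly e P = 0" if "e \<in> E" "\<And>c. e (poly P (\<iota> c)) = 0" for e P
    using poly_all_0_iff_0[of "map_poly e P"] that eval by auto
  show "\<exists>e\<in>?E. e r \<noteq> 0" if "r \<noteq> 0" for r
  proof -
    have "lead_coeff r \<noteq> 0" using that by simp
    then obtain e where e: "e \<in> E" "e (lead_coeff r) \<noteq> 0" using sep by blast
    hence "map_poly e r \<noteq> 0" using coeff_e by (metis coeff_0)
    hence "\<exists>c. e (poly r (\<iota> c)) \<noteq> 0" using zero[OF e(1), of r] by metis
    thus ?thesis using e(1) by auto
  qed
  fix P H :: "'a poly"
  assume irr: "irreducible P" and van: "\<forall>e\<in>?E. e P = 0 \<longrightarrow> e H = 0"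
  have van': "e (poly H (\<iota> c)) = 0" if "e \<in> E" "e (poly P (\<iota> c)) = 0" for e c
    using van that by auto
  show "P dvd H"
  proof (cases "degree P = 0")
    case True
    then obtain p where p: "P = [:p:]" by (metis degree_eq_zeroE)
    have "p dvd coeff H i" for i
    proof -
      have "irreducible p" using irr unfolding p by (simp add: prime_elem_const_poly_iff irreducible_const_poly_iff)
      moreover have "e (coeff H i) = 0" if "e \<in> E" "e p = 0" for e
      proof -
        have "map_poly e H = 0" using that van' by (intro zero) (auto simp: p)
        thus ?thesis using coeff_e[OF that(1)] by (metis coeff_0)
      qed
      ultimately show ?thesis using E unfolding point_evaluations_def by blast
    qed
    thus ?thesis unfolding p by (simp add: const_poly_dvd_iff)
  next
    case False
    show ?thesis
    proof (rule ccontr)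
      assume ndvd: "\<not> P dvd H"
      have "degree P > 0" using False by simp
      from irreducible_poly_elimination[OF irr this ndvd]
      obtain A B r where r: "r \<noteq> 0" "A * P + B * H = [:r:]" by metis
      have "lead_coeff P \<noteq> 0" using irr by auto
      \<comment> \<open>One evaluation has to keep both factors nonzero: the leading coefficient so
        that the specialised \<open>P\<close> stays nonconstant and has a root, and \<open>r\<close>
        so that this root is a contradiction.\<close>
      hence "lead_coeff P * r \<noteq> 0" using r(1) by simp
      then obtain e where e: "e \<in> E" "e (lead_coeff P * r) \<noteq> 0" using sep by blast
      interpret comm_ring_hom e using hom[OF e(1)] .
      have lr: "e (lead_coeff P) \<noteq> 0" "e r \<noteq> 0" using e(2) by (auto simp: hom_distribs)
      have "degree (map_poly e P) \<noteq> 0"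
        using le_degree[of "map_poly e P" "degree P"] lr(1) coeff_e[OF e(1)] False by auto
      hence "\<not> constant (poly (map_poly e P))" by (simp add: constant_degree)
      then obtain c where "poly (map_poly e P) c = 0"
        using Fundamental_Theorem_Algebra.fundamental_theorem_of_algebra by blast
      hence "e (poly P (\<iota> c)) = 0" using eval[OF e(1)] by simp
      moreover from this have "e (poly H (\<iota> c)) = 0" by (rule van'[OF e(1)])
      moreover have "e (poly (A * P + B * H) (\<iota> c)) = e r" unfolding r(2) by simp
      ultimately show False using lr(2) by (simp add: hom_distribs)
    qed
  qed
qed

lemma point_evaluations_complex: "point_evaluations {id :: complex \<Rightarrow> complex} (\<lambda>c. c)"
  unfolding point_evaluations_def
proof (intro conjI ballI allI impI)
  show "comm_ring_hom e" if "e \<in> {id :: complex \<Rightarrow> complex}" for e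
    using that by unfold_locales auto
next
  fix p h :: complex assume "irreducible p"
  hence "p \<noteq> 0" by auto
  thus "p dvd h" by (intro dvdI[of _ _ "h / p"]) simp
qed auto

lemma point_evaluations_poly3:
  "point_evaluations (range (\<lambda>v P. eval3 P v)) (\<lambda>c. [:[:[:c:]:]:])"
proof -
  let ?E1 = "(\<lambda>(e, c) P. e (poly P c)) ` ({id :: complex \<Rightarrow> complex} \<times> UNIV)"
  let ?E2 = "(\<lambda>(e, c) P. e (poly P [:c:])) ` (?E1 \<times> UNIV)"
  let ?E3 = "(\<lambda>(e, c) P. e (poly P [:[:c:]:])) ` (?E2 \<times> UNIV)"
  have "?E3 = range (\<lambda>v P. eval3 P v)" (is "_ = ?R")
  proof (intro equalityI subsetI)
    fix f assume "f \<in> ?E3"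
    then obtain x y z :: complex where "f = (\<lambda>P. poly (poly (poly P [:[:z:]:]) [:y:]) x)" by auto
    hence "f = (\<lambda>P. eval3 P (vector [x, y, z]))" unfolding eval3_def by (simp add: vector_3)
    thus "f \<in> ?R" by blast
  next
    fix f assume "f \<in> ?R"
    then obtain v :: "complex^3" where f: "f = (\<lambda>P. poly (poly (poly P [:[:v $ 3:]:]) [:v $ 2:]) (v $ 1))"
      unfolding eval3_def by blast
    have "(\<lambda>P. poly P (v $ 1)) \<in> ?E1" by (auto simp: image_iff)
    hence "(\<lambda>P. poly (poly P [:v $ 2:]) (v $ 1)) \<in> ?E2"
      by (intro image_eqI[of _ _ "((\<lambda>P. poly P (v $ 1)), v $ 2)"]) auto
    thus "f \<in> ?E3"
      unfolding f by (intro image_eqI[of _ _ "((\<lambda>P. poly (poly P [:v $ 2:]) (v $ 1)), v $ 3)"]) auto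
  qed
  moreover have "point_evaluations ?E3 (\<lambda>c. [:[:[:c:]:]:])"
    by (rule point_evaluations_poly[OF point_evaluations_poly[OF point_evaluations_poly[OF point_evaluations_complex]]])
  ultimately show ?thesis by simp
qed

lemma eval3_hom: "comm_ring_hom (\<lambda>P. eval3 P v)"
  using point_evaluations_poly3 unfolding point_evaluations_def by blast

lemma eval3_nonzero_ex: "P \<noteq> 0 \<Longrightarrow> \<exists>v. eval3 P v \<noteq> 0"
  using point_evaluations_poly3 unfolding point_evaluations_def by blast

text \<open>The Nullstellensatz for an irreducible surface in affine 3-space, applied below mostly
  to cones over plane curves.\<close>

theorem study_lemma:
  assumes "irreducible P" "\<And>v. eval3 P v = 0 \<Longrightarrow> eval3 H v = 0"
  shows "P dvd H"
  using point_evaluations_poly3 assms unfolding point_evaluations_def by blast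

lemma eval3_simps [simp]:
  "eval3 0 v = 0" "eval3 1 v = 1" "eval3 (P + Q) v = eval3 P v + eval3 Q v"
  "eval3 (P - Q) v = eval3 P v - eval3 Q v" "eval3 (- P) v = - eval3 P v"
  "eval3 (P * Q) v = eval3 P v * eval3 Q v" "eval3 (P ^ k) v = eval3 P v ^ k"
  by (simp_all add: eval3_def)

lemma eval3_const [simp]: "eval3 [:[:[:c:]:]:] v = c" by (simp add: eval3_def)

lemma eval3_prod: "eval3 (prod f A) v = (\<Prod>i\<in>A. eval3 (f i) v)"
  by (induction A rule: infinite_finite_induct) auto

lemma poly3_eqI: "P = Q" if "\<And>v. eval3 P v = eval3 Q v"
  using eval3_nonzero_ex[of "P - Q"] that by auto

section \<open>Substitution into ternary polynomials\<close>

lemma vec3_eq_iff: "v = w \<longleftrightarrow> v $ 1 = w $ 1 \<and> v $ 2 = w $ 2 \<and> v $ 3 = w $ 3" for v w :: "'a^3"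
  by (simp add: Finite_Cartesian_Product.vec_eq_iff forall_3)

lemma map_poly_pCons_0: "f 0 = 0 \<Longrightarrow> map_poly f (pCons a p) = pCons (f a) (map_poly f p)"
  by (rule poly_eqI) (simp add: coeff_map_poly coeff_pCons split: nat.split)

text \<open>Substitution of three elements of a commutative ring, with \<open>\<iota>\<close>
  embedding the coefficients. Linear changes of coordinates, the Gauss map and restriction to a line
  are all instances, and \<open>hom_psubst\<close> relates each of them to evaluation.\<close>

definition psubst :: "(complex \<Rightarrow> 'b :: comm_ring_1) \<Rightarrow> 'b \<Rightarrow> 'b \<Rightarrow> 'b \<Rightarrow> poly3 \<Rightarrow> 'b" where
  "psubst \<iota> X Y Z F = poly (map_poly (\<lambda>g. poly (map_poly (\<lambda>u. poly (map_poly \<iota> u) X) g) Y) F) Z"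

lemma comm_ring_hom_poly_map_poly:
  assumes "comm_ring_hom h"
  shows "comm_ring_hom (\<lambda>p. poly (map_poly h p) x)"
proof -
  interpret comm_ring_hom h by fact
  interpret m: map_poly_comm_ring_hom h ..
  show ?thesis by unfold_locales (simp_all add: m.hom_add m.hom_mult m.hom_uminus)
qed

lemma hom_poly_map_poly:
  assumes "comm_ring_hom h" "comm_ring_hom g"
  shows "h (poly (map_poly g p) x) = poly (map_poly (\<lambda>c. h (g c)) p) (h x)"
proof -
  interpret h: comm_ring_hom h by fact
  interpret g: comm_ring_hom g by fact
  show ?thesis by (simp add: h.poly_map_poly[symmetric] map_poly_map_poly o_def)
qed

lemma hom_psubst:
  assumes h: "comm_ring_hom h" and \<iota>: "comm_ring_hom \<iota>"
  shows "h (psubst \<iota> X Y Z F) = psubst (\<lambda>c. h (\<iota> c)) (h X) (h Y) (h Z) F"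
  unfolding psubst_def
  by (subst hom_poly_map_poly, rule h, (intro comm_ring_hom_poly_map_poly \<iota>),
      subst hom_poly_map_poly, rule h, (intro comm_ring_hom_poly_map_poly \<iota>),
      subst hom_poly_map_poly, rule h, rule \<iota>, rule refl)

lemma comm_ring_hom_id: "comm_ring_hom (\<lambda>c. c)"
  by unfold_locales auto

lemma eval3_eq_psubst: "eval3 F v = psubst (\<lambda>c. c) (v $ 1) (v $ 2) (v $ 3) F"
proof -
  have h1: "comm_ring_hom (\<lambda>p. poly p (v $ 1))" by unfold_locales auto
  have h2: "comm_ring_hom (\<lambda>p. poly (poly p [:v $ 2:]) (v $ 1))" by unfold_locales auto
  have id: "map_poly (\<lambda>c. c) p = p" for p :: "'a :: zero poly" by (simp add: map_poly_idI)
  have e2: "poly (poly g [:v $ 2:]) (v $ 1) = poly (map_poly (\<lambda>u. poly u (v $ 1)) g) (v $ 2)" for g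
    using hom_poly_map_poly[OF h1 comm_ring_hom_id, of g "[:v $ 2:]"] by (simp add: id)
  have "eval3 F v = poly (map_poly (\<lambda>g. poly (poly g [:v $ 2:]) (v $ 1)) F) (v $ 3)"
    using hom_poly_map_poly[OF h2 comm_ring_hom_id, of F "[:[:v $ 3:]:]"] by (simp add: id eval3_def)
  thus ?thesis unfolding psubst_def id e2 .
qed

lemma eval3_smult [simp]: "eval3 (Polynomial.smult c F) v = poly (poly c [:v $ 2:]) (v $ 1) * eval3 F v"
  by (simp add: eval3_def)

abbreviation const3 :: "complex \<Rightarrow> poly3" where "const3 c \<equiv> [:[:[:c:]:]:]"

definition coord :: "3 \<Rightarrow> poly3" where
  "coord i = (if i = 1 then [:[:[:0, 1:]:]:] else if i = 2 then [:[:0, 1:]:] else [:0, 1:])"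

lemma eval3_coord [simp]: "eval3 (coord i) v = v $ i"
  using exhaust_3[of i] by (auto simp: coord_def eval3_def)

lemma comm_ring_hom_const3: "comm_ring_hom const3"
  by unfold_locales (auto simp: one_pCons)

lemma eval3_psubst:
  "eval3 (psubst const3 X Y Z F) v = eval3 F (vector [eval3 X v, eval3 Y v, eval3 Z v])"
  by (subst hom_psubst[OF eval3_hom comm_ring_hom_const3]) (simp add: eval3_eq_psubst[of F] vector_3)

section \<open>Linear forms and linear changes of coordinates\<close>

definition linear_form :: "complex^3 \<Rightarrow> poly3" where
  "linear_form w = (\<Sum>i\<in>UNIV. const3 (w $ i) * coord i)"

lemma eval3_linear_form [simp]: "eval3 (linear_form w) v = w $ 1 * v $ 1 + w $ 2 * v $ 2 + w $ 3 * v $ 3"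
  by (simp add: linear_form_def sum_3)

definition linear_subst :: "complex^3^3 \<Rightarrow> poly3 \<Rightarrow> poly3" where
  "linear_subst A = psubst const3 (linear_form (A $ 1)) (linear_form (A $ 2)) (linear_form (A $ 3))"

lemma eval3_linear_subst [simp]: "eval3 (linear_subst A F) v = eval3 F (A *v v)"
proof -
  have "A *v v = vector [eval3 (linear_form (A $ 1)) v, eval3 (linear_form (A $ 2)) v, eval3 (linear_form (A $ 3)) v]"
    by (simp add: vec3_eq_iff matrix_vector_mult_def sum_3 vector_3)
  thus ?thesis by (simp add: linear_subst_def eval3_psubst)
qed

lemma linear_subst_linear_subst: "linear_subst B (linear_subst A F) = linear_subst (A ** B) F"
  by (rule poly3_eqI) (simp add: matrix_vector_mul_assoc)

lemma linear_subst_id [simp]: "linear_subst (Finite_Cartesian_Product.mat 1) F = F"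
  by (rule poly3_eqI) simp

lemma linear_subst_mult: "linear_subst A (F * G) = linear_subst A F * linear_subst A G"
  by (rule poly3_eqI) simp

lemma linear_subst_1 [simp]: "linear_subst A 1 = 1"
  by (rule poly3_eqI) simp

lemma linear_subst_0 [simp]: "linear_subst A 0 = 0"
  by (rule poly3_eqI) simp

lemma is_unit_linear_subst: "is_unit F \<Longrightarrow> is_unit (linear_subst A F)"
  by (metis dvdE dvdI linear_subst_mult linear_subst_1)

text \<open>Substitution by an invertible matrix is a ring automorphism, so it preserves units and
  factorisations.\<close>

lemma irreducible_linear_subst:
  assumes "A ** B = Finite_Cartesian_Product.mat 1" "B ** A = Finite_Cartesian_Product.mat 1" "irreducible F"
  shows "irreducible (linear_subst A F)"
proof (rule irreducibleI)
  have inv: "linear_subst B (linear_subst A G) = G" "linear_subst A (linear_subst B G) = G" for G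
    using assms by (simp_all add: linear_subst_linear_subst)
  show "linear_subst A F \<noteq> 0" using inv(1)[of F] assms(3) by (metis linear_subst_0 not_irreducible_zero)
  show "\<not> is_unit (linear_subst A F)"
    using is_unit_linear_subst[of "linear_subst A F" B] inv(1) irreducible_not_unit[OF assms(3)] by metis
  fix a b assume "linear_subst A F = a * b"
  hence "F = linear_subst B a * linear_subst B b" using inv(1)[of F] by (simp add: linear_subst_mult)
  hence "is_unit (linear_subst B a) \<or> is_unit (linear_subst B b)"
    using assms(3) irreducibleD by blast
  thus "is_unit a \<or> is_unit b" using is_unit_linear_subst inv(2) by metis
qed

lemma is_unit_poly3_iff: "is_unit (P :: poly3) \<longleftrightarrow> (\<exists>c. c \<noteq> 0 \<and> P = const3 c)"
proof
  assume "is_unit P"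
  thus "\<exists>c. c \<noteq> 0 \<and> P = const3 c"
    unfolding is_unit_poly_iff by (metis dvd_0_left zero_neq_one)
next
  assume "\<exists>c. c \<noteq> 0 \<and> P = const3 c"
  thus "is_unit P" by (auto simp: is_unit_poly_iff dvd_field_iff)
qed

subsection \<open>Derivatives\<close>

lemma DERIV_poly2:
  fixes q :: "complex poly poly"
  assumes "DERIV x t :> x'" "DERIV y t :> y'"
  shows "DERIV (\<lambda>t. poly (poly q [:y t:]) (x t)) t :>
    poly (poly (map_poly pderiv q) [:y t:]) (x t) * x' + poly (poly (pderiv q) [:y t:]) (x t) * y'"
proof (induction q)
  case 0
  show ?case by simp
next
  case (pCons a q)
  show ?case
    by (rule DERIV_cong, (simp del: mult_pCons_left),
      (rule derivative_intros DERIV_chain2[OF poly_DERIV] assms pCons.IH)+)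
      (simp add: map_poly_pCons_0 pderiv_pCons algebra_simps)
qed

lemma DERIV_eval3:
  assumes "DERIV x t :> x'" "DERIV y t :> y'" "DERIV z t :> z'"
  shows "DERIV (\<lambda>t. eval3 F (vector [x t, y t, z t])) t :>
    gradient F (vector [x t, y t, z t]) $ 1 * x' + gradient F (vector [x t, y t, z t]) $ 2 * y' +
    gradient F (vector [x t, y t, z t]) $ 3 * z'"
proof (induction F)
  case 0
  show ?case by (simp add: gradient_def vector_3)
next
  case (pCons a F)
  have "DERIV (\<lambda>t. poly (poly a [:y t:]) (x t) + z t * eval3 F (vector [x t, y t, z t])) t :>
    poly (poly (map_poly pderiv a) [:y t:]) (x t) * x' + poly (poly (pderiv a) [:y t:]) (x t) * y' +
    (z' * eval3 F (vector [x t, y t, z t]) + (gradient F (vector [x t, y t, z t]) $ 1 * x' +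
    gradient F (vector [x t, y t, z t]) $ 2 * y' + gradient F (vector [x t, y t, z t]) $ 3 * z') * z t)"
    by (intro DERIV_add DERIV_mult DERIV_poly2 assms pCons.IH)
  moreover have "eval3 (pCons a F) (vector [x t, y t, z t]) =
      poly (poly a [:y t:]) (x t) + z t * eval3 F (vector [x t, y t, z t])" for t
    by (simp add: eval3_def vector_3)
  ultimately show ?case
    by (simp add: gradient_def vector_3 eval3_def map_poly_pCons_0 pderiv_pCons algebra_simps)
qed

definition dot :: "complex^3 \<Rightarrow> complex^3 \<Rightarrow> complex" where
  "dot u v = u $ 1 * v $ 1 + u $ 2 * v $ 2 + u $ 3 * v $ 3"

lemma vector3_eta: "vector [v $ 1, v $ 2, v $ 3] = (v :: complex^3)"
  by (simp add: vec3_eq_iff vector_3)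

lemma DERIV_eval3_line:
  "DERIV (\<lambda>t. eval3 F (u + t *s w)) t :> dot (gradient F (u + t *s w)) w"
proof -
  have "DERIV (\<lambda>t. eval3 F (vector [u $ 1 + t * w $ 1, u $ 2 + t * w $ 2, u $ 3 + t * w $ 3])) t :>
    dot (gradient F (vector [u $ 1 + t * w $ 1, u $ 2 + t * w $ 2, u $ 3 + t * w $ 3])) w"
    unfolding dot_def by (rule DERIV_eval3) (auto intro!: derivative_eq_intros)
  moreover have "vector [u $ 1 + t * w $ 1, u $ 2 + t * w $ 2, u $ 3 + t * w $ 3] = u + t *s w" for t
    by (simp add: vec3_eq_iff vector_3)
  ultimately show ?thesis by simp
qed

text \<open>The chain rule, tested on the coordinate directions. The transpose is the reason why
  dual objects change contragrediently.\<close>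

lemma gradient_linear_subst:
  "gradient (linear_subst A F) v = transpose A *v gradient F (A *v v)"
proof -
  have "dot (gradient (linear_subst A F) v) w = dot (gradient F (A *v v)) (A *v w)" for w
  proof -
    have "DERIV (\<lambda>t. eval3 (linear_subst A F) (v + t *s w)) 0 :> dot (gradient (linear_subst A F) v) w"
      using DERIV_eval3_line[of "linear_subst A F" v w 0] by simp
    moreover have "DERIV (\<lambda>t. eval3 F (A *v v + t *s (A *v w))) 0 :> dot (gradient F (A *v v)) (A *v w)"
      using DERIV_eval3_line[of F "A *v v" "A *v w" 0] by simp
    moreover have "eval3 (linear_subst A F) (v + t *s w) = eval3 F (A *v v + t *s (A *v w))" for t
      by (simp add: matrix_vector_right_distrib vector_scalar_commute)
    ultimately show ?thesis using DERIV_unique by simp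
  qed
  note d = this
  have "dot g (A *v axis i 1) = (transpose A *v g) $ i" for g i
    by (simp add: dot_def matrix_vector_mult_def transpose_def sum_3 axis_def if_distrib cong: if_cong)
      (use exhaust_3[of i] in auto)
  moreover have "dot g (axis i 1) = g $ i" for g i
    using exhaust_3[of i] by (auto simp: dot_def axis_def)
  ultimately show ?thesis
    unfolding Finite_Cartesian_Product.vec_eq_iff using d by metis
qed

subsection \<open>Forms\<close>

lemma eval3_sum_coeff3:
  "eval3 F v = (\<Sum>k\<le>degree F. \<Sum>j\<le>degree (coeff F k). \<Sum>i\<le>degree (coeff (coeff F k) j).
    coeff3 F i j k * (v $ 1 ^ i * v $ 2 ^ j * v $ 3 ^ k))"
  unfolding eval3_def coeff3_def
  by (simp add: poly_altdef[of F] poly_altdef[of "coeff F _"] poly_altdef[of "coeff (coeff F _) _"]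
    poly_sum poly_power sum_distrib_left sum_distrib_right mult_ac)

lemma form_eval3:
  assumes "form n F"
  shows "eval3 F (c *s v) = c ^ n * eval3 F v"
proof -
  have scale: "coeff3 F i j k * ((c * v $ 1) ^ i * (c * v $ 2) ^ j * (c * v $ 3) ^ k) =
      c ^ n * (coeff3 F i j k * (v $ 1 ^ i * v $ 2 ^ j * v $ 3 ^ k))" for i j k
  proof (cases "coeff3 F i j k = 0")
    case False
    hence "n = i + j + k" using assms unfolding form_def by auto
    thus ?thesis by (simp add: power_add power_mult_distrib)
  qed simp
  show ?thesis
    unfolding eval3_sum_coeff3 sum_distrib_left
    by (intro sum.cong refl) (simp only: vector_smult_component scale)
qed

text \<open>Doubling the argument multiplies a monomial of degree d by 2^d, and these factors are
  distinct, so an eigenvector of doubling has monomials of one degree only. This detects homogeneity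
  from values instead of coefficients.\<close>

lemma form_if_eval3_double:
  assumes "G \<noteq> 0" "\<And>v. eval3 G (2 *s v) = \<kappa> * eval3 G v"
  shows "\<exists>d. form d G"
proof -
  define s1 :: "complex poly \<Rightarrow> complex poly" where "s1 = (\<lambda>r. pcompose r [:0, 2:])"
  define s2 :: "complex poly poly \<Rightarrow> complex poly poly" where "s2 = (\<lambda>q. pcompose (map_poly s1 q) [:0, 2:])"
  \<comment> \<open>The polynomial of \<open>G\<close> at the doubled argument, built layer by layer
    so that its coefficients can be read off.\<close>
  define G2 where "G2 = pcompose (map_poly s2 G) [:0, 2:]"
  have s0: "s1 0 = 0" "s2 0 = 0" by (simp_all add: s1_def s2_def)
  have c1: "coeff (s1 r) i = 2 ^ i * coeff r i" for r i
    by (simp add: s1_def coeff_pcompose_linear)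
  have two: "(2 :: complex poly) ^ j = [:2 ^ j:]" "(2 :: complex poly poly) ^ j = [:[:2 ^ j:]:]" for j
  proof -
    show "(2 :: complex poly) ^ j = [:2 ^ j:]" "(2 :: complex poly poly) ^ j = [:[:2 ^ j:]:]"
      by (simp_all only: numeral_poly poly_const_pow)
  qed
  have c2: "coeff (coeff (s2 q) j) i = 2 ^ i * 2 ^ j * coeff (coeff q j) i" for q i j
    using s0 by (simp add: s2_def coeff_pcompose_linear coeff_map_poly c1 two mult_ac)
  have c3: "coeff3 G2 i j k = 2 ^ (i + j + k) * coeff3 G i j k" for i j k
    using s0 by (simp add: G2_def coeff3_def coeff_pcompose_linear coeff_map_poly c2 two power_add mult_ac)
  have h1: "comm_ring_hom s1" unfolding s1_def
    by unfold_locales (simp_all add: pcompose_add pcompose_mult)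
  have h2: "comm_ring_hom s2"
  proof -
    interpret s1: comm_ring_hom s1 by fact
    interpret m: map_poly_comm_ring_hom s1 ..
    show ?thesis unfolding s2_def by unfold_locales (simp_all add: pcompose_add pcompose_mult hom_distribs)
  qed
  have e1: "poly (s1 r) x = poly r (2 * x)" for r x by (simp add: s1_def poly_pcompose mult.commute)
  have g1: "comm_ring_hom (\<lambda>u. poly u x)" for x :: complex by unfold_locales auto
  have g2: "comm_ring_hom (\<lambda>u. poly (poly u [:y:]) x)" for x y :: complex by unfold_locales auto
  have id: "map_poly (\<lambda>c. c) p = p" for p :: "'a :: zero poly" by (simp add: map_poly_idI)
  have p2: "poly (poly q [:y:]) x = poly (map_poly (\<lambda>u. poly u x) q) y" for q and x y :: complex
    using hom_poly_map_poly[OF g1 comm_ring_hom_id, of q "[:y:]"] by (simp add: id)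
  have p3: "poly (poly (poly q [:[:z:]:]) [:y:]) x = poly (map_poly (\<lambda>u. poly (poly u [:y:]) x) q) z"
    for q and x y z :: complex
    using hom_poly_map_poly[OF g2 comm_ring_hom_id, of q "[:[:z:]:]"] by (simp add: id)
  have e2: "poly (poly (s2 q) [:y:]) x = poly (poly q [:2 * y:]) (2 * x)" for q x y
  proof -
    have "poly (poly (s2 q) [:y:]) x = poly (poly (map_poly s1 q) [:2 * y:]) x"
      by (simp add: s2_def poly_pcompose mult.commute numeral_poly)
    also have "\<dots> = poly (map_poly (\<lambda>u. poly (s1 u) x) q) (2 * y)"
      using hom_poly_map_poly[OF g1 h1] by simp
    finally show ?thesis by (simp add: e1 p2)
  qed
  have "eval3 G2 v = eval3 G (2 *s v)" for v
  proof -
    have "eval3 G2 v = poly (poly (poly (map_poly s2 G) [:[:2 * v $ 3:]:]) [:v $ 2:]) (v $ 1)"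
      by (simp add: eval3_def G2_def poly_pcompose mult.commute numeral_poly)
    also have "\<dots> = poly (map_poly (\<lambda>u. poly (poly (s2 u) [:v $ 2:]) (v $ 1)) G) (2 * v $ 3)"
      using hom_poly_map_poly[OF g2 h2] by simp
    finally show ?thesis by (simp add: e2 p3 eval3_def)
  qed
  hence "G2 = const3 \<kappa> * G" using assms(2) by (intro poly3_eqI) simp
  hence eq: "2 ^ (i + j + k) * coeff3 G i j k = \<kappa> * coeff3 G i j k" for i j k
    using c3[of i j k] by (auto simp: coeff3_def)
  have "\<exists>i j k. coeff3 G i j k \<noteq> 0"
    using assms(1) unfolding coeff3_def by (metis leading_coeff_0_iff)
  then obtain i j k where ijk: "coeff3 G i j k \<noteq> 0" by blast
  have "i' + j' + k' = i + j + k" if "coeff3 G i' j' k' \<noteq> 0" for i' j' k'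
  proof -
    have "(2 :: complex) ^ (i' + j' + k') = 2 ^ (i + j + k)"
      using eq[of i' j' k'] eq[of i j k] that ijk by simp
    hence "norm ((2 :: complex) ^ (i' + j' + k')) = norm ((2 :: complex) ^ (i + j + k))" by simp
    hence "(2 :: real) ^ (i' + j' + k') = 2 ^ (i + j + k)" by (simp only: norm_power norm_numeral)
    thus ?thesis by (simp only: power_inject_exp) 
  qed
  thus ?thesis using assms(1) unfolding form_def by blast
qed

lemma form_gradient_scale:
  assumes "form n F" "c \<noteq> 0" "n > 0"
  shows "gradient F (c *s v) = c ^ (n - 1) *s gradient F v"
proof -
  have "dot (gradient F (c *s v)) w = c ^ (n - 1) * dot (gradient F v) w" for w
  proof -
    have "DERIV (\<lambda>t. eval3 F (c *s v + t *s (c *s w))) 0 :> dot (gradient F (c *s v)) (c *s w)"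
      using DERIV_eval3_line[of F "c *s v" "c *s w" 0] by simp
    moreover have "DERIV (\<lambda>t. c ^ n * eval3 F (v + t *s w)) 0 :> c ^ n * dot (gradient F v) w"
      using DERIV_cmult[OF DERIV_eval3_line[of F v w 0]] by simp
    moreover have "eval3 F (c *s v + t *s (c *s w)) = c ^ n * eval3 F (v + t *s w)" for t
      by (subst form_eval3[OF assms(1), symmetric]) (simp add: algebra_simps)
    ultimately have "dot (gradient F (c *s v)) (c *s w) = c ^ n * dot (gradient F v) w"
      using DERIV_unique by simp
    moreover have "dot (gradient F (c *s v)) (c *s w) = c * dot (gradient F (c *s v)) w"
      by (simp add: dot_def algebra_simps)
    moreover have "c ^ n = c * c ^ (n - 1)" using assms(3) by (cases n) auto
    ultimately show ?thesis using assms(2) by simp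
  qed
  note d = this
  show ?thesis
    using d[of "axis 1 1"] d[of "axis 2 1"] d[of "axis 3 1"]
    by (simp add: vec3_eq_iff dot_def axis_def)
qed

lemma form_euler:
  assumes "form n F"
  shows "dot (gradient F v) v = of_nat n * eval3 F v"
proof -
  have "DERIV (\<lambda>t. eval3 F (v + t *s v)) 0 :> dot (gradient F v) v"
    using DERIV_eval3_line[of F v v 0] by simp
  moreover have "eval3 F (v + t *s v) = (1 + t) ^ n * eval3 F v" for t
    using form_eval3[OF assms, of "1 + t" v] by (simp add: algebra_simps)
  moreover have "DERIV (\<lambda>t. (1 + t) ^ n * eval3 F v) 0 :> of_nat n * eval3 F v"
    by (auto intro!: derivative_eq_intros)
  ultimately show ?thesis using DERIV_unique by simp
qed

lemma form_linear_subst: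
  assumes "form n F" "A ** B = Finite_Cartesian_Product.mat 1"
  shows "form n (linear_subst A F)"
proof -
  have ev: "eval3 (linear_subst A F) (c *s v) = c ^ n * eval3 (linear_subst A F) v" for c v
    by (simp add: vector_scalar_commute form_eval3[OF assms(1)])
  have F0: "F \<noteq> 0" using assms(1) unfolding form_def by simp
  have ne: "linear_subst A F \<noteq> 0"
  proof
    assume "linear_subst A F = 0"
    hence "linear_subst B (linear_subst A F) = 0" by simp
    thus False using F0 assms(2) by (simp add: linear_subst_linear_subst)
  qed
  then obtain d where d: "form d (linear_subst A F)"
    using form_if_eval3_double[of "linear_subst A F" "2 ^ n"] ev by blast
  obtain v where v: "eval3 (linear_subst A F) v \<noteq> 0" using eval3_nonzero_ex[OF ne] by blast
  have "(2 :: complex) ^ d = 2 ^ n" using form_eval3[OF d, of 2 v] ev[of 2 v] v by simp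
  hence "norm ((2 :: complex) ^ d) = norm ((2 :: complex) ^ n)" by simp
  hence "(2 :: real) ^ d = 2 ^ n" by (simp only: norm_power norm_numeral)
  hence "d = n" by (simp only: power_inject_exp)
  thus ?thesis using d by simp
qed

subsection \<open>Restriction to a line\<close>

definition line_poly :: "poly3 \<Rightarrow> complex^3 \<Rightarrow> complex^3 \<Rightarrow> complex poly" where
  "line_poly F u w = psubst (\<lambda>c. [:c:]) [:u $ 1, w $ 1:] [:u $ 2, w $ 2:] [:u $ 3, w $ 3:] F"

lemma comm_ring_hom_const_poly: "comm_ring_hom (\<lambda>c. [:c:])"
  by unfold_locales (auto simp: one_pCons)

lemma comm_ring_hom_poly_eval: "comm_ring_hom (\<lambda>p. poly p x)"
  by unfold_locales auto

lemma poly_line_poly: "poly (line_poly F u w) t = eval3 F (u + t *s w)"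
  unfolding line_poly_def
  by (subst hom_psubst[OF comm_ring_hom_poly_eval comm_ring_hom_const_poly])
    (simp add: eval3_eq_psubst)

lemma poly_pderiv_line_poly: "poly (pderiv (line_poly F u w)) t = dot (gradient F (u + t *s w)) w"
  using DERIV_unique[OF poly_DERIV[of "line_poly F u w" t]] DERIV_eval3_line[of F u w t]
  by (simp add: poly_line_poly[abs_def])

lemma poly_zero_if_zero_off_0:
  fixes p :: "complex poly"
  assumes "\<And>t. t \<noteq> 0 \<Longrightarrow> poly p t = 0"
  shows "p = 0"
proof -
  have "poly (p * [:0, 1:]) t = 0" for t using assms[of t] by (cases "t = 0") auto
  hence "p * [:0, 1:] = 0" using poly_all_0_iff_0 by blast
  thus ?thesis by simp
qed

lemma poly_bounded_cball:
  fixes p :: "complex poly"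
  obtains C where "C > 0" "\<And>t. norm t \<le> r \<Longrightarrow> norm (poly p t) \<le> C"
proof -
  have "bounded (poly p ` cball 0 r)"
    by (intro compact_imp_bounded compact_continuous_image continuous_intros compact_cball)
  then obtain C where "C > 0" "\<forall>x\<in>poly p ` cball 0 r. norm x \<le> C" using bounded_pos by blast
  thus ?thesis using that[of C] by auto
qed

text \<open>If the degree exceeded \<open>N\<close>, the reflected polynomial would tend to 0 at 0,
  although its value there is the leading coefficient.\<close>

lemma degree_le_if_growth:
  fixes p :: "complex poly"
  assumes "\<And>t. norm t \<ge> K \<Longrightarrow> norm (poly p t) \<le> C * norm t ^ N"
  shows "degree p \<le> N"
proof (rule ccontr)
  assume "\<not> degree p \<le> N"
  hence d: "degree p > N" by simp
  define K' where "K' = max K 1"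
  have K': "K' \<ge> K" "K' \<ge> 1" unfolding K'_def by auto
  have "((\<lambda>x. poly (reflect_poly p) x) \<longlongrightarrow> poly (reflect_poly p) 0) (at 0)"
    by (intro tendsto_intros)
  moreover have "((\<lambda>x. poly (reflect_poly p) x) \<longlongrightarrow> 0) (at 0)"
  proof (rule Lim_null_comparison)
    have "norm (poly (reflect_poly p) x) \<le> \<bar>C\<bar> * norm x ^ (degree p - N)" if "x \<noteq> 0" "norm x < 1 / K'" for x
    proof -
      have "norm x * K' < 1" using that K' by (simp add: pos_less_divide_eq)
      hence "norm (inverse x) \<ge> K'" using that K' by (simp add: norm_divide inverse_eq_divide pos_le_divide_eq mult.commute)
      hence "norm (poly p (inverse x)) \<le> C * norm (inverse x) ^ N" using assms K' by simp
      also have "\<dots> \<le> \<bar>C\<bar> * norm (inverse x) ^ N" by (intro mult_right_mono) auto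
      finally have "norm (poly (reflect_poly p) x) \<le> norm x ^ degree p * (\<bar>C\<bar> * norm (inverse x) ^ N)"
        using that by (simp add: poly_reflect_poly_nz norm_mult norm_power mult_left_mono)
      also have "norm x ^ degree p = norm x ^ (degree p - N) * norm x ^ N"
        using d by (simp flip: power_add)
      finally show ?thesis using that by (simp add: norm_divide power_divide field_simps)
    qed
    thus "\<forall>\<^sub>F x in at 0. norm (poly (reflect_poly p) x) \<le> \<bar>C\<bar> * norm x ^ (degree p - N)"
      unfolding eventually_at by (intro exI[of _ "1 / K'"]) (use K' in \<open>auto simp: dist_norm\<close>)
    have "((\<lambda>x::complex. \<bar>C\<bar> * norm x ^ (degree p - N)) \<longlongrightarrow> \<bar>C\<bar> * norm (0::complex) ^ (degree p - N)) (at 0)"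
      by (intro tendsto_intros)
    thus "((\<lambda>x::complex. \<bar>C\<bar> * norm x ^ (degree p - N)) \<longlongrightarrow> 0) (at 0)"
      using d by (simp add: power_0_left)
  qed
  ultimately have "poly (reflect_poly p) 0 = 0" using tendsto_unique by (metis at_neq_bot)
  hence "p = 0" by (simp add: poly_0_coeff_0)
  thus False using d by simp
qed

lemma line_poly_reverse:
  assumes "form n F" "t \<noteq> 0"
  shows "poly (line_poly F u w) t = t ^ n * poly (line_poly F w u) (1 / t)"
proof -
  have "u + t *s w = t *s (w + (1 / t) *s u)" using assms(2) by (simp add: vec3_eq_iff field_simps)
  thus ?thesis by (simp only: poly_line_poly form_eval3[OF assms(1)])
qed

text \<open>Interchanging \<open>u\<close> and \<open>w\<close> inverts the parameter, so growth at
  infinity is controlled by the values of the other polynomial on the unit disc.\<close>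

lemma degree_line_poly_le:
  assumes "form n F"
  shows "degree (line_poly F u w) \<le> n"
proof -
  obtain C where C: "C > 0" "\<And>t. norm t \<le> 1 \<Longrightarrow> norm (poly (line_poly F w u) t) \<le> C"
    using poly_bounded_cball by blast
  show ?thesis
  proof (rule degree_le_if_growth[of 1 _ C])
    fix t :: complex assume t: "norm t \<ge> 1"
    hence t': "t \<noteq> 0" "norm (1 / t) \<le> 1" by (auto simp: norm_divide divide_le_eq_1)
    have "norm (poly (line_poly F u w) t) = norm t ^ n * norm (poly (line_poly F w u) (1 / t))"
      by (simp only: line_poly_reverse[OF assms t'(1)] norm_mult norm_power)
    also have "\<dots> \<le> norm t ^ n * C" using C(2)[OF t'(2)] by (intro mult_left_mono) auto
    finally show "norm (poly (line_poly F u w) t) \<le> C * norm t ^ n" by (simp only: mult.commute)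
  qed
qed

lemma coeff_line_poly_top:
  assumes "form n F"
  shows "coeff (line_poly F u w) n = eval3 F w"
proof -
  let ?p = "line_poly F u w"
  \<comment> \<open>The reversal of \<open>?p\<close> with \<open>n\<close> taken as its degree; it
    agrees with \<open>line_poly F w u\<close> off 0, hence everywhere.\<close>
  define q where "q = (\<Sum>i\<le>n. monom (coeff ?p i) (n - i))"
  have "poly (q - line_poly F w u) t = 0" if "t \<noteq> 0" for t
  proof -
    have "poly q t = (\<Sum>i\<le>n. coeff ?p i * t ^ (n - i))" by (simp add: q_def poly_sum poly_monom)
    also have "\<dots> = t ^ n * (\<Sum>i\<le>n. coeff ?p i * (1 / t) ^ i)"
      unfolding sum_distrib_left by (intro sum.cong) (use that in \<open>auto simp: power_diff field_simps\<close>)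
    also have "(\<Sum>i\<le>n. coeff ?p i * (1 / t) ^ i) = poly ?p (1 / t)"
      by (rule poly_eq_sum_upto[OF degree_line_poly_le[OF assms], symmetric])
    also have "t ^ n * poly ?p (1 / t) = poly (line_poly F w u) t"
      using line_poly_reverse[OF assms that, of w u] by simp
    finally show ?thesis by simp
  qed
  hence "q = line_poly F w u" using poly_zero_if_zero_off_0[of "q - line_poly F w u"] by simp
  hence "poly q 0 = eval3 F w" by (simp add: poly_line_poly)
  moreover have "poly q 0 = (\<Sum>i\<le>n. if i = n then coeff ?p i else 0)"
    unfolding q_def poly_sum by (intro sum.cong) (auto simp: poly_monom)
  ultimately show ?thesis by simp
qed

subsection \<open>Irreducible forms\<close>

text \<open>Along the ray through \<open>v\<close> a multiple of \<open>F\<close> is divisible by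
  \<open>c ^ n\<close> while \<open>K\<close> scales by the smaller power \<open>c ^ j\<close>;
  comparing the two as polynomials in \<open>c\<close> at 0 leaves only the value 0.\<close>

lemma dvd_lower_degree_imp_0:
  assumes F: "form n F" and dvd: "F dvd K"
    and K: "\<And>c v. c \<noteq> 0 \<Longrightarrow> eval3 K (c *s v) = c ^ j * eval3 K v" and j: "j < n"
  shows "K = 0"
proof (rule poly3_eqI)
  fix v
  obtain Q where Q: "K = F * Q" using dvd by (rule dvdE)
  let ?q = "[:eval3 K v:] - monom (eval3 F v) (n - j) * line_poly Q 0 v"
  have "poly ?q c = 0" if "c \<noteq> 0" for c
  proof -
    have "c ^ j * eval3 K v = c ^ n * eval3 F v * eval3 Q (c *s v)"
      using K[OF that, of v] by (auto simp: Q form_eval3[OF F])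
    also have "c ^ n = c ^ j * c ^ (n - j)" using j by (simp flip: power_add)
    finally have "eval3 K v = c ^ (n - j) * eval3 F v * eval3 Q (c *s v)" using that by simp
    thus ?thesis by (simp add: poly_monom poly_line_poly mult_ac)
  qed
  hence "?q = 0" by (rule poly_zero_if_zero_off_0)
  hence "poly ?q 0 = 0" by simp
  thus "eval3 K v = eval3 0 v" using j by (simp add: poly_monom)
qed

lemma irreducible_dvd_prodD:
  assumes "irreducible (F :: poly3)" "finite A" "F dvd prod f A"
  shows "\<exists>x\<in>A. F dvd f x"
proof -
  have "prime_elem F" using assms(1) by (rule irreducible_imp_prime_elem)
  with assms(2,3) show ?thesis
    by (induction A rule: finite_induct) (auto dest: prime_elem_dvd_multD)
qed

text \<open>A vanishing derivative in direction \<open>w\<close> makes \<open>F\<close> a cone with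
  apex \<open>w\<close>, that is, a binary form in two linear forms \<open>X\<close> and
  \<open>Y\<close> vanishing at \<open>w\<close>. Over the complex numbers such a form splits into
  linear factors, which contradicts irreducibility in degree at least 2.\<close>

lemma cone_imp_apex_0:
  assumes irr: "irreducible F" and F: "form n F" and n: "n \<ge> 2"
    and w: "\<And>v. dot (gradient F v) w = 0"
  shows "w = 0"
proof (rule ccontr)
  assume "w \<noteq> 0"
  then obtain k where k: "w $ k \<noteq> 0" by (metis Finite_Cartesian_Product.vec_eq_iff zero_index)
  obtain i j where ij: "i \<noteq> j" "i \<noteq> k" "j \<noteq> k" "UNIV = {i, j, k}"
  proof -
    have "(UNIV :: 3 set) = {1, 2, 3}" using exhaust_3 by auto
    thus ?thesis using that[of 1 2] that[of 1 3] that[of 2 3] exhaust_3[of k] by (auto simp: insert_commute)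
  qed
  have const: "eval3 F (v + t *s w) = eval3 F v" for v t
  proof -
    have "poly (pderiv (line_poly F v w)) t = 0" for t by (simp add: poly_pderiv_line_poly w)
    hence "pderiv (line_poly F v w) = 0" using poly_all_0_iff_0 by blast
    hence "degree (line_poly F v w) = 0" by (simp add: pderiv_eq_0_iff)
    then obtain c where "line_poly F v w = [:c:]" by (metis degree_eq_zeroE)
    hence "poly (line_poly F v w) t = poly (line_poly F v w) 0" by simp
    thus ?thesis by (simp add: poly_line_poly)
  qed
  \<comment> \<open>Coordinates on the quotient by the span of \<open>w\<close>: dividing by
    \<open>w $ k\<close> makes both vanish at \<open>w\<close>.\<close>
  obtain X Y where X: "\<And>v. eval3 X v = v $ i - w $ i / w $ k * v $ k"
    and Y: "\<And>v. eval3 Y v = v $ j - w $ j / w $ k * v $ k"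
  proof
    show "eval3 (coord l - const3 (w $ l / w $ k) * coord k) v = v $ l - w $ l / w $ k * v $ k" for l v
      by simp
    thus "eval3 (coord j - const3 (w $ j / w $ k) * coord k) v = v $ j - w $ j / w $ k * v $ k" for v .
  qed
  let ?ei = "axis i 1 :: complex^3" and ?ej = "axis j 1 :: complex^3"
  let ?\<beta> = "line_poly F ?ej ?ei"
  have F_eq: "eval3 F v = eval3 Y v ^ n * poly ?\<beta> (eval3 X v / eval3 Y v)" if "eval3 Y v \<noteq> 0" for v
  proof -
    have e: "v + (- v $ k / w $ k) *s w = eval3 Y v *s (?ej + (eval3 X v / eval3 Y v) *s ?ei)"
    proof (subst Finite_Cartesian_Product.vec_eq_iff, rule allI)
      fix l
      have "l \<in> {i, j, k}" using ij(4) by auto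
      moreover have "(eval3 Y v *s (?ej + (eval3 X v / eval3 Y v) *s ?ei)) $ l =
          (if l = j then eval3 Y v else if l = i then eval3 X v else 0)"
        using ij(1) that by (auto simp: axis_def)
      ultimately show "(v + (- v $ k / w $ k) *s w) $ l = (eval3 Y v *s (?ej + (eval3 X v / eval3 Y v) *s ?ei)) $ l"
        using ij(1-3) k by (auto simp: X Y)
    qed
    have "eval3 F v = eval3 F (v + (- v $ k / w $ k) *s w)" by (simp only: const)
    thus ?thesis by (simp only: e form_eval3[OF F] poly_line_poly)
  qed
  have lin: "K = 0" if "F dvd K" "\<And>c v. eval3 K (c *s v) = c * eval3 K v" for K
    by (rule dvd_lower_degree_imp_0[OF F that(1), of 1]) (use n that(2) in auto)
  have Y0: "Y \<noteq> 0"
  proof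
    assume "Y = 0"
    hence "eval3 Y ?ej = 0" by simp
    thus False using ij(1-3) by (simp add: Y axis_def)
  qed
  have XY0: "X - const3 t * Y \<noteq> 0" for t
  proof
    assume "X - const3 t * Y = 0"
    hence "eval3 (X - const3 t * Y) ?ei = 0" by (simp only: eval3_simps)
    thus False using ij(1-3) by (simp add: X Y axis_def)
  qed
  have scale_Y: "eval3 Y (c *s v) = c * eval3 Y v" for c v
    by (simp add: Y algebra_simps)
  have scale_XY: "eval3 (X - const3 t * Y) (c *s v) = c * eval3 (X - const3 t * Y) v" for t c v
    by (simp add: X Y algebra_simps)
  show False
  proof (cases "?\<beta> = 0")
    case True
    hence "eval3 (F * Y) v = eval3 0 v" for v using F_eq[of v] by (cases "eval3 Y v = 0") auto
    hence "F * Y = 0" by (rule poly3_eqI)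
    thus False using Y0 F unfolding form_def by (metis mult_eq_0_iff)
  next
    case False
    let ?T = "{t. poly ?\<beta> t = 0}"
    have T: "finite ?T" using False by (rule poly_roots_finite)
    \<comment> \<open>At every zero of \<open>F\<close>, either \<open>Y\<close> vanishes or the
      ratio of \<open>X\<close> to \<open>Y\<close> is a root of the restriction, so
      \<open>F\<close> divides this product and hence a linear factor.\<close>
    let ?K = "Y * (\<Prod>t\<in>?T. X - const3 t * Y)"
    have "F dvd ?K"
    proof (rule study_lemma[OF irr])
      fix v assume Fv: "eval3 F v = 0"
      show "eval3 ?K v = 0"
      proof (cases "eval3 Y v = 0")
        case False
        define x where "x = eval3 X v / eval3 Y v"
        have "x \<in> ?T" using F_eq[OF False] Fv False unfolding x_def by simp
        moreover have "eval3 (X - const3 x * Y) v = 0" using False by (simp add: x_def)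
        ultimately have "(\<Prod>t\<in>?T. eval3 (X - const3 t * Y) v) = 0"
          by (intro prod_zero T bexI[of _ x])
        thus ?thesis by (subst eval3_simps(6), subst eval3_prod) simp
      next
        case True
        thus ?thesis by (subst eval3_simps(6)) simp
      qed
    qed
    hence "F dvd Y \<or> F dvd (\<Prod>t\<in>?T. X - const3 t * Y)"
      using irreducible_imp_prime_elem[OF irr] prime_elem_dvd_multD by blast
    hence "F dvd Y \<or> (\<exists>t. F dvd X - const3 t * Y)" using irreducible_dvd_prodD[OF irr T] by blast
    thus False
    proof (elim disjE exE)
      assume "F dvd Y"
      thus False using lin[OF _ scale_Y] Y0 by blast
    next
      fix t assume "F dvd X - const3 t * Y"
      thus False using lin[OF _ scale_XY] XY0[of t] by blast
    qed
  qed
qed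

subsection \<open>The equation of the dual curve\<close>

definition partial3 :: "poly3 \<Rightarrow> 3 \<Rightarrow> poly3" where
  "partial3 F i = (if i = 1 then map_poly (map_poly pderiv) F else if i = 2 then map_poly pderiv F else pderiv F)"

lemma eval3_partial3 [simp]: "eval3 (partial3 F i) v = gradient F v $ i"
  using exhaust_3[of i] by (auto simp: partial3_def gradient_def vector_3)

definition gauss_pullback :: "poly3 \<Rightarrow> poly3 \<Rightarrow> poly3" where
  "gauss_pullback F = psubst const3 (partial3 F 1) (partial3 F 2) (partial3 F 3)"

lemma eval3_gauss_pullback [simp]: "eval3 (gauss_pullback F H) v = eval3 H (gradient F v)"
  by (simp add: gauss_pullback_def eval3_psubst vector3_eta)

text \<open>Formulated on the whole affine cone, so at a point with zero gradient it demands that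
  \<open>H\<close> vanish at 0. For irreducible \<open>F\<close> this form is equivalent to
  divisibility of the pullback by \<open>F\<close>.\<close>

definition vanishes_on_dual :: "poly3 \<Rightarrow> poly3 \<Rightarrow> bool" where
  "vanishes_on_dual F H \<longleftrightarrow> (\<forall>v. eval3 F v = 0 \<longrightarrow> eval3 H (gradient F v) = 0)"

text \<open>\<open>G\<close> generates the ideal of all polynomials vanishing on the gradients; that
  this ideal is principal expresses that the dual is a curve.\<close>

definition dual_equation :: "poly3 \<Rightarrow> poly3 \<Rightarrow> bool" where
  "dual_equation F G \<longleftrightarrow> irreducible G \<and> (\<forall>H. vanishes_on_dual F H \<longleftrightarrow> G dvd H)"

text \<open>By Study's lemma, vanishing on the dual means that \<open>F\<close> divides the pullback
  under the Gauss map; primality of \<open>F\<close> does the rest.\<close>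

lemma vanishes_on_dual_mult:
  assumes "irreducible F"
  shows "vanishes_on_dual F (H * K) \<longleftrightarrow> vanishes_on_dual F H \<or> vanishes_on_dual F K"
proof -
  have iff: "vanishes_on_dual F H \<longleftrightarrow> F dvd gauss_pullback F H" for H
  proof
    assume "vanishes_on_dual F H"
    thus "F dvd gauss_pullback F H"
      by (intro study_lemma[OF assms]) (simp add: vanishes_on_dual_def)
  next
    assume "F dvd gauss_pullback F H"
    then obtain Q where "gauss_pullback F H = F * Q" by (rule dvdE)
    hence "eval3 H (gradient F v) = eval3 F v * eval3 Q v" for v
      by (metis eval3_gauss_pullback eval3_simps(6))
    thus "vanishes_on_dual F H" by (simp add: vanishes_on_dual_def)
  qed
  have "gauss_pullback F (H * K) = gauss_pullback F H * gauss_pullback F K"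
    by (rule poly3_eqI) simp
  thus ?thesis
    using prime_elem_dvd_mult_iff[OF irreducible_imp_prime_elem[OF assms]] by (simp add: iff)
qed

text \<open>Some irreducible factor of \<open>R\<close> inherits the vanishing. Units are excluded
  because the origin lies on the cone of \<open>F\<close>.\<close>

lemma vanishes_on_dual_ex_irreducible_factor:
  assumes irr: "irreducible F" and F0: "eval3 F 0 = 0" and R: "R \<noteq> 0" "vanishes_on_dual F R"
  shows "\<exists>G. irreducible G \<and> vanishes_on_dual F G"
proof -
  obtain M where M: "\<And>x. x \<in># M \<Longrightarrow> prime_elem x" "normalize (prod_mset M) = normalize R"
    using prime_factorization_exists[OF R(1)] by auto
  have unit: "\<not> vanishes_on_dual F 1" using F0 unfolding vanishes_on_dual_def by auto
  have "R dvd prod_mset M" using M(2) by (metis associatedD2 dvd_refl)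
  then obtain Q where "prod_mset M = R * Q" by (rule dvdE)
  hence "vanishes_on_dual F (prod_mset M)" using R(2) vanishes_on_dual_mult[OF irr] by simp
  hence "\<exists>x\<in>#M. vanishes_on_dual F x"
    by (induction M) (use unit vanishes_on_dual_mult[OF irr] in auto)
  thus ?thesis using M(1) prime_elem_imp_irreducible by blast
qed

text \<open>Degree at least 2 excludes lines, whose dual is a point and not a curve.\<close>

locale irreducible_form =
  fixes F :: poly3 and n :: nat
  assumes irr: "irreducible F" and form: "form n F" and n2: "n \<ge> 2"
begin

lemma prime: "prime_elem F"
  using irr by (rule irreducible_imp_prime_elem)

lemma eval3_0: "eval3 F 0 = 0"
  using form_eval3[OF form, of 0 0] n2 by (auto simp: power_0_left)

text \<open>Such a combination has degree \<open>n - 1\<close>, so divisibility by \<open>F\<close>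
  forces it to vanish and \<open>F\<close> to be a cone with apex \<open>w\<close>. Geometrically,
  the tangents do not all pass through one point.\<close>

lemma partial_combination_not_dvd:
  fixes w :: "complex^3"
  assumes "w \<noteq> 0"
  shows "\<not> F dvd const3 (w $ 1) * partial3 F 1 + const3 (w $ 2) * partial3 F 2 + const3 (w $ 3) * partial3 F 3"
    (is "\<not> F dvd ?K")
proof
  assume dvd: "F dvd ?K"
  have K: "eval3 ?K v = dot (gradient F v) w" for v
    by (simp add: dot_def mult.commute)
  have "?K = 0"
  proof (rule dvd_lower_degree_imp_0[OF form dvd])
    fix c :: complex and v assume "c \<noteq> 0"
    thus "eval3 ?K (c *s v) = c ^ (n - 1) * eval3 ?K v"
      unfolding K using form_gradient_scale[OF form, of c v] n2 by (simp add: dot_def algebra_simps)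
  qed (use n2 in auto)
  hence "dot (gradient F v) w = 0" for v using K[of v] by (simp only: eval3_simps)
  thus False using cone_imp_apex_0[OF irr form n2] assms by blast
qed

lemma partial3_not_dvd: "\<not> F dvd partial3 F i"
proof -
  let ?e = "axis i 1 :: complex^3"
  have "const3 (?e $ 1) * partial3 F 1 + const3 (?e $ 2) * partial3 F 2 + const3 (?e $ 3) * partial3 F 3 = partial3 F i"
    by (rule poly3_eqI) (use exhaust_3[of i] in \<open>auto simp: axis_def\<close>)
  moreover have "?e \<noteq> 0" by (simp add: axis_eq_0_iff)
  ultimately show ?thesis using partial_combination_not_dvd by metis
qed

lemma coord_not_dvd: "\<not> F dvd coord i"
proof
  assume "F dvd coord i"
  hence "coord i = 0" by (rule dvd_lower_degree_imp_0[OF form, of _ 1]) (use n2 in auto)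
  hence "eval3 (coord i) (axis i 1) = 0" by simp
  thus False by (simp add: axis_def)
qed

text \<open>\<open>F\<close> divides neither a partial derivative nor a coordinate, so by primality
  the vanishing may be tested away from their zeros. This permits division by them in
  applications.\<close>

lemma vanishes_on_dualI:
  assumes "\<And>v. eval3 F v = 0 \<Longrightarrow> gradient F v $ i \<noteq> 0 \<Longrightarrow> v $ j \<noteq> 0 \<Longrightarrow> eval3 H (gradient F v) = 0"
  shows "vanishes_on_dual F H"
proof -
  have "F dvd gauss_pullback F H * (partial3 F i * coord j)"
    by (rule study_lemma[OF irr]) (use assms in auto)
  hence "F dvd gauss_pullback F H"
    using prime_elem_dvd_mult_iff[OF prime] partial3_not_dvd coord_not_dvd by blast
  then obtain Q where "gauss_pullback F H = F * Q" by (rule dvdE)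
  hence "eval3 H (gradient F v) = eval3 F v * eval3 Q v" for v
    by (metis eval3_gauss_pullback eval3_simps(6))
  thus ?thesis by (simp add: vanishes_on_dual_def)
qed

lemma gradient_0: "gradient F 0 = 0"
proof -
  have "dot (gradient F 0) w = 0" for w
  proof -
    have "dot (gradient F 0) w = poly (pderiv (line_poly F 0 w)) 0" by (simp add: poly_pderiv_line_poly)
    also have "\<dots> = coeff (line_poly F 0 w) 1" by (simp add: poly_0_coeff_0 coeff_pderiv)
    also have "line_poly F 0 w = monom (eval3 F w) n"
    proof -
      have "poly (line_poly F 0 w) t = poly (monom (eval3 F w) n) t" for t
        by (simp add: poly_line_poly poly_monom form_eval3[OF form] mult.commute)
      thus ?thesis by (simp add: poly_eq_poly_eq_iff[symmetric] ext)
    qed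
    finally show ?thesis using n2 by simp
  qed
  from this[of "axis 1 1"] this[of "axis 2 1"] this[of "axis 3 1"]
  show ?thesis by (simp add: vec3_eq_iff dot_def axis_def)
qed

text \<open>Gradients scale by the power \<open>n - 1\<close>, so a root of \<open>c\<close> of that
  order rescales the point; for \<open>c = 0\<close> the origin serves.\<close>

lemma scaled_gradient:
  assumes "eval3 F v = 0"
  obtains v' where "eval3 F v' = 0" "gradient F v' = c *s gradient F v"
proof (cases "c = 0")
  case True
  thus ?thesis using that[of 0] eval3_0 gradient_0 by simp
next
  case False
  define b where "b = exp (Ln c / of_nat (n - 1))"
  have b: "b ^ (n - 1) = c"
    unfolding b_def using False n2 by (subst exp_of_nat_mult[symmetric]) simp
  hence "b \<noteq> 0" using False n2 by (auto simp: power_0_left)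
  hence "gradient F (b *s v) = c *s gradient F v" "eval3 F (b *s v) = 0"
    using form_gradient_scale[OF form, of b v] b n2 assms by (simp_all add: form_eval3[OF form])
  thus ?thesis using that by blast
qed

text \<open>Gradients can be rescaled to a fixed nonzero first component, so a relation
  \<open>r\<close> between the first two components would give their ratio only finitely many
  values. Then \<open>F\<close> would divide a linear combination of two partials.\<close>

lemma binary_not_vanishes_on_dual:
  assumes "r \<noteq> 0"
  shows "\<not> vanishes_on_dual F [:r:]"
proof
  assume van: "vanishes_on_dual F [:r:]"
  \<comment> \<open>The factor \<open>coord 1\<close> provides a value \<open>\<mu>\<close> of the
    first variable that is nonzero and at which \<open>r\<close> does not vanish
    identically.\<close>
  have "[:r:] * coord 1 \<noteq> 0"
  proof -
    have "coord 1 \<noteq> 0" by (simp add: coord_def)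
    thus ?thesis using assms by (metis mult_eq_0_iff pCons_eq_0_iff)
  qed
  then obtain v0 where v0: "eval3 ([:r:] * coord 1) v0 \<noteq> 0" using eval3_nonzero_ex by blast
  define \<mu> where "\<mu> = v0 $ 1"
  have \<mu>: "\<mu> \<noteq> 0" using v0 by (auto simp: \<mu>_def)
  define \<rho> where "\<rho> = map_poly (\<lambda>u. poly u \<mu>) r"
  have \<rho>: "poly \<rho> t = poly (poly r [:t:]) \<mu>" for t
    using hom_poly_map_poly[OF comm_ring_hom_poly_eval[of \<mu>] comm_ring_hom_id, of r "[:t:]"]
    by (simp add: \<rho>_def map_poly_idI)
  have "poly \<rho> (v0 $ 2) \<noteq> 0" using v0 by (auto simp: \<rho> \<mu>_def eval3_def)
  hence "\<rho> \<noteq> 0" by auto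
  hence fin: "finite {t. poly \<rho> t = 0}" by (rule poly_roots_finite)
  let ?L = "\<lambda>t. const3 \<mu> * partial3 F 2 - const3 t * partial3 F 1"
  have "F dvd partial3 F 1 * (\<Prod>t\<in>{t. poly \<rho> t = 0}. ?L t)"
  proof (rule study_lemma[OF irr])
    fix v assume v: "eval3 F v = 0"
    show "eval3 (partial3 F 1 * (\<Prod>t\<in>{t. poly \<rho> t = 0}. ?L t)) v = 0"
    proof (cases "gradient F v $ 1 = 0")
      case True
      thus ?thesis by (subst eval3_simps(6)) simp
    next
      case False
      let ?t = "\<mu> * gradient F v $ 2 / gradient F v $ 1"
      obtain v' where v': "eval3 F v' = 0" "gradient F v' = (\<mu> / gradient F v $ 1) *s gradient F v"
        using scaled_gradient[OF v] by blast
      hence "eval3 [:r:] (gradient F v') = 0" using van unfolding vanishes_on_dual_def by blast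
      hence "poly \<rho> ?t = 0" using False unfolding v'(2) by (simp add: eval3_def \<rho>)
      moreover have "eval3 (?L ?t) v = 0" using False by simp
      ultimately have "(\<Prod>t\<in>{t. poly \<rho> t = 0}. eval3 (?L t) v) = 0"
        by (intro prod_zero fin bexI[of _ ?t]) auto
      thus ?thesis by (subst eval3_simps(6), subst eval3_prod) simp
    qed
  qed
  hence "F dvd (\<Prod>t\<in>{t. poly \<rho> t = 0}. ?L t)"
    using prime_elem_dvd_mult_iff[OF prime] partial3_not_dvd by blast
  then obtain t where t: "F dvd ?L t" using irreducible_dvd_prodD[OF irr fin] by blast
  define w :: "complex^3" where "w = vector [- t, \<mu>, 0]"
  have eq: "?L t = const3 (w $ 1) * partial3 F 1 + const3 (w $ 2) * partial3 F 2 + const3 (w $ 3) * partial3 F 3"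
    by (rule poly3_eqI) (simp add: w_def vector_3)
  have "w \<noteq> 0" using \<mu> by (simp add: w_def vec3_eq_iff vector_3)
  from partial_combination_not_dvd[OF this] show False using t[unfolded eq] by contradiction
qed

text \<open>If \<open>G\<close> did not divide \<open>H\<close>, eliminating the third variable
  would yield a nonzero polynomial in two variables vanishing on the dual. A \<open>G\<close> free
  of that variable is excluded for the same reason.\<close>

lemma dual_equationI:
  assumes G: "irreducible G" "vanishes_on_dual F G"
  shows "dual_equation F G"
  unfolding dual_equation_def
proof (intro conjI allI iffI G(1))
  fix H assume "G dvd H"
  then obtain Q where "H = G * Q" by (rule dvdE)
  thus "vanishes_on_dual F H" using G(2) vanishes_on_dual_mult[OF irr] by simp
next
  fix H assume H: "vanishes_on_dual F H"
  show "G dvd H"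
  proof (rule ccontr)
    assume ndvd: "\<not> G dvd H"
    show False
    proof (cases "degree G = 0")
      case True
      then obtain r where "G = [:r:]" by (metis degree_eq_zeroE)
      thus False using binary_not_vanishes_on_dual[of r] G by auto
    next
      case False
      hence "degree G > 0" by simp
      from irreducible_poly_elimination[OF G(1) this ndvd]
      obtain A B r where r: "r \<noteq> 0" "A * G + B * H = [:r:]" by metis
      have "vanishes_on_dual F (A * G + B * H)" using G(2) H unfolding vanishes_on_dual_def by simp
      thus False using binary_not_vanishes_on_dual[OF r(1)] r(2) by simp
    qed
  qed
qed

text \<open>The set of gradients is stable under doubling, so \<open>G\<close> divides its own
  pullback under doubling; both are irreducible, hence differ by a constant, and this makes
  \<open>G\<close> homogeneous.\<close>

lemma dual_equation_form:
  assumes "dual_equation F G"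
  obtains d where "form d G" "d > 0"
proof -
  have G: "irreducible G" "vanishes_on_dual F G" using assms unfolding dual_equation_def by auto
  let ?S = "Finite_Cartesian_Product.mat 2 :: complex^3^3" and ?T = "Finite_Cartesian_Product.mat (1 / 2) :: complex^3^3"
  have S: "?S *v v = 2 *s v" for v by (simp add: vec3_eq_iff matrix_vector_mult_def sum_3 Finite_Cartesian_Product.mat_def)
  have ST: "?S ** ?T = Finite_Cartesian_Product.mat 1" "?T ** ?S = Finite_Cartesian_Product.mat 1"
    by (auto simp: Finite_Cartesian_Product.vec_eq_iff forall_3 matrix_matrix_mult_def sum_3 Finite_Cartesian_Product.mat_def)
  have "vanishes_on_dual F (linear_subst ?S G)"
    unfolding vanishes_on_dual_def
  proof (intro allI impI)
    fix v assume "eval3 F v = 0"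
    then obtain v' where "eval3 F v' = 0" "gradient F v' = 2 *s gradient F v" by (rule scaled_gradient)
    thus "eval3 (linear_subst ?S G) (gradient F v) = 0"
      using G(2) unfolding vanishes_on_dual_def by (metis S eval3_linear_subst)
  qed
  hence "G dvd linear_subst ?S G" using assms unfolding dual_equation_def by blast
  then obtain Q where Q: "linear_subst ?S G = G * Q" by (rule dvdE)
  have "irreducible (linear_subst ?S G)" using ST G(1) by (intro irreducible_linear_subst)
  hence "is_unit G \<or> is_unit Q" using Q irreducibleD by blast
  hence "is_unit Q" using irreducible_not_unit[OF G(1)] by blast
  then obtain c where c: "Q = const3 c" unfolding is_unit_poly3_iff by blast
  have "eval3 G (2 *s v) = c * eval3 G v" for v
    using arg_cong[OF Q, of "\<lambda>P. eval3 P v"] by (simp add: S c)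
  moreover have "G \<noteq> 0" using G(1) by auto
  ultimately obtain d where d: "form d G" using form_if_eval3_double by blast
  have "d > 0"
  proof (rule ccontr)
    assume "\<not> d > 0"
    hence "eval3 G v = eval3 G 0" for v using form_eval3[OF d, of 0 v] by simp
    hence "G = const3 (eval3 G 0)" by (intro poly3_eqI) simp
    hence "is_unit G" using \<open>G \<noteq> 0\<close> unfolding is_unit_poly3_iff by (metis pCons_0_0)
    thus False using irreducible_not_unit[OF G(1)] by blast
  qed
  thus ?thesis using that d by blast
qed

end

subsection \<open>The discriminant of the restriction to a line\<close>

text \<open>On the line with coordinates l lie the points (-l2, l1, 0) and (-l3, 0, l1), which
  parametrise it when l1 is nonzero. Here the \<open>coord i\<close> stand for these line
  coordinates, so the coefficients are polynomials in l.\<close>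

definition generic_line_poly :: "poly3 \<Rightarrow> poly3 poly" where
  "generic_line_poly F = psubst (\<lambda>c. [:const3 c:]) [:- coord 2, - coord 3:] [:coord 1:] [:0, coord 1:] F"

text \<open>The resultant of the restriction and its derivative, with formal degrees
  \<open>n\<close> and \<open>n - 1\<close>. It carries extra factors compared with the true
  discriminant, such as the leading coefficient, but these are constant on the pencil below.\<close>

definition line_discriminant :: "nat \<Rightarrow> poly3 \<Rightarrow> poly3" where
  "line_discriminant n F =
    Determinant.det (sylvester_mat_sub n (n - 1) (generic_line_poly F) (pderiv (generic_line_poly F)))"

lemma map_poly_generic_line_poly:
  "map_poly (\<lambda>P. eval3 P l) (generic_line_poly F) = line_poly F (vector [- l $ 2, l $ 1, 0]) (vector [- l $ 3, 0, l $ 1])"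
proof -
  interpret h: comm_ring_hom "\<lambda>P. eval3 P l" by (rule eval3_hom)
  interpret m: map_poly_comm_ring_hom "\<lambda>P. eval3 P l" ..
  have c: "comm_ring_hom (\<lambda>c. [:const3 c:])" by unfold_locales (auto simp: one_pCons)
  show ?thesis
    unfolding generic_line_poly_def line_poly_def
    by (subst hom_psubst[OF m.comm_ring_hom_axioms c]) (simp add: vector_3 map_poly_pCons_0)
qed

lemma map_poly_pderiv:
  assumes "comm_ring_hom h"
  shows "map_poly h (pderiv p) = pderiv (map_poly h p)"
proof -
  interpret comm_ring_hom h by fact
  show ?thesis by (rule poly_eqI) (simp add: coeff_pderiv coeff_map_poly hom_mult hom_of_nat del: of_nat_Suc)
qed

lemma eval3_line_discriminant:
  fixes F :: poly3 and l :: "complex^3"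
  defines "p \<equiv> line_poly F (vector [- l $ 2, l $ 1, 0]) (vector [- l $ 3, 0, l $ 1])"
  shows "eval3 (line_discriminant n F) l = Determinant.det (sylvester_mat_sub n (n - 1) p (pderiv p))"
proof -
  interpret h: comm_ring_hom "\<lambda>P. eval3 P l" by (rule eval3_hom)
  show ?thesis
    unfolding line_discriminant_def p_def
    by (subst h.hom_det[symmetric], subst sylvester_mat_sub_map)
      (simp_all add: map_poly_pderiv[OF eval3_hom] map_poly_generic_line_poly)
qed

lemma degree_pderiv_line_poly_le:
  "form n F \<Longrightarrow> degree (pderiv (line_poly F u w)) \<le> n - 1"
  using degree_line_poly_le[of n F u w] by (simp add: degree_pderiv)

section \<open>The pencil of lines through \<open>e\<^sub>3\<close>\<close>

definition e\<^sub>3 :: "complex^3" where "e\<^sub>3 = vector [0, 0, 1]"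

text \<open>The pencil consists of the lines x = a y, with line coordinates (1, -a, 0); the
  polynomial variable is z, at the point (a, 1, z).\<close>

definition pencil_poly :: "poly3 \<Rightarrow> complex \<Rightarrow> complex poly" where
  "pencil_poly F a = line_poly F (vector [a, 1, 0]) e\<^sub>3"

definition pencil_discriminant :: "nat \<Rightarrow> poly3 \<Rightarrow> complex poly" where
  "pencil_discriminant n F = line_poly (line_discriminant n F) (vector [1, 0, 0]) (vector [0, - 1, 0])"

lemma poly_pencil_poly: "poly (pencil_poly F a) z = eval3 F (vector [a, 1, z])"
proof -
  have "vector [a, 1, 0] + z *s e\<^sub>3 = (vector [a, 1, z] :: complex^3)"
    by (simp add: e\<^sub>3_def vec3_eq_iff vector_3)
  thus ?thesis by (simp add: pencil_poly_def poly_line_poly)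
qed

lemma poly_pderiv_pencil_poly: "poly (pderiv (pencil_poly F a)) z = gradient F (vector [a, 1, z]) $ 3"
proof -
  have "vector [a, 1, 0] + z *s e\<^sub>3 = (vector [a, 1, z] :: complex^3)"
    by (simp add: e\<^sub>3_def vec3_eq_iff vector_3)
  thus ?thesis by (simp add: pencil_poly_def poly_pderiv_line_poly) (simp add: dot_def e\<^sub>3_def vector_3)
qed

lemma poly_line_poly_pencil:
  "poly (line_poly H (vector [1, 0, 0]) (vector [0, - 1, 0])) a = eval3 H (vector [1, - a, 0])"
proof -
  have "vector [1, 0, 0] + a *s vector [0, - 1, 0] = (vector [1, - a, 0] :: complex^3)"
    by (simp add: vec3_eq_iff vector_3)
  thus ?thesis by (simp add: poly_line_poly)
qed

lemma poly_pencil_discriminant: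
  "poly (pencil_discriminant n F) a =
    Determinant.det (sylvester_mat_sub n (n - 1) (pencil_poly F a) (pderiv (pencil_poly F a)))"
  by (simp add: pencil_discriminant_def poly_line_poly_pencil eval3_line_discriminant vector_3
      pencil_poly_def e\<^sub>3_def)

lemma split_if_coprime_pderiv:
  fixes p :: "complex poly"
  assumes "\<And>z. poly p z = 0 \<Longrightarrow> poly (pderiv p) z \<noteq> 0"
  obtains z where "inj_on z {..<degree p}"
    "p = Polynomial.smult (lead_coeff p) (\<Prod>i<degree p. [:- z i, 1:])"
proof -
  have sq: "rsquarefree p" using assms rsquarefree_roots by blast
  hence "p \<noteq> 0" by (simp add: rsquarefree_def)
  hence fin: "finite {z. poly p z = 0}" by (rule poly_roots_finite)
  note dec = complex_poly_decompose_rsquarefree[OF sq]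
  have "degree p = degree (\<Prod>z|poly p z = 0. [:- z, 1:])"
    using \<open>p \<noteq> 0\<close> by (subst dec[symmetric]) simp
  also have "\<dots> = card {z. poly p z = 0}"
    by (subst degree_prod_eq_sum_degree) auto
  finally have card: "degree p = card {z. poly p z = 0}" .
  obtain h where h: "bij_betw h {0..<degree p} {z. poly p z = 0}"
    using ex_bij_betw_nat_finite[OF fin] card by auto
  hence "(\<Prod>z|poly p z = 0. [:- z, 1:]) = (\<Prod>i<degree p. [:- h i, 1:])"
    using prod.reindex_bij_betw[OF h, of "\<lambda>z. [:- z, 1:]"] by (simp add: atLeast0LessThan)
  thus ?thesis using that[of h] h dec by (simp add: bij_betw_def atLeast0LessThan)
qed

lemma pencil_discriminant_common_root:
  assumes "form n F" "n \<ge> 2" "poly (pencil_poly F a) z = 0" "poly (pderiv (pencil_poly F a)) z = 0"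
  shows "poly (pencil_discriminant n F) a = 0"
  unfolding poly_pencil_discriminant
  by (rule det_sylvester_mat_sub_common_root[OF _ _ _ assms(3,4)])
    (use assms(1,2) degree_line_poly_le degree_pderiv_line_poly_le in \<open>auto simp: pencil_poly_def\<close>)

lemma degree_pencil_poly:
  assumes "form n F" "eval3 F e\<^sub>3 \<noteq> 0"
  shows "degree (pencil_poly F a) = n" "lead_coeff (pencil_poly F a) = eval3 F e\<^sub>3"
proof -
  have "coeff (pencil_poly F a) n = eval3 F e\<^sub>3"
    unfolding pencil_poly_def by (rule coeff_line_poly_top[OF assms(1)])
  thus "degree (pencil_poly F a) = n"
    using degree_line_poly_le[OF assms(1)] assms(2) le_degree
    by (metis le_antisym pencil_poly_def)
  thus "lead_coeff (pencil_poly F a) = eval3 F e\<^sub>3" using \<open>coeff (pencil_poly F a) n = eval3 F e\<^sub>3\<close> by simp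
qed

text \<open>The second alternative serves to prove that the discriminant is nonzero somewhere; the
  first applies at every parameter where it does not vanish.\<close>

lemma pencil_discriminant_split:
  assumes F: "form n F" "n \<ge> 2" "eval3 F e\<^sub>3 \<noteq> 0" and a: "poly (pencil_discriminant n F) a \<noteq> 0 \<or>
    (\<forall>z. poly (pencil_poly F a) z = 0 \<longrightarrow> poly (pderiv (pencil_poly F a)) z \<noteq> 0)"
  obtains z where "inj_on z {..<n}"
    "pencil_poly F a = Polynomial.smult (eval3 F e\<^sub>3) (\<Prod>i<n. [:- z i, 1:])"
    "poly (pencil_discriminant n F) a = eval3 F e\<^sub>3 ^ (n - 1) * (\<Prod>i<n. poly (pderiv (pencil_poly F a)) (z i))"
proof -
  have "poly (pderiv (pencil_poly F a)) z \<noteq> 0" if "poly (pencil_poly F a) z = 0" for z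
    using a pencil_discriminant_common_root[OF F(1,2) that] that by blast
  then obtain z where z: "inj_on z {..<n}"
    "pencil_poly F a = Polynomial.smult (eval3 F e\<^sub>3) (\<Prod>i<n. [:- z i, 1:])"
    using split_if_coprime_pderiv[of "pencil_poly F a"] degree_pencil_poly[OF F(1,3)] by metis
  have "poly (pencil_discriminant n F) a = eval3 F e\<^sub>3 ^ (n - 1) * (\<Prod>i<n. poly (pderiv (pencil_poly F a)) (z i))"
    unfolding poly_pencil_discriminant
    by (rule det_sylvester_mat_sub_split[OF z(1) _ _ z(2)])
      (use F(1,2) degree_pderiv_line_poly_le in \<open>auto simp: pencil_poly_def\<close>)
  thus ?thesis using that z by blast
qed

lemma continuous_on_eval3: "continuous_on S (eval3 P)"
proof -
  have "continuous_on S (\<lambda>v. eval3 P v)"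
    unfolding eval3_sum_coeff3 by (intro continuous_intros)
  thus ?thesis by simp
qed

lemma norm_vector3_le: "norm (vector [x, y, z] :: complex^3) \<le> norm x + norm y + norm z"
  unfolding norm_vec_def by (rule order.trans[OF L2_set_le_sum]) (auto simp: sum_3 vector_3)

lemma eval3_bounded:
  obtains M where "M > 0" "\<And>v. norm v \<le> r \<Longrightarrow> norm (eval3 P v) \<le> M"
proof -
  have "bounded (eval3 P ` cball 0 r)"
    by (intro compact_imp_bounded compact_continuous_image continuous_on_eval3 compact_cball)
  then obtain M where "M > 0" "\<forall>x\<in>eval3 P ` cball 0 r. norm x \<le> M" using bounded_pos by blast
  thus ?thesis using that[of M] by auto
qed

context irreducible_form
begin

text \<open>On the tangent line at \<open>v\<close> the restriction of \<open>F\<close> has a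
  multiple root: \<open>v\<close> lies on the line by Euler's identity, and the direction of the
  line is orthogonal to the gradient.\<close>

lemma vanishes_on_dual_discriminant: "vanishes_on_dual F (line_discriminant n F)"
proof (rule vanishes_on_dualI[where i = 1 and j = 2])
  fix v assume v: "eval3 F v = 0" "gradient F v $ 1 \<noteq> 0" "v $ 2 \<noteq> 0"
  define l where "l = gradient F v"
  let ?u = "vector [- l $ 2, l $ 1, 0] :: complex^3" and ?w = "vector [- l $ 3, 0, l $ 1] :: complex^3"
  have euler: "l $ 1 * v $ 1 + l $ 2 * v $ 2 + l $ 3 * v $ 3 = 0"
    using form_euler[OF form, of v] v(1) by (simp add: dot_def l_def)
  \<comment> \<open>Solving for \<open>v\<close> in the parametrisation of its tangent gives the
    parameter \<open>v $ 3 / v $ 2\<close>, which is why the coordinate 2 is kept nonzero.\<close>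
  have pt: "?u + (v $ 3 / v $ 2) *s ?w = (l $ 1 / v $ 2) *s v"
  proof -
    have "l $ 2 * v $ 2 = (l $ 1 * v $ 1 + l $ 2 * v $ 2 + l $ 3 * v $ 3) - (l $ 1 * v $ 1 + l $ 3 * v $ 3)"
      by simp
    hence "- (l $ 2 * v $ 2) = l $ 1 * v $ 1 + l $ 3 * v $ 3" unfolding euler by simp
    note e = this
    show ?thesis using v(3) by (simp add: vec3_eq_iff vector_3 field_simps) (rule e)
  qed
  have c: "l $ 1 / v $ 2 \<noteq> 0" using v by (simp add: l_def)
  have "dot (gradient F ((l $ 1 / v $ 2) *s v)) ?w = 0"
    using form_gradient_scale[OF form c, of v] n2 by (simp add: dot_def vector_3 flip: l_def)
  moreover have "eval3 F ((l $ 1 / v $ 2) *s v) = 0" using v(1) by (simp add: form_eval3[OF form])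
  ultimately have "eval3 (line_discriminant n F) l = 0"
    unfolding eval3_line_discriminant
    using degree_line_poly_le[OF form] degree_pderiv_line_poly_le[OF form] n2
    by (intro det_sylvester_mat_sub_common_root[of _ _ _ _ "v $ 3 / v $ 2"])
      (auto simp: poly_line_poly poly_pderiv_line_poly pt)
  thus "eval3 (line_discriminant n F) (gradient F v) = 0" by (simp add: l_def)
qed

text \<open>Eliminating z from \<open>F\<close> and its z-derivative leaves a nonzero polynomial in
  x and y. On the pencil line through a point where both it and y are nonzero, \<open>F\<close> has
  only simple roots.\<close>

lemma pencil_discriminant_nonzero:
  assumes e3: "eval3 F e\<^sub>3 \<noteq> 0"
  shows "pencil_discriminant n F \<noteq> 0"
proof -
  have deg: "degree F > 0"
  proof (rule ccontr)
    assume "\<not> degree F > 0"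
    then obtain f where "F = [:f:]" by (metis degree_eq_zeroE gr0I)
    hence "eval3 F e\<^sub>3 = eval3 F 0" by (simp add: eval3_def e\<^sub>3_def vector_3)
    thus False using e3 eval3_0 by simp
  qed
  have "\<not> F dvd pderiv F" using partial3_not_dvd[of 3] by (simp add: partial3_def)
  from irreducible_poly_elimination[OF irr deg this]
  obtain A B r where r: "r \<noteq> 0" "A * F + B * pderiv F = [:r:]" by metis
  have "coord 2 \<noteq> 0" by (simp add: coord_def)
  hence "[:r:] * coord 2 \<noteq> 0" using r(1) by (metis mult_eq_0_iff pCons_eq_0_iff)
  then obtain v where v: "eval3 ([:r:] * coord 2) v \<noteq> 0" using eval3_nonzero_ex by blast
  have y: "v $ 2 \<noteq> 0" and rv: "poly (poly r [:v $ 2:]) (v $ 1) \<noteq> 0" using v by auto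
  define a where "a = v $ 1 / v $ 2"
  have no: "poly (pderiv (pencil_poly F a)) z \<noteq> 0" if z: "poly (pencil_poly F a) z = 0" for z
  proof
    assume z': "poly (pderiv (pencil_poly F a)) z = 0"
    let ?v = "vector [v $ 1, v $ 2, v $ 2 * z] :: complex^3"
    have s: "?v = v $ 2 *s vector [a, 1, z]" using y by (simp add: vec3_eq_iff vector_3 a_def)
    have "eval3 F ?v = 0" using z unfolding s form_eval3[OF form] by (simp add: poly_pencil_poly)
    moreover have "eval3 (pderiv F) ?v = 0"
    proof -
      have "eval3 (pderiv F) ?v = gradient F ?v $ 3" by (simp add: gradient_def vector_3)
      also have "\<dots> = v $ 2 ^ (n - 1) * gradient F (vector [a, 1, z]) $ 3"
        unfolding s using form_gradient_scale[OF form y] n2 by simp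
      finally show ?thesis using z' by (simp add: poly_pderiv_pencil_poly)
    qed
    ultimately have "eval3 (A * F + B * pderiv F) ?v = 0" by simp
    thus False using rv unfolding r(2) by (simp add: eval3_def vector_3)
  qed
  then obtain z where z: "inj_on z {..<n}"
    "pencil_poly F a = Polynomial.smult (eval3 F e\<^sub>3) (\<Prod>i<n. [:- z i, 1:])"
    "poly (pencil_discriminant n F) a = eval3 F e\<^sub>3 ^ (n - 1) * (\<Prod>i<n. poly (pderiv (pencil_poly F a)) (z i))"
    using pencil_discriminant_split[OF form n2 e3, of a] by blast
  have "poly (pencil_poly F a) (z i) = 0" if "i < n" for i
    using that unfolding z(2) by (auto simp: poly_prod)
  hence "poly (pencil_discriminant n F) a \<noteq> 0" using no e3 unfolding z(3) by auto
  thus ?thesis by auto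
qed

lemma ex_dual_equation_if_eval3_e3:
  assumes "eval3 F e\<^sub>3 \<noteq> 0"
  obtains G where "dual_equation F G"
proof -
  have "line_discriminant n F \<noteq> 0"
    using pencil_discriminant_nonzero[OF assms]
    by (metis eval3_simps(1) pencil_discriminant_def poly_line_poly poly_all_0_iff_0)
  then obtain G where "irreducible G" "vanishes_on_dual F G"
    using vanishes_on_dual_ex_irreducible_factor[OF irr eval3_0] vanishes_on_dual_discriminant by blast
  thus ?thesis using that dual_equationI by blast
qed

text \<open>For large z the point (a, 1, z) divided by z is close to \<open>e\<^sub>3\<close>, and
  \<open>F\<close> has no zeros there.\<close>

lemma pencil_root_bound:
  assumes e3: "eval3 F e\<^sub>3 \<noteq> 0"
  obtains K where "K \<ge> 1" "\<And>a z. poly (pencil_poly F a) z = 0 \<Longrightarrow> norm z \<le> K * (1 + norm a)"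
proof -
  have "isCont (eval3 F) e\<^sub>3" using continuous_on_eval3[of UNIV F] by (simp add: continuous_on_eq_continuous_at)
  then obtain \<delta> where \<delta>: "\<delta> > 0" "\<And>v. dist v e\<^sub>3 < \<delta> \<Longrightarrow> eval3 F v \<noteq> 0"
    using continuous_at_avoid[of e\<^sub>3 "eval3 F" 0] e3 by (metis dist_commute)
  define K where "K = max 1 (3 / \<delta>)"
  have K: "K \<ge> 1" "K * \<delta> \<ge> 3" using \<delta>(1) by (auto simp: K_def max_def field_simps)
  have "norm z \<le> K * (1 + norm a)" if z: "poly (pencil_poly F a) z = 0" for a z
  proof (rule ccontr)
    assume "\<not> ?thesis"
    hence big: "norm z > K + K * norm a" by (simp add: algebra_simps)
    have "0 \<le> K * norm a" using K(1) by simp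
    hence zK: "norm z > K" "norm z > K * norm a" "norm z > 0" using big K(1) by linarith+
    have "dist (vector [a / z, 1 / z, 1]) e\<^sub>3 = norm (vector [a / z, 1 / z, 0] :: complex^3)"
      by (simp add: dist_norm e\<^sub>3_def vec3_eq_iff vector_3 arg_cong[where f = norm])
    also have "\<dots> \<le> norm a / norm z + 1 / norm z"
      using norm_vector3_le[of "a / z" "1 / z" 0] by (simp add: norm_divide)
    also have "\<dots> < 1 / K + 1 / K"
      using zK K(1) by (intro add_strict_mono) (auto simp: field_simps)
    also have "\<dots> \<le> \<delta>" using K \<delta>(1) by (simp add: field_simps)
    finally have "eval3 F (vector [a / z, 1 / z, 1]) \<noteq> 0" using \<delta>(2) by simp
    moreover have "vector [a, 1, z] = z *s (vector [a / z, 1 / z, 1] :: complex^3)"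
      using zK by (simp add: vec3_eq_iff vector_3)
    ultimately show False using z zK by (simp add: poly_pencil_poly form_eval3[OF form])
  qed
  thus ?thesis using that K(1) by blast
qed

text \<open>Dividing the point by \<open>1 + norm a\<close> moves it into a fixed ball, and the
  derivative is homogeneous of degree \<open>n - 1\<close>.\<close>

lemma pencil_pderiv_bound:
  assumes e3: "eval3 F e\<^sub>3 \<noteq> 0"
  obtains M where "M > 0" "\<And>a z. poly (pencil_poly F a) z = 0 \<Longrightarrow>
    norm (poly (pderiv (pencil_poly F a)) z) \<le> M * (1 + norm a) ^ (n - 1)"
proof -
  obtain K where K: "K \<ge> 1" "\<And>a z. poly (pencil_poly F a) z = 0 \<Longrightarrow> norm z \<le> K * (1 + norm a)"
    using pencil_root_bound[OF e3] by blast
  obtain M where M: "M > 0" "\<And>v. norm v \<le> 2 + K \<Longrightarrow> norm (eval3 (pderiv F) v) \<le> M"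
    using eval3_bounded[of "2 + K" "pderiv F"] by blast
  have "norm (poly (pderiv (pencil_poly F a)) z) \<le> M * (1 + norm a) ^ (n - 1)"
    if "poly (pencil_poly F a) z = 0" for a z
  proof -
    define c where "c = 1 + norm a"
    have c: "c > 0" "norm a \<le> c" "1 \<le> c" "norm z \<le> K * c" using K(2)[OF that] by (auto simp: c_def add_pos_nonneg)
    let ?c = "of_real c :: complex"
    have "vector [a, 1, z] = ?c *s (vector [a / ?c, 1 / ?c, z / ?c] :: complex^3)"
      using c by (simp add: vec3_eq_iff vector_3)
    hence "poly (pderiv (pencil_poly F a)) z = ?c ^ (n - 1) * gradient F (vector [a / ?c, 1 / ?c, z / ?c]) $ 3"
      using form_gradient_scale[OF form, of ?c] c n2 by (simp add: poly_pderiv_pencil_poly)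
    also have "gradient F v $ 3 = eval3 (pderiv F) v" for v by (simp add: gradient_def vector_3)
    finally have "norm (poly (pderiv (pencil_poly F a)) z) =
        c ^ (n - 1) * norm (eval3 (pderiv F) (vector [a / ?c, 1 / ?c, z / ?c]))"
      using c by (simp add: norm_mult norm_power)
    moreover have "norm (vector [a / ?c, 1 / ?c, z / ?c] :: complex^3) \<le> 2 + K"
    proof -
      have "norm (a / ?c) \<le> 1" "norm (1 / ?c) \<le> 1" "norm (z / ?c) \<le> K"
        using c by (auto simp: norm_divide divide_le_eq)
      thus ?thesis using norm_vector3_le[of "a / ?c" "1 / ?c" "z / ?c"] by simp
    qed
    ultimately have "norm (poly (pderiv (pencil_poly F a)) z) \<le> c ^ (n - 1) * M"
      using M(2) c by (simp add: mult_left_mono)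
    thus ?thesis by (simp only: mult.commute c_def)
  qed
  thus ?thesis using that M(1) by blast
qed

text \<open>The product formula has \<open>n\<close> factors, each growing at most like the power
  \<open>n - 1\<close> of the parameter.\<close>

lemma degree_pencil_discriminant_le:
  assumes e3: "eval3 F e\<^sub>3 \<noteq> 0"
  shows "degree (pencil_discriminant n F) \<le> n * (n - 1)"
proof -
  obtain M where M: "M > 0" "\<And>a z. poly (pencil_poly F a) z = 0 \<Longrightarrow>
      norm (poly (pderiv (pencil_poly F a)) z) \<le> M * (1 + norm a) ^ (n - 1)"
    using pencil_pderiv_bound[OF e3] by blast
  define c where "c = norm (eval3 F e\<^sub>3 ^ (n - 1)) * (M * 2 ^ (n - 1)) ^ n"
  show ?thesis
  proof (rule degree_le_if_growth[of 1 _ c])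
    fix a :: complex assume a: "norm a \<ge> 1"
    show "norm (poly (pencil_discriminant n F) a) \<le> c * norm a ^ (n * (n - 1))"
    proof (cases "poly (pencil_discriminant n F) a = 0")
      case True
      have "c \<ge> 0" using M(1) by (simp add: c_def)
      thus ?thesis using True by simp
    next
      case False
      then obtain z where z: "inj_on z {..<n}"
        "pencil_poly F a = Polynomial.smult (eval3 F e\<^sub>3) (\<Prod>i<n. [:- z i, 1:])"
        "poly (pencil_discriminant n F) a = eval3 F e\<^sub>3 ^ (n - 1) * (\<Prod>i<n. poly (pderiv (pencil_poly F a)) (z i))"
        using pencil_discriminant_split[OF form n2 e3, of a] by blast
      have "norm (poly (pderiv (pencil_poly F a)) (z i)) \<le> M * 2 ^ (n - 1) * norm a ^ (n - 1)" if "i < n" for i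
      proof -
        have "poly (pencil_poly F a) (z i) = 0" using that unfolding z(2) by (auto simp: poly_prod)
        from M(2)[OF this] have "norm (poly (pderiv (pencil_poly F a)) (z i)) \<le> M * (1 + norm a) ^ (n - 1)" .
        also have "\<dots> \<le> M * (2 * norm a) ^ (n - 1)"
          using a M(1) by (intro mult_left_mono power_mono) auto
        finally show ?thesis by (simp add: power_mult_distrib)
      qed
      hence "(\<Prod>i<n. norm (poly (pderiv (pencil_poly F a)) (z i))) \<le> (\<Prod>i<n. M * 2 ^ (n - 1) * norm a ^ (n - 1))"
        by (intro prod_mono) auto
      also have "\<dots> = (M * 2 ^ (n - 1)) ^ n * norm a ^ (n * (n - 1))"
        by (simp add: power_mult_distrib mult.commute flip: power_mult)
      finally show ?thesis
        unfolding z(3) c_def norm_mult prod_norm[symmetric] mult.assoc by (intro mult_left_mono) auto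
    qed
  qed
qed

end

section \<open>From local vanishing orders to the degree of the dual curve\<close>

text \<open>If the order were below \<open>s\<close>, the cofactor would tend to 0 at a point where
  it does not vanish. Real exponents are allowed since individual roots contribute fractional
  powers.\<close>

lemma order_ge_if_powr_bound:
  fixes p :: "complex poly"
  assumes p: "p \<noteq> 0" and "\<epsilon> > 0"
    and bound: "\<And>x. 0 < dist x a \<Longrightarrow> dist x a < \<epsilon> \<Longrightarrow> norm (poly p x) \<le> C * dist x a powr s"
  shows "s \<le> real (order a p)"
proof (rule ccontr)
  assume "\<not> ?thesis"
  hence s: "s - real (order a p) > 0" by simp
  obtain q where q: "p = [:- a, 1:] ^ order a p * q" "\<not> [:- a, 1:] dvd q"
    using order_decomp[OF p] by blast
  have "((\<lambda>x. poly q x) \<longlongrightarrow> 0) (at a)"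
  proof (rule Lim_null_comparison)
    have "norm (poly q x) \<le> C * dist x a powr (s - real (order a p))" if "0 < dist x a" "dist x a < \<epsilon>" for x
    proof -
      have "dist x a ^ order a p * norm (poly q x) = norm (poly p x)"
        by (subst q(1)) (simp add: norm_mult norm_power dist_norm)
      also have "\<dots> \<le> C * dist x a powr s" by (rule bound[OF that])
      also have "dist x a powr s = dist x a ^ order a p * dist x a powr (s - real (order a p))"
        using that(1) by (simp add: powr_realpow[symmetric] flip: powr_add)
      finally show ?thesis using that(1) by (simp add: mult.left_commute)
    qed
    thus "\<forall>\<^sub>F x in at a. norm (poly q x) \<le> C * dist x a powr (s - real (order a p))"
      unfolding eventually_at using \<open>\<epsilon> > 0\<close> by (intro exI[of _ \<epsilon>]) auto
    have "((\<lambda>x. dist x a powr (s - real (order a p))) \<longlongrightarrow> dist a a powr (s - real (order a p))) (at a)"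
      using s by (intro tendsto_powr2 tendsto_intros) auto
    hence "((\<lambda>x. dist x a powr (s - real (order a p))) \<longlongrightarrow> 0) (at a)" by simp
    from tendsto_mult_left[OF this, of C]
    show "((\<lambda>x. C * dist x a powr (s - real (order a p))) \<longlongrightarrow> 0) (at a)" by simp
  qed
  moreover have "((\<lambda>x. poly q x) \<longlongrightarrow> poly q a) (at a)" by (intro tendsto_intros)
  ultimately have "poly q a = 0" using tendsto_unique by (metis at_neq_bot)
  thus False using q(2) by (simp add: poly_eq_0_iff_dvd)
qed

text \<open>On the pencil the discriminant factors as \<open>G\<close> times \<open>Q\<close>.
  Nonvanishing at (0, 1, 0), the member at infinite parameter, gives \<open>G\<close> its full
  degree \<open>d\<close> there; nonvanishing at the parameters in \<open>S\<close> assigns all the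
  orders to \<open>Q\<close>.\<close>

lemma (in irreducible_form) dual_degree_bound:
  assumes e3: "eval3 F e\<^sub>3 \<noteq> 0" and G: "dual_equation F G" "form d G"
    and G2: "eval3 G (vector [0, 1, 0]) \<noteq> 0"
    and S: "finite S" "\<And>a. a \<in> S \<Longrightarrow> eval3 G (vector [1, - a, 0]) \<noteq> 0"
    and s: "\<And>a. a \<in> S \<Longrightarrow> \<exists>C \<epsilon>. \<epsilon> > 0 \<and> (\<forall>x. 0 < dist x a \<longrightarrow> dist x a < \<epsilon> \<longrightarrow>
      norm (poly (pencil_discriminant n F) x) \<le> C * dist x a powr s a)"
  shows "real d + (\<Sum>a\<in>S. s a) \<le> real (n * (n - 1))"
proof -
  have "G dvd line_discriminant n F"
    using G(1) vanishes_on_dual_discriminant unfolding dual_equation_def by blast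
  then obtain Q where Q: "line_discriminant n F = G * Q" by (rule dvdE)
  let ?line = "\<lambda>H. line_poly H (vector [1, 0, 0]) (vector [0, - 1, 0])"
  let ?D = "pencil_discriminant n F"
  have "poly ?D a = poly (?line G * ?line Q) a" for a
    by (simp add: pencil_discriminant_def poly_line_poly Q)
  hence D: "?D = ?line G * ?line Q" by (simp add: poly_eq_poly_eq_iff[symmetric] ext)
  have D0: "?D \<noteq> 0" by (rule pencil_discriminant_nonzero[OF e3])
  hence ne: "?line G \<noteq> 0" "?line Q \<noteq> 0" unfolding D by auto
  have "coeff (?line G) d = eval3 G ((- 1) *s vector [0, 1, 0])"
    by (simp add: coeff_line_poly_top[OF G(2)] vec3_eq_iff vector_3 arg_cong[where f = "eval3 G"])
  also have "\<dots> \<noteq> 0" using G2 by (subst form_eval3[OF G(2)]) simp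
  finally have dG: "d \<le> degree (?line G)" by (rule le_degree)
  have "s a \<le> real (order a (?line Q))" if a: "a \<in> S" for a
  proof -
    have "s a \<le> real (order a ?D)" using s[OF a] order_ge_if_powr_bound[OF D0] by blast
    also have "order a ?D = order a (?line G) + order a (?line Q)"
      unfolding D by (rule order_mult) (use ne in simp)
    also have "order a (?line G) = 0"
      using S(2)[OF a] by (intro order_0I) (simp add: poly_line_poly_pencil)
    finally show ?thesis by simp
  qed
  hence "(\<Sum>a\<in>S. s a) \<le> (\<Sum>a\<in>S. real (order a (?line Q)))" by (rule sum_mono)
  also have "\<dots> = real (\<Sum>a\<in>S. order a (?line Q))" by simp
  also have "(\<Sum>a\<in>S. order a (?line Q)) = (\<Sum>a\<in>S \<inter> {a. poly (?line Q) a = 0}. order a (?line Q))"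
    using S(1) by (intro sum.mono_neutral_right) (auto simp: order_root)
  also have "\<dots> \<le> (\<Sum>a | poly (?line Q) a = 0. order a (?line Q))"
    using poly_roots_finite[OF ne(2)] by (intro sum_mono2) auto
  also have "\<dots> \<le> degree (?line Q)" by (rule sum_order_le_degree[OF ne(2)])
  finally have "(\<Sum>a\<in>S. s a) \<le> real (degree (?line Q))" by simp
  moreover have "degree ?D = degree (?line G) + degree (?line Q)"
    unfolding D using ne by (rule degree_mult_eq)
  moreover have "degree ?D \<le> n * (n - 1)" by (rule degree_pencil_discriminant_le[OF e3])
  ultimately show ?thesis using dG by (smt (verit) of_nat_add of_nat_le_iff)
qed

subsection \<open>Zero loci and the degree of the dual curve\<close>

lemma mem_span_singleton: "w \<in> vec.span {v} \<longleftrightarrow> (\<exists>c. w = c *s v)" for v w :: "complex^3"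
  by (auto simp: vec.span_singleton)

lemma mem_zero_locus_span_iff:
  assumes "form d G" "v \<noteq> 0"
  shows "vec.span {v} \<in> zero_locus G \<longleftrightarrow> eval3 G v = 0"
proof
  assume "vec.span {v} \<in> zero_locus G"
  moreover have "v \<in> vec.span {v}" by (simp add: vec.span_base)
  ultimately show "eval3 G v = 0" by (auto simp: zero_locus_def)
next
  assume "eval3 G v = 0"
  hence "eval3 G w = 0" if "w \<in> vec.span {v}" for w
    using that form_eval3[OF assms(1)] by (auto simp: mem_span_singleton)
  thus "vec.span {v} \<in> zero_locus G" using assms(2) by (auto simp: zero_locus_def P2_def)
qed

lemma zero_locus_iff:
  assumes "form d G"
  shows "p \<in> zero_locus G \<longleftrightarrow> (\<exists>v. v \<noteq> 0 \<and> p = vec.span {v} \<and> eval3 G v = 0)"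
proof
  assume p: "p \<in> zero_locus G"
  then obtain v where v: "v \<noteq> 0" "p = vec.span {v}" by (auto simp: zero_locus_def P2_def)
  thus "\<exists>v. v \<noteq> 0 \<and> p = vec.span {v} \<and> eval3 G v = 0"
    using p mem_zero_locus_span_iff[OF assms v(1)] by blast
next
  assume "\<exists>v. v \<noteq> 0 \<and> p = vec.span {v} \<and> eval3 G v = 0"
  thus "p \<in> zero_locus G" using mem_zero_locus_span_iff[OF assms] by blast
qed

lemma form_0_zero_locus:
  assumes "form 0 G"
  shows "zero_locus G = {}"
proof -
  have const: "eval3 G v = eval3 G 0" for v
  proof -
    have "eval3 G (0 *s v) = 0 ^ 0 * eval3 G v" by (rule form_eval3[OF assms])
    thus ?thesis unfolding power_0 mult_1_left vector_smult_lzero by (rule sym)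
  qed
  have "G \<noteq> 0" using assms by (simp add: form_def)
  then obtain v where v: "eval3 G v \<noteq> 0" using eval3_nonzero_ex by blast
  have "eval3 G w \<noteq> 0" for w using v trans[OF const[of w] const[of v, symmetric]] by simp
  thus ?thesis using zero_locus_iff[OF assms] by blast
qed

lemma form_pos_zero_locus_nonempty:
  assumes "form d G" "d > 0"
  shows "zero_locus G \<noteq> {}"
proof -
  let ?u = "axis 1 1 :: complex^3" and ?w = "axis 2 1 :: complex^3"
  have "\<exists>v. v \<noteq> 0 \<and> eval3 G v = 0"
  proof (cases "eval3 G ?w = 0")
    case True
    thus ?thesis by (intro exI[of _ ?w]) (simp add: axis_eq_0_iff)
  next
    case False
    hence "degree (line_poly G ?u ?w) \<ge> d"
      using coeff_line_poly_top[OF assms(1), of ?u ?w] by (intro le_degree) simp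
    hence "\<not> constant (poly (line_poly G ?u ?w))" using assms(2) by (simp add: constant_degree)
    then obtain t where "poly (line_poly G ?u ?w) t = 0"
      using Fundamental_Theorem_Algebra.fundamental_theorem_of_algebra by blast
    moreover have "?u + t *s ?w \<noteq> 0" by (simp add: vec3_eq_iff axis_def)
    ultimately show ?thesis by (intro exI[of _ "?u + t *s ?w"]) (simp add: poly_line_poly)
  qed
  thus ?thesis using zero_locus_iff[OF assms(1)] by blast
qed

lemma form_degree_unique:
  assumes "form d G" "form d' G'" "c \<noteq> 0" "\<And>v. eval3 G' v = c * eval3 G v"
  shows "d' = d"
proof -
  have "G \<noteq> 0" using assms(1) by (simp add: form_def)
  then obtain v where v: "eval3 G v \<noteq> 0" using eval3_nonzero_ex by blast
  have "2 ^ d' * eval3 G' v = c * (2 ^ d * eval3 G v)"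
    using assms(4)[of "2 *s v"] by (simp add: form_eval3[OF assms(1)] form_eval3[OF assms(2)])
  hence "(2 :: complex) ^ d' = 2 ^ d" using v assms(3) by (simp add: assms(4))
  hence "norm ((2 :: complex) ^ d') = norm ((2 :: complex) ^ d)" by simp
  hence "(2 :: real) ^ d' = 2 ^ d" by (simp only: norm_power norm_numeral)
  thus ?thesis by (simp only: power_inject_exp)
qed

text \<open>For uniqueness, Study's lemma makes \<open>G\<close> divide any other squarefree
  equation \<open>G'\<close>. A prime of the cofactor vanishes only inside the common locus, so it
  divides \<open>G\<close> too, giving a square in \<open>G'\<close>.\<close>

lemma curve_degree_zero_locus:
  assumes G: "irreducible G" "form d G" "d > 0"
  shows "curve_degree (zero_locus G) = d"
  unfolding curve_degree_def
proof (rule the_equality)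
  have "squarefree G"
  proof (rule squarefreeI)
    fix x assume "x ^ 2 dvd G"
    then obtain Q where "G = x ^ 2 * Q" by (rule dvdE)
    hence "G = x * (x * Q)" by (simp only: power2_eq_square mult.assoc)
    from irreducibleD[OF G(1) this] show "is_unit x" by (auto simp: is_unit_mult_iff)
  qed
  thus "\<exists>G'. reduced_curve d G' \<and> zero_locus G' = zero_locus G"
    using G(2) unfolding reduced_curve_def by blast
next
  fix d' assume "\<exists>G'. reduced_curve d' G' \<and> zero_locus G' = zero_locus G"
  then obtain G' where G': "form d' G'" "squarefree G'" "zero_locus G' = zero_locus G"
    unfolding reduced_curve_def by blast
  \<comment> \<open>A constant form has an empty locus, unlike \<open>G\<close>. Positive degree
    makes both forms vanish at the origin, which no projective point sees.\<close>
  have d': "d' > 0"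
    using form_0_zero_locus form_pos_zero_locus_nonempty[OF G(2,3)] G'(1,3) by (metis gr0I)
  have same: "eval3 G v = 0 \<longleftrightarrow> eval3 G' v = 0" for v
  proof (cases "v = 0")
    case True
    have "eval3 G 0 = 0" "eval3 G' 0 = 0"
      using form_eval3[OF G(2), of 0 0] form_eval3[OF G'(1), of 0 0] G(3) d' by (auto simp: power_0_left)
    thus ?thesis using True by simp
  next
    case False
    thus ?thesis
      using mem_zero_locus_span_iff[OF G(2) False] mem_zero_locus_span_iff[OF G'(1) False] G'(3) by simp
  qed
  have "G dvd G'" using same by (intro study_lemma[OF G(1)]) simp
  then obtain Q where Q: "G' = G * Q" by (rule dvdE)
  have G'0: "G' \<noteq> 0" using G'(1) unfolding form_def by simp
  have "is_unit Q"
  proof (rule ccontr)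
    assume nu: "\<not> is_unit Q"
    have "Q \<noteq> 0" using Q G'0 by auto
    from prime_divisor_exists[OF this nu] obtain P where P: "P dvd Q" "prime P" by auto
    have "irreducible P" using P(2) by (simp add: prime_elem_imp_irreducible)
    hence "P dvd G"
    proof (rule study_lemma)
      fix v assume "eval3 P v = 0"
      moreover obtain Q' where "Q = P * Q'" using P(1) by (rule dvdE)
      ultimately have "eval3 G' v = 0" by (simp add: Q)
      thus "eval3 G v = 0" using same by simp
    qed
    hence "P * P dvd G'" unfolding Q using P(1) by (rule mult_dvd_mono)
    hence "is_unit P" by (intro squarefreeD[OF G'(2)]) (simp only: power2_eq_square)
    thus False using P(2) not_prime_unit by blast
  qed
  then obtain c where "c \<noteq> 0" "Q = const3 c" unfolding is_unit_poly3_iff by blast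
  thus "d' = d" using form_degree_unique[OF G(2) G'(1), of c] by (simp add: Q mult.commute)
qed

context irreducible_form
begin

lemma singular_points_iff:
  assumes "v \<noteq> 0"
  shows "vec.span {v} \<in> singular_points F \<longleftrightarrow> eval3 F v = 0 \<and> gradient F v = 0"
proof -
  have "gradient F w = 0" if g0: "gradient F v = 0" and w: "w \<in> vec.span {v}" for w
  proof -
    obtain c where "w = c *s v" using w by (auto simp: mem_span_singleton)
    thus ?thesis using g0 gradient_0 form_gradient_scale[OF form, of c v] n2 by (cases "c = 0") auto
  qed
  moreover have "v \<in> vec.span {v}" by (simp add: vec.span_base)
  ultimately show ?thesis
    unfolding singular_points_def using mem_zero_locus_span_iff[OF form assms] by blast
qed

lemma tangent_lines_eq:
  "tangent_lines F = {vec.span {gradient F v} | v. eval3 F v = 0 \<and> gradient F v \<noteq> 0}"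
proof -
  have "v \<noteq> 0 \<and> vec.span {v} \<in> zero_locus F - singular_points F \<longleftrightarrow> eval3 F v = 0 \<and> gradient F v \<noteq> 0" for v
    using mem_zero_locus_span_iff[OF form, of v] singular_points_iff[of v] gradient_0 by (cases "v = 0") auto
  thus ?thesis unfolding tangent_lines_def by simp
qed

text \<open>A closed set containing the tangents is cut out by forms that vanish on the dual, and
  these are multiples of \<open>G\<close>.\<close>

lemma dual_curve_eq_zero_locus:
  assumes G: "dual_equation F G"
  shows "dual_curve F = zero_locus G"
proof -
  obtain d where d: "form d G" "d > 0" using dual_equation_form[OF G] by blast
  show ?thesis
    unfolding dual_curve_def
  proof (rule hull_unique)
    show "tangent_lines F \<subseteq> zero_locus G"
    proof
      fix t assume "t \<in> tangent_lines F"
      then obtain v where v: "t = vec.span {gradient F v}" "eval3 F v = 0" "gradient F v \<noteq> 0"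
        unfolding tangent_lines_eq by blast
      have "vanishes_on_dual F G" using G unfolding dual_equation_def by auto
      thus "t \<in> zero_locus G"
        using v mem_zero_locus_span_iff[OF d(1) v(3)] unfolding vanishes_on_dual_def by simp
    qed
    show "zariski_closed (zero_locus G)"
      unfolding zariski_closed_def
      by (intro exI[of _ "{G}"]) (use d(1) in \<open>auto simp: zero_locus_def\<close>)
    fix t assume t: "tangent_lines F \<subseteq> t" "zariski_closed t"
    then obtain S where S: "\<forall>H\<in>S. \<exists>d. form d H" "t = {p \<in> P2. \<forall>H\<in>S. p \<in> zero_locus H}"
      unfolding zariski_closed_def by blast
    have "G dvd H" if H: "H \<in> S" for H
    proof -
      obtain d' where d': "form d' H" using S(1) H by blast
      have "vanishes_on_dual F H"
      proof (rule vanishes_on_dualI[where i = 1 and j = 1])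
        fix v assume v: "eval3 F v = 0" "gradient F v $ 1 \<noteq> 0"
        hence g: "gradient F v \<noteq> 0" by auto
        hence "vec.span {gradient F v} \<in> zero_locus H"
          using v(1) t(1) S(2) H unfolding tangent_lines_eq by blast
        thus "eval3 H (gradient F v) = 0" using mem_zero_locus_span_iff[OF d' g] by simp
      qed
      thus ?thesis using G unfolding dual_equation_def by blast
    qed
    hence "eval3 H v = 0" if "H \<in> S" "eval3 G v = 0" for H v
      using that by (metis dvdE eval3_simps(6) mult_zero_left)
    thus "zero_locus G \<subseteq> t" unfolding S(2) zero_locus_def by auto
  qed
qed

lemma curve_degree_dual_curve:
  assumes "dual_equation F G" "form d G"
  shows "curve_degree (dual_curve F) = d"
proof -
  obtain d' where d': "form d' G" "d' > 0" using dual_equation_form[OF assms(1)] by blast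
  have "d = d'" using form_degree_unique[OF d'(1) assms(2), of 1] by simp
  thus ?thesis
    using curve_degree_zero_locus[OF _ d'] assms(1) dual_curve_eq_zero_locus[OF assms(1)]
    by (simp add: dual_equation_def)
qed

end

subsection \<open>Linear coordinate changes\<close>

lemma vanishes_on_dual_linear_subst:
  assumes "A ** B = Finite_Cartesian_Product.mat 1"
  shows "vanishes_on_dual (linear_subst A F) H \<longleftrightarrow> vanishes_on_dual F (linear_subst (transpose A) H)"
proof -
  have "A *v (B *v v) = v" for v using assms by (simp add: matrix_vector_mul_assoc)
  thus ?thesis unfolding vanishes_on_dual_def eval3_linear_subst gradient_linear_subst by metis
qed

text \<open>Coordinates of lines transform contragrediently to those of points, hence the transposed
  inverse.\<close>

lemma dual_equation_linear_subst:
  assumes AB: "A ** B = Finite_Cartesian_Product.mat 1" "B ** A = Finite_Cartesian_Product.mat 1"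
    and G: "dual_equation F G"
  shows "dual_equation (linear_subst A F) (linear_subst (transpose B) G)"
  unfolding dual_equation_def
proof (intro conjI allI)
  have t: "transpose B ** transpose A = Finite_Cartesian_Product.mat 1"
    "transpose A ** transpose B = Finite_Cartesian_Product.mat 1"
    using AB by (simp_all add: matrix_transpose_mul[symmetric])
  show "irreducible (linear_subst (transpose B) G)"
    using G t by (intro irreducible_linear_subst) (auto simp: dual_equation_def)
  fix H
  have inv: "linear_subst (transpose B) (linear_subst (transpose A) H) = H"
    "linear_subst (transpose A) (linear_subst (transpose B) G) = G"
    using t by (simp_all add: linear_subst_linear_subst)
  have "vanishes_on_dual (linear_subst A F) H \<longleftrightarrow> G dvd linear_subst (transpose A) H"
    using G unfolding vanishes_on_dual_linear_subst[OF AB(1)] dual_equation_def by simp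
  also have "\<dots> \<longleftrightarrow> linear_subst (transpose B) G dvd H"
  proof
    assume "G dvd linear_subst (transpose A) H"
    then obtain Q where "linear_subst (transpose A) H = G * Q" by (rule dvdE)
    hence "H = linear_subst (transpose B) (G * Q)" using inv(1) by simp
    thus "linear_subst (transpose B) G dvd H" by (simp add: linear_subst_mult)
  next
    assume "linear_subst (transpose B) G dvd H"
    then obtain Q where "H = linear_subst (transpose B) G * Q" by (rule dvdE)
    hence "linear_subst (transpose A) H = G * linear_subst (transpose A) Q"
      using inv(2) by (simp add: linear_subst_mult)
    thus "G dvd linear_subst (transpose A) H" by simp
  qed
  finally show "vanishes_on_dual (linear_subst A F) H \<longleftrightarrow> linear_subst (transpose B) G dvd H" .
qed

subsection \<open>Roots near a multiple root\<close>

text \<open>Dividing \<open>q\<close> by \<open>1 - \<eta> / \<eta>'\<close> for a large root \<open>\<eta>'\<close> hardly changes its coefficients.\<close>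

lemma large_roots_bound:
  fixes R :: nat
  assumes "c > 0" "C \<ge> 0"
  shows "\<exists>K\<ge>1. \<forall>(q :: complex poly) A xs. length xs = k \<longrightarrow> (\<forall>x\<in>set xs. K < norm x) \<longrightarrow>
    q = A * (\<Prod>x\<leftarrow>xs. [:- x, 1:]) \<longrightarrow> (\<forall>j. norm (coeff q j) \<le> C) \<longrightarrow> c \<le> norm (coeff q R) \<longrightarrow> R + k \<le> degree q"
  using assms
proof (induction k arbitrary: c C)
  case 0
  show ?case
  proof (intro exI[of _ 1] conjI allI impI)
    fix q :: "complex poly"
    assume "c \<le> norm (coeff q R)"
    hence "coeff q R \<noteq> 0" using 0 by auto
    thus "R + 0 \<le> degree q" by (simp add: le_degree)
  qed simp
next
  case (Suc k)
  obtain K0 where K0: "K0 \<ge> 1" "\<And>(q :: complex poly) A xs. length xs = k \<Longrightarrow> (\<forall>x\<in>set xs. K0 < norm x) \<Longrightarrow>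
    q = A * (\<Prod>x\<leftarrow>xs. [:- x, 1:]) \<Longrightarrow> (\<forall>j. norm (coeff q j) \<le> 2 * C) \<Longrightarrow> c / 2 \<le> norm (coeff q R) \<Longrightarrow> R + k \<le> degree q"
    using Suc.IH[of "c / 2" "2 * C"] Suc.prems by auto
  \<comment> \<open>Chosen so that removing a root beyond \<open>K\<close> shifts each coefficient
    by at most \<open>C\<close> and at most \<open>c / 2\<close>: the first preserves the upper
    bound \<open>2 * C\<close>, the second the lower bound \<open>c / 2\<close>.\<close>
  define K where "K = K0 + 2 + 4 * C / c"
  have "4 * C / c \<ge> 0" using Suc.prems by simp
  hence K: "K \<ge> K0" "K \<ge> 2" using K0(1) by (simp_all add: K_def)
  have "K * c = K0 * c + 2 * c + 4 * C" using Suc.prems by (simp add: K_def algebra_simps)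
  moreover have "K0 * c \<ge> 0" using Suc.prems(1) K0(1) by (intro mult_nonneg_nonneg) auto
  ultimately have "K * c \<ge> 4 * C" using Suc.prems(1) by linarith
  note K = K this
  show ?case
  proof (intro exI[of _ K] conjI allI impI)
    show "K \<ge> 1" using K by simp
    fix q A :: "complex poly" and xs :: "complex list"
    assume len: "length xs = Suc k" and large: "\<forall>x\<in>set xs. K < norm x"
      and q: "q = A * (\<Prod>x\<leftarrow>xs. [:- x, 1:])" and C: "\<forall>j. norm (coeff q j) \<le> C"
      and c: "c \<le> norm (coeff q R)"
    obtain x ys where xs: "xs = x # ys" "length ys = k" using len by (cases xs) auto
    have x: "norm x > K" using large xs by simp
    hence x0: "x \<noteq> 0" using K by auto
    define B where "B = A * (\<Prod>x\<leftarrow>ys. [:- x, 1:])"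
    have qB: "q = [:- x, 1:] * B" unfolding q xs B_def by (simp add: mult_ac)
    define q' where "q' = Polynomial.smult (- x) B"
    have q'0: "coeff q 0 = coeff q' 0" unfolding qB q'_def by simp
    have q'Suc: "coeff q' (Suc j) = coeff q (Suc j) + coeff q' j / x" for j
      unfolding qB q'_def using x0 by (simp add: field_simps)
    have small: "norm (y / x) \<le> C * 2 / K" if "norm y \<le> 2 * C" for y
    proof -
      have "norm (y / x) \<le> (2 * C) / K"
        unfolding norm_divide using that x K Suc.prems by (intro frac_le) auto
      thus ?thesis by (simp add: mult.commute)
    qed
    have CK: "C * 2 / K \<le> C" "C * 2 / K \<le> c / 2"
      using K Suc.prems by (simp_all add: field_simps mult_left_mono)
    have bound: "norm (coeff q' j) \<le> 2 * C" for j
    proof (induction j)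
      case 0
      have "norm (coeff q' 0) \<le> C" using C q'0 by metis
      thus ?case using Suc.prems by linarith
    next
      case (Suc j)
      have "norm (coeff q' (Suc j)) \<le> C + norm (coeff q' j / x)"
        unfolding q'Suc using C norm_triangle_ineq by (metis add_right_mono order_trans)
      thus ?case using small[OF Suc] CK(1) by linarith
    qed
    have "c / 2 \<le> norm (coeff q' R)"
    proof (cases R)
      case 0
      thus ?thesis using c q'0 Suc.prems by simp
    next
      case (Suc j)
      have "norm (coeff q R) \<le> norm (coeff q' R) + norm (coeff q' j / x)"
        unfolding Suc q'Suc using norm_triangle_ineq2[of "coeff q (Suc j)" "- (coeff q' j / x)"] by simp
      thus ?thesis using small[OF bound[of j]] CK(2) c by linarith
    qed
    moreover have "q' = Polynomial.smult (- x) A * (\<Prod>x\<leftarrow>ys. [:- x, 1:])" by (simp add: q'_def B_def)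
    ultimately have "R + k \<le> degree q'"
      using K0(2)[OF xs(2), of q' "Polynomial.smult (- x) A"] large xs(1) K(1) bound by (meson list.set_intros(2) order_le_less_trans)
    also have "degree q' = degree B" using x0 by (simp add: q'_def)
    finally have RB: "R + k \<le> degree B" .
    have "q \<noteq> 0" using c Suc.prems by auto
    hence "degree q = Suc (degree B)" unfolding qB by (subst degree_mult_eq) auto
    thus "R + Suc k \<le> degree q" using RB by simp
  qed
qed

text \<open>Rescaling the variable by \<open>\<epsilon>\<close> turns the hypotheses into uniform
  bounds: all coefficients at most \<open>C\<close>, the one of index \<open>R\<close> at least
  \<open>c\<close>. Then at most \<open>n - R\<close> rescaled roots can be large; \<open>K\<close>
  is a maximum over all possible numbers of them.\<close>

lemma near_roots:
  fixes R n :: nat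
  assumes "c > 0" "C \<ge> 0"
  obtains K where "K \<ge> 1" "\<And>(p :: complex poly) l z \<epsilon>. p = Polynomial.smult l (\<Prod>i<n. [:- z i, 1:]) \<Longrightarrow> l \<noteq> 0 \<Longrightarrow>
    0 < \<epsilon> \<Longrightarrow> \<epsilon> \<le> 1 \<Longrightarrow> (\<And>j. j < R \<Longrightarrow> norm (coeff p j) \<le> C * \<epsilon> ^ (R - j)) \<Longrightarrow>
    (\<And>j. norm (coeff p j) \<le> C) \<Longrightarrow> c \<le> norm (coeff p R) \<Longrightarrow> R \<le> card {i. i < n \<and> norm (z i) \<le> K * \<epsilon>}"
proof -
  have "\<exists>K\<ge>1. \<forall>(q :: complex poly) A xs. length xs = k \<longrightarrow> (\<forall>x\<in>set xs. K < norm x) \<longrightarrow>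
    q = A * (\<Prod>x\<leftarrow>xs. [:- x, 1:]) \<longrightarrow> (\<forall>j. norm (coeff q j) \<le> C) \<longrightarrow> c \<le> norm (coeff q R) \<longrightarrow> R + k \<le> degree q" for k
    by (rule large_roots_bound[OF assms])
  then obtain K where K: "\<And>k. K k \<ge> 1" "\<And>k (q :: complex poly) A xs. length xs = k \<Longrightarrow> (\<forall>x\<in>set xs. K k < norm x) \<Longrightarrow>
    q = A * (\<Prod>x\<leftarrow>xs. [:- x, 1:]) \<Longrightarrow> (\<forall>j. norm (coeff q j) \<le> C) \<Longrightarrow> c \<le> norm (coeff q R) \<Longrightarrow> R + k \<le> degree q"
    by metis
  define K' where "K' = Max (K ` {..n})"
  have K': "K k \<le> K'" if "k \<le> n" for k unfolding K'_def using that by (intro Max_ge) auto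
  show ?thesis
  proof (rule that[of K'])
    show "K' \<ge> 1" using K(1)[of 0] K'[of 0] by simp
    fix p :: "complex poly" and l z \<epsilon>
    assume p: "p = Polynomial.smult l (\<Prod>i<n. [:- z i, 1:])" and l: "l \<noteq> 0" and \<epsilon>: "0 < \<epsilon>" "\<epsilon> \<le> 1"
      and low: "\<And>j. j < R \<Longrightarrow> norm (coeff p j) \<le> C * \<epsilon> ^ (R - j)"
      and all: "\<And>j. norm (coeff p j) \<le> C" and R: "c \<le> norm (coeff p R)"
    let ?\<epsilon> = "of_real \<epsilon> :: complex"
    define q where "q = Polynomial.smult (1 / ?\<epsilon> ^ R) (pcompose p [:0, ?\<epsilon>:])"
    have coeff_q: "coeff q j = ?\<epsilon> ^ j * coeff p j / ?\<epsilon> ^ R" for j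
      by (simp add: q_def coeff_pcompose_linear)
    have q_le: "norm (coeff q j) \<le> C" for j
    proof (cases "j < R")
      case True
      have "norm (coeff q j) = \<epsilon> ^ j * norm (coeff p j) / \<epsilon> ^ R"
        using \<epsilon> by (simp add: coeff_q norm_mult norm_divide norm_power)
      also have "\<dots> \<le> \<epsilon> ^ j * (C * \<epsilon> ^ (R - j)) / \<epsilon> ^ R"
        using low[OF True] \<epsilon> by (intro divide_right_mono mult_left_mono) auto
      also have "\<epsilon> ^ j * (C * \<epsilon> ^ (R - j)) = C * \<epsilon> ^ R" using True by (simp flip: power_add)
      finally show ?thesis using \<epsilon> by simp
    next
      case False
      hence "?\<epsilon> ^ j = ?\<epsilon> ^ (j - R) * ?\<epsilon> ^ R" by (simp flip: power_add)
      hence "coeff q j = ?\<epsilon> ^ (j - R) * coeff p j" using \<epsilon> by (simp add: coeff_q)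
      hence "norm (coeff q j) = \<epsilon> ^ (j - R) * norm (coeff p j)" using \<epsilon> by (simp add: norm_mult norm_power)
      also have "\<dots> \<le> 1 * C" using \<epsilon> all by (intro mult_mono power_le_one) auto
      finally show ?thesis by simp
    qed
    have q_R: "coeff q R = coeff p R" using \<epsilon> by (simp add: coeff_q)
    define I where "I = {i. i < n \<and> norm (z i) > K' * \<epsilon>}"
    have fin: "finite I" unfolding I_def by simp
    obtain js where js: "set js = I" "distinct js" using finite_distinct_list[OF fin] by blast
    have card: "card I = length js" using js distinct_card by metis
    define w where "w i = z i / ?\<epsilon>" for i
    have lin: "pcompose [:- z i, 1:] [:0, ?\<epsilon>:] = Polynomial.smult ?\<epsilon> [:- w i, 1:]" for i
      using \<epsilon> by (simp add: pcompose_pCons w_def)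
    have "q = Polynomial.smult (l * ?\<epsilon> ^ n / ?\<epsilon> ^ R) (\<Prod>i<n. [:- w i, 1:])"
      unfolding q_def p by (simp only: pcompose_smult pcompose_prod lin prod_smult) simp
    also have "(\<Prod>i<n. [:- w i, 1:]) = (\<Prod>i\<in>{..<n} - I. [:- w i, 1:]) * (\<Prod>i\<in>I. [:- w i, 1:])"
      by (rule prod.subset_diff) (auto simp: I_def)
    also have "(\<Prod>i\<in>I. [:- w i, 1:]) = (\<Prod>x\<leftarrow>map w js. [:- x, 1:])"
      using prod.distinct_set_conv_list[OF js(2), of "\<lambda>i. [:- w i, 1:]"] js(1) by (simp add: o_def)
    finally have q_eq: "q = Polynomial.smult (l * ?\<epsilon> ^ n / ?\<epsilon> ^ R) (\<Prod>i\<in>{..<n} - I. [:- w i, 1:]) * (\<Prod>x\<leftarrow>map w js. [:- x, 1:])"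
      by simp
    have "card I \<le> n" using card_mono[of "{..<n}" I] by (auto simp: I_def)
    have "\<forall>x\<in>set (map w js). K (card I) < norm x"
    proof
      fix x assume "x \<in> set (map w js)"
      then obtain i where i: "i \<in> I" "x = w i" using js(1) by auto
      have "K' < norm (w i)" using i(1) \<epsilon> by (simp add: w_def I_def norm_divide field_simps)
      thus "K (card I) < norm x" using K'[OF \<open>card I \<le> n\<close>] i(2) by simp
    qed
    hence "R + card I \<le> degree q"
      using q_le R q_R card by (intro K(2)[OF _ _ q_eq]) auto
    also have "degree q = n"
    proof -
      have "degree q = degree p" using \<epsilon> by (simp add: q_def)
      also have "\<dots> = n" unfolding p using l by (simp add: degree_prod_eq_sum_degree)
      finally show ?thesis .
    qed
    finally have "R + card I \<le> n" .
    moreover have "{i. i < n \<and> norm (z i) \<le> K' * \<epsilon>} = {..<n} - I" by (auto simp: I_def)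
    moreover have "card ({..<n} - I) = n - card I"
      using fin by (subst card_Diff_subset) (auto simp: I_def)
    ultimately show "R \<le> card {i. i < n \<and> norm (z i) \<le> K' * \<epsilon>}" by simp
  qed
qed

lemma norm_coeff_le_cauchy:
  fixes p :: "complex poly"
  assumes "r > 0" "\<And>x. norm x = r \<Longrightarrow> norm (poly p x) \<le> M"
  shows "norm (coeff p j) \<le> M / r ^ j"
proof -
  have deriv: "(deriv ^^ k) (poly p) = poly ((pderiv ^^ k) p)" for k
    by (induction k) (auto intro!: DERIV_imp_deriv poly_DERIV)
  have "coeff ((pderiv ^^ k) p) i * fact i = fact (k + i) * coeff p (k + i)" for k i
  proof (induction k arbitrary: i)
    case (Suc k)
    have "coeff ((pderiv ^^ Suc k) p) i * fact i = coeff ((pderiv ^^ k) p) (Suc i) * fact (Suc i)"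
      by (simp add: coeff_pderiv algebra_simps)
    also have "\<dots> = fact (k + Suc i) * coeff p (k + Suc i)" by (rule Suc)
    finally show ?case by simp
  qed simp
  from this[of j 0] have c: "(deriv ^^ j) (poly p) 0 = fact j * coeff p j"
    by (simp add: deriv poly_0_coeff_0)
  have "norm ((deriv ^^ j) (poly p) 0) \<le> fact j * M / r ^ j"
    by (rule Cauchy_inequality) (use assms in \<open>auto intro!: holomorphic_intros continuous_intros\<close>)
  hence "fact j * norm (coeff p j) \<le> fact j * (M / r ^ j)" unfolding c norm_mult by simp
  thus ?thesis by (subst (asm) mult_le_cancel_left_pos) auto
qed

subsection \<open>Vanishing order of the discriminant\<close>

text \<open>Supplies continuity and bounds for the coefficients as the base point moves.\<close>

lemma coeff_line_poly_polynomial_left: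
  "\<exists>T. \<forall>u j. coeff (line_poly F u w) j = eval3 (T j) u"
proof -
  define P where "P = psubst (\<lambda>c. [:const3 c:]) [:coord 1, const3 (w $ 1):] [:coord 2, const3 (w $ 2):] [:coord 3, const3 (w $ 3):] F"
  have "map_poly (\<lambda>P. eval3 P u) P = line_poly F u w" for u
  proof -
    interpret h: comm_ring_hom "\<lambda>P. eval3 P u" by (rule eval3_hom)
    interpret m: map_poly_comm_ring_hom "\<lambda>P. eval3 P u" ..
    have c: "comm_ring_hom (\<lambda>c. [:const3 c:])" by unfold_locales (auto simp: one_pCons)
    show ?thesis
      unfolding P_def line_poly_def
      by (subst hom_psubst[OF m.comm_ring_hom_axioms c]) (simp add: map_poly_pCons_0)
  qed
  hence "coeff (line_poly F u w) j = eval3 (coeff P j) u" for u j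
    by (metis coeff_map_poly eval3_simps(1))
  thus ?thesis by (intro exI[of _ "coeff P"]) simp
qed

text \<open>Makes nonvanishing of a coefficient a polynomial condition on the direction, to be met
  in general position.\<close>

lemma coeff_line_poly_polynomial_right:
  "\<exists>T. \<forall>w j. coeff (line_poly F u w) j = eval3 (T j) w"
proof -
  define P where "P = psubst (\<lambda>c. [:const3 c:]) [:const3 (u $ 1), coord 1:] [:const3 (u $ 2), coord 2:] [:const3 (u $ 3), coord 3:] F"
  have "map_poly (\<lambda>P. eval3 P w) P = line_poly F u w" for w
  proof -
    interpret h: comm_ring_hom "\<lambda>P. eval3 P w" by (rule eval3_hom)
    interpret m: map_poly_comm_ring_hom "\<lambda>P. eval3 P w" ..
    have c: "comm_ring_hom (\<lambda>c. [:const3 c:])" by unfold_locales (auto simp: one_pCons)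
    show ?thesis
      unfolding P_def line_poly_def
      by (subst hom_psubst[OF m.comm_ring_hom_axioms c]) (simp add: map_poly_pCons_0)
  qed
  hence "coeff (line_poly F u w) j = eval3 (coeff P j) w" for w j
    by (metis coeff_map_poly eval3_simps(1))
  thus ?thesis by (intro exI[of _ "coeff P"]) simp
qed

text \<open>When \<open>a\<close> is at distance \<open>\<epsilon>\<close> from
  \<open>a\<^sub>0\<close>, at least \<open>R\<close> roots lie within a fixed multiple of
  \<open>\<epsilon>\<close> of \<open>z\<^sub>0\<close>. Each contributes a factor of size
  \<open>\<epsilon> powr e\<close> to the product formula, except that one root satisfying
  \<open>E\<close> may contribute only \<open>\<epsilon> powr e'\<close>; the remaining roots
  contribute bounded factors.\<close>

lemma (in irreducible_form) pencil_discriminant_local_bound: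
  fixes E :: "complex \<Rightarrow> complex \<Rightarrow> bool" and e e' :: real
  assumes e3: "eval3 F e\<^sub>3 \<noteq> 0" and \<rho>: "\<rho> > 0" and e: "0 \<le> e'" "e' \<le> e" and R: "R \<ge> 1" and C: "C \<ge> 0"
    and small: "\<And>a z. dist a a\<^sub>0 < \<rho> \<Longrightarrow> dist z z\<^sub>0 < \<rho> \<Longrightarrow>
      norm (eval3 F (vector [a, 1, z])) \<le> C * (dist a a\<^sub>0 + dist z z\<^sub>0) ^ R"
    and deriv: "\<And>a z. dist a a\<^sub>0 < \<rho> \<Longrightarrow> dist z z\<^sub>0 < \<rho> \<Longrightarrow> eval3 F (vector [a, 1, z]) = 0 \<Longrightarrow>
      norm (gradient F (vector [a, 1, z]) $ 3) \<le> C * (dist a a\<^sub>0 + dist z z\<^sub>0) powr (if E a z then e' else e)"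
    and exc: "\<And>a z z'. dist a a\<^sub>0 < \<rho> \<Longrightarrow> dist z z\<^sub>0 < \<rho> \<Longrightarrow> dist z' z\<^sub>0 < \<rho> \<Longrightarrow>
      eval3 F (vector [a, 1, z]) = 0 \<Longrightarrow> eval3 F (vector [a, 1, z']) = 0 \<Longrightarrow> E a z \<Longrightarrow> E a z' \<Longrightarrow> z = z'"
    and mult: "coeff (line_poly F (vector [a\<^sub>0, 1, z\<^sub>0]) e\<^sub>3) R \<noteq> 0"
  shows "\<exists>C' \<epsilon>. \<epsilon> > 0 \<and> (\<forall>a. 0 < dist a a\<^sub>0 \<longrightarrow> dist a a\<^sub>0 < \<epsilon> \<longrightarrow>
    norm (poly (pencil_discriminant n F) a) \<le> C' * dist a a\<^sub>0 powr ((real R - 1) * e + e'))"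
proof -
  define q where "q a = line_poly F (vector [a, 1, z\<^sub>0]) e\<^sub>3" for a
  have pt: "vector [a, 1, z\<^sub>0] + x *s e\<^sub>3 = (vector [a, 1, z\<^sub>0 + x] :: complex^3)" for a x
    by (simp add: e\<^sub>3_def vec3_eq_iff vector_3)
  have poly_q: "poly (q a) x = eval3 F (vector [a, 1, z\<^sub>0 + x])" for a x
    by (simp add: q_def poly_line_poly pt)
  obtain S where S: "\<And>a j. coeff (q a) j = poly (S j) a"
  proof -
    obtain T where T: "\<And>u j. coeff (line_poly F u e\<^sub>3) j = eval3 (T j) u"
      using coeff_line_poly_polynomial_left by blast
    have "vector [0, 1, z\<^sub>0] + a *s vector [1, 0, 0] = (vector [a, 1, z\<^sub>0] :: complex^3)" for a
      by (simp add: vec3_eq_iff vector_3)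
    hence "coeff (q a) j = poly (line_poly (T j) (vector [0, 1, z\<^sub>0]) (vector [1, 0, 0])) a" for a j
      by (simp add: q_def T poly_line_poly)
    thus ?thesis by (rule that)
  qed
  define c where "c = norm (coeff (q a\<^sub>0) R) / 2"
  have c: "c > 0" using mult by (simp add: c_def q_def)
  have "isCont (\<lambda>a. norm (poly (S R) a)) a\<^sub>0" by (intro continuous_intros)
  moreover have "norm (poly (S R) a\<^sub>0) > c" using c by (simp add: c_def S)
  ultimately have "\<forall>\<^sub>F a in at a\<^sub>0. norm (poly (S R) a) > c"
    unfolding isCont_def by (rule order_tendstoD(1))
  then obtain \<delta> where \<delta>: "\<delta> > 0" "\<And>a. a \<noteq> a\<^sub>0 \<Longrightarrow> dist a a\<^sub>0 < \<delta> \<Longrightarrow> c < norm (coeff (q a) R)"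
    unfolding eventually_at S by blast
  have "\<exists>B>0. \<forall>a. norm a \<le> norm a\<^sub>0 + 1 \<longrightarrow> norm (poly (S j) a) \<le> B" for j
    using poly_bounded_cball[of "norm a\<^sub>0 + 1" "S j"] by metis
  then obtain B where B: "\<And>j. B j > 0" "\<And>j a. norm a \<le> norm a\<^sub>0 + 1 \<Longrightarrow> norm (poly (S j) a) \<le> B j"
    by metis
  define Cc where "Cc = C * 2 ^ R + (\<Sum>j\<le>n. B j)"
  have "(\<Sum>j\<le>n. B j) \<ge> 0" using B(1) by (intro sum_nonneg) (auto intro: less_imp_le)
  hence Cc: "Cc \<ge> 0" "C * 2 ^ R \<le> Cc" using C by (auto simp: Cc_def)
  have norm_le: "norm a \<le> norm a\<^sub>0 + 1" if "dist a a\<^sub>0 < 1" for a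
    using that norm_triangle_ineq2[of a "a\<^sub>0"] by (simp add: dist_norm)
  have all: "norm (coeff (q a) j) \<le> Cc" if a: "dist a a\<^sub>0 < 1" for a j
  proof (cases "j \<le> n")
    case True
    have "norm (coeff (q a) j) \<le> B j" using B(2)[OF norm_le[OF a]] by (simp add: S)
    also have "\<dots> \<le> (\<Sum>j\<le>n. B j)" using True B(1) by (intro member_le_sum) (auto intro: less_imp_le)
    also have "\<dots> \<le> Cc" using C by (simp add: Cc_def)
    finally show ?thesis .
  next
    case False
    moreover have "degree (q a) \<le> n" unfolding q_def by (rule degree_line_poly_le[OF form])
    ultimately have "coeff (q a) j = 0" by (intro coeff_eq_0) simp
    thus ?thesis using Cc by simp
  qed
  obtain K where K: "K \<ge> 1" "\<And>(p :: complex poly) l z \<epsilon>. p = Polynomial.smult l (\<Prod>i<n. [:- z i, 1:]) \<Longrightarrow> l \<noteq> 0 \<Longrightarrow>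
    0 < \<epsilon> \<Longrightarrow> \<epsilon> \<le> 1 \<Longrightarrow> (\<And>j. j < R \<Longrightarrow> norm (coeff p j) \<le> Cc * \<epsilon> ^ (R - j)) \<Longrightarrow>
    (\<And>j. norm (coeff p j) \<le> Cc) \<Longrightarrow> c \<le> norm (coeff p R) \<Longrightarrow> R \<le> card {i. i < n \<and> norm (z i) \<le> K * \<epsilon>}"
    using near_roots[OF c Cc(1)] by blast
  obtain M where M: "M > 0" "\<And>a z. poly (pencil_poly F a) z = 0 \<Longrightarrow>
      norm (poly (pderiv (pencil_poly F a)) z) \<le> M * (1 + norm a) ^ (n - 1)"
    using pencil_pderiv_bound[OF e3] by blast
  define M\<^sub>1 where "M\<^sub>1 = M * (2 + norm a\<^sub>0) ^ (n - 1) + C * (1 + K) powr e + C * (1 + K) powr e'"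
  have M\<^sub>1: "M\<^sub>1 \<ge> M * (2 + norm a\<^sub>0) ^ (n - 1)" "M\<^sub>1 \<ge> C * (1 + K) powr e" "M\<^sub>1 \<ge> C * (1 + K) powr e'" "M\<^sub>1 \<ge> 0"
    using M(1) C by (auto simp: M\<^sub>1_def intro!: add_nonneg_nonneg)
  define \<epsilon>\<^sub>0 where "\<epsilon>\<^sub>0 = min (min \<delta> 1) (\<rho> / K)"
  have \<epsilon>\<^sub>0: "\<epsilon>\<^sub>0 > 0" using \<delta>(1) \<rho> K(1) by (simp add: \<epsilon>\<^sub>0_def)
  define C' where "C' = norm (eval3 F e\<^sub>3 ^ (n - 1)) * M\<^sub>1 ^ n"
  have C': "C' \<ge> 0" using M\<^sub>1 by (simp add: C'_def)
  have "norm (poly (pencil_discriminant n F) a) \<le> C' * dist a a\<^sub>0 powr ((real R - 1) * e + e')"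
    if a: "0 < dist a a\<^sub>0" "dist a a\<^sub>0 < \<epsilon>\<^sub>0" for a
  proof (cases "poly (pencil_discriminant n F) a = 0")
    case True
    thus ?thesis using C' by simp
  next
    case False
    define \<epsilon> where "\<epsilon> = dist a a\<^sub>0"
    have "\<epsilon> < \<rho> / K" using a by (simp add: \<epsilon>_def \<epsilon>\<^sub>0_def)
    hence K\<rho>: "K * \<epsilon> < \<rho>" using K(1) by (simp add: field_simps)
    have "\<epsilon> > 0" using a by (simp add: \<epsilon>_def)
    moreover have "\<epsilon> < \<rho>"
      using mult_right_mono[OF K(1) less_imp_le[OF \<open>\<epsilon> > 0\<close>]] K\<rho> by linarith
    ultimately have \<epsilon>: "0 < \<epsilon>" "\<epsilon> < 1" "\<epsilon> < \<delta>" "\<epsilon> < \<rho>"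
      using a by (auto simp: \<epsilon>_def \<epsilon>\<^sub>0_def)
    obtain z where z: "inj_on z {..<n}"
      "pencil_poly F a = Polynomial.smult (eval3 F e\<^sub>3) (\<Prod>i<n. [:- z i, 1:])"
      "poly (pencil_discriminant n F) a = eval3 F e\<^sub>3 ^ (n - 1) * (\<Prod>i<n. poly (pderiv (pencil_poly F a)) (z i))"
      using pencil_discriminant_split[OF form n2 e3, of a] False by blast
    have root: "poly (pencil_poly F a) (z i) = 0" if "i < n" for i
      using that unfolding z(2) by (auto simp: poly_prod)
    have "poly (q a) x = poly (Polynomial.smult (eval3 F e\<^sub>3) (\<Prod>i<n. [:- (z i - z\<^sub>0), 1:])) x" for x
    proof -
      have "poly (q a) x = poly (pencil_poly F a) (z\<^sub>0 + x)" by (simp add: poly_q poly_pencil_poly)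
      thus ?thesis unfolding z(2) by (simp add: poly_prod algebra_simps)
    qed
    hence q_eq: "q a = Polynomial.smult (eval3 F e\<^sub>3) (\<Prod>i<n. [:- (z i - z\<^sub>0), 1:])"
      by (simp only: poly_eq_poly_eq_iff[symmetric] ext)
    have low: "norm (coeff (q a) j) \<le> Cc * \<epsilon> ^ (R - j)" if "j < R" for j
    proof -
      \<comment> \<open>Cauchy's estimate on the circle of radius \<open>\<epsilon>\<close>, where
        both distances equal \<open>\<epsilon>\<close> and so \<open>F\<close> is at most
        \<open>C * (2 * \<epsilon>) ^ R\<close>.\<close>
      have "norm (coeff (q a) j) \<le> (C * (2 * \<epsilon>) ^ R) / \<epsilon> ^ j"
      proof (rule norm_coeff_le_cauchy[OF \<epsilon>(1)])
        fix x :: complex assume "norm x = \<epsilon>"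
        thus "norm (poly (q a) x) \<le> C * (2 * \<epsilon>) ^ R"
          using small[of a "z\<^sub>0 + x"] \<epsilon> unfolding poly_q by (simp add: dist_norm \<epsilon>_def)
      qed
      also have "\<epsilon> ^ R = \<epsilon> ^ (R - j) * \<epsilon> ^ j" using that by (simp flip: power_add)
      hence "(C * (2 * \<epsilon>) ^ R) / \<epsilon> ^ j = (C * 2 ^ R) * \<epsilon> ^ (R - j)" using \<epsilon>(1) by (simp add: power_mult_distrib)
      also have "\<dots> \<le> Cc * \<epsilon> ^ (R - j)" using Cc(2) \<epsilon>(1) by (intro mult_right_mono) auto
      finally show ?thesis .
    qed
    define N where "N = {i. i < n \<and> norm (z i - z\<^sub>0) \<le> K * \<epsilon>}"
    define NE where "NE = {i \<in> N. E a (z i)}"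
    have "a \<noteq> a\<^sub>0" using a by auto
    hence "c \<le> norm (coeff (q a) R)" using \<delta>(2)[of a] \<epsilon>(3) by (simp add: \<epsilon>_def)
    hence cardN: "R \<le> card N"
      unfolding N_def using \<epsilon> all[of a] low e3 by (intro K(2)[OF q_eq]) (auto simp: \<epsilon>_def)
    have finN: "finite N" "N \<subseteq> {..<n}" "NE \<subseteq> N" by (auto simp: N_def NE_def)
    have inN: "dist (z i) z\<^sub>0 < \<rho>" "eval3 F (vector [a, 1, z i]) = 0" if "i \<in> N" for i
    proof -
      have "i < n" "norm (z i - z\<^sub>0) \<le> K * \<epsilon>" using that by (simp_all add: N_def)
      thus "dist (z i) z\<^sub>0 < \<rho>" "eval3 F (vector [a, 1, z i]) = 0"
        using K\<rho> root[of i] by (simp_all add: dist_norm flip: poly_pencil_poly)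
    qed
    have "i = j" if "i \<in> NE" "j \<in> NE" for i j
    proof -
      have ij: "i \<in> N" "j \<in> N" "E a (z i)" "E a (z j)" using that by (simp_all add: NE_def)
      have "dist a a\<^sub>0 < \<rho>" using \<epsilon>(4) by (simp add: \<epsilon>_def)
      from exc[OF this inN(1)[OF ij(1)] inN(1)[OF ij(2)] inN(2)[OF ij(1)] inN(2)[OF ij(2)] ij(3,4)]
      have "z i = z j" .
      thus ?thesis using inj_onD[OF z(1)] ij(1,2) by (simp add: N_def)
    qed
    moreover have "finite NE" using finN finite_subset by blast
    ultimately have cardNE: "card NE \<le> 1" by (auto simp: card_le_Suc0_iff_eq)
    define x where "x i = (if i \<in> N then if i \<in> NE then e' else e else 0)" for i
    have factor: "norm (poly (pderiv (pencil_poly F a)) (z i)) \<le> M\<^sub>1 * \<epsilon> powr x i" if i: "i < n" for i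
    proof (cases "i \<in> N")
      case True
      have "norm (poly (pderiv (pencil_poly F a)) (z i)) \<le> C * (dist a a\<^sub>0 + dist (z i) z\<^sub>0) powr (x i)"
        using deriv[of a "z i"] inN[OF True] \<epsilon>(4) True
        by (simp add: poly_pderiv_pencil_poly x_def NE_def \<epsilon>_def)
      also have "\<dots> \<le> C * ((1 + K) * \<epsilon>) powr x i"
        using True C e by (intro mult_left_mono powr_mono2) (auto simp: N_def x_def \<epsilon>_def dist_norm algebra_simps)
      also have "\<dots> = C * (1 + K) powr x i * \<epsilon> powr x i" using \<epsilon>(1) K(1) by (simp add: powr_mult)
      also have "\<dots> \<le> M\<^sub>1 * \<epsilon> powr x i"
        using True M\<^sub>1 by (intro mult_right_mono) (auto simp: x_def)
      finally show ?thesis .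
    next
      case False
      have "norm (poly (pderiv (pencil_poly F a)) (z i)) \<le> M * (1 + norm a) ^ (n - 1)"
        by (rule M(2)[OF root[OF i]])
      also have "\<dots> \<le> M * (2 + norm a\<^sub>0) ^ (n - 1)"
        using norm_le[of a] \<epsilon>(2) M(1) by (intro mult_left_mono power_mono) (auto simp: \<epsilon>_def)
      also have "\<dots> \<le> M\<^sub>1" by (rule M\<^sub>1)
      finally show ?thesis using False \<epsilon>(1) by (simp add: x_def)
    qed
    have "norm (poly (pencil_discriminant n F) a) \<le> norm (eval3 F e\<^sub>3 ^ (n - 1)) * (\<Prod>i<n. M\<^sub>1 * \<epsilon> powr x i)"
      unfolding z(3) norm_mult prod_norm[symmetric] using factor by (intro mult_left_mono prod_mono) auto
    also have "\<dots> = C' * \<epsilon> powr (\<Sum>i<n. x i)"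
      using \<epsilon>(1) by (simp add: C'_def prod.distrib powr_sum)
    \<comment> \<open>Since \<open>\<epsilon>\<close> is below 1, it suffices that the exponents add
      up to at least the claimed one; roots beyond \<open>R\<close>, or the absence of an
      exceptional root, can only increase the sum.\<close>
    also have "\<dots> \<le> C' * \<epsilon> powr ((real R - 1) * e + e')"
    proof (intro mult_left_mono powr_mono')
      have "(\<Sum>i<n. x i) = (\<Sum>i\<in>N. x i)"
        using finN by (intro sum.mono_neutral_right) (auto simp: x_def)
      also have "\<dots> = (\<Sum>i\<in>N - NE. x i) + (\<Sum>i\<in>NE. x i)"
        using finN by (intro sum.subset_diff)
      also have "(\<Sum>i\<in>N - NE. x i) = real (card (N - NE)) * e" by (simp add: x_def)
      also have "(\<Sum>i\<in>NE. x i) = real (card NE) * e'" using finN by (simp add: x_def subset_iff)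
      also have "card (N - NE) = card N - card NE"
        using finN by (intro card_Diff_subset) (auto intro: finite_subset)
      finally have sum: "(\<Sum>i<n. x i) = real (card N - card NE) * e + real (card NE) * e'" .
      have e0: "e \<ge> 0" using e by linarith
      consider "card NE = 0" | "card NE = 1" using cardNE by linarith
      thus "(real R - 1) * e + e' \<le> (\<Sum>i<n. x i)"
      proof cases
        case 1
        have "(real R - 1) * e + e' \<le> real R * e" using e by (simp add: algebra_simps)
        also have "\<dots> \<le> real (card N) * e" using cardN e0 by (intro mult_right_mono) auto
        finally show ?thesis using sum 1 by simp
      next
        case 2
        have "(real R - 1) * e \<le> real (card N - 1) * e" using cardN R e0 by (intro mult_right_mono) auto
        thus ?thesis using sum 2 by simp
      qed
    qed (use \<epsilon> C' in auto)
    finally show ?thesis by (simp add: \<epsilon>_def)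
  qed
  thus ?thesis using \<epsilon>\<^sub>0 by blast
qed

subsection \<open>The ADE normal forms\<close>

fun ade_mult :: "ade \<Rightarrow> nat" where
  "ade_mult (A_type k) = 2"
| "ade_mult (D_type k) = 3"
| "ade_mult E6 = 3"
| "ade_mult E7 = 3"
| "ade_mult E8 = 3"

text \<open>On the curve \<open>g = 0\<close>, the gradient of the normal form \<open>g\<close> is of size \<open>r\<^sup>e\<close> at distance \<open>r\<close> from
  the origin, with \<open>e\<close> given by \<open>ade_exp\<close>, except that the exponent on the branch \<open>y = 0\<close> of \<open>D\<^sub>k\<close> is 2.\<close>

fun ade_exp :: "ade \<Rightarrow> real" where
  "ade_exp (A_type k) = (real k + 1) / 2"
| "ade_exp (D_type k) = real k / 2"
| "ade_exp E6 = 8 / 3"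
| "ade_exp E7 = 3"
| "ade_exp E8 = 10 / 3"

fun ade_exp_axis :: "ade \<Rightarrow> real" where
  "ade_exp_axis (D_type k) = 2"
| "ade_exp_axis T = ade_exp T"

text \<open>Evaluates to k + 1 for A_k, k + 2 for D_k and 8, 9, 10 for E6, E7, E8. One of the roots
  near the point is counted with the exponent of the exceptional branch, the others with the generic
  one.\<close>

definition ade_order :: "ade \<Rightarrow> real" where
  "ade_order T = (real (ade_mult T) - 1) * ade_exp T + ade_exp_axis T"

fun ade_dx :: "ade \<Rightarrow> complex \<times> complex \<Rightarrow> complex" where
  "ade_dx (A_type k) (x, y) = 2 * x"
| "ade_dx (D_type k) (x, y) = 2 * x * y"
| "ade_dx E6 (x, y) = 3 * x^2"
| "ade_dx E7 (x, y) = 3 * x^2 + y^3"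
| "ade_dx E8 (x, y) = 3 * x^2"

fun ade_dy :: "ade \<Rightarrow> complex \<times> complex \<Rightarrow> complex" where
  "ade_dy (A_type k) (x, y) = of_nat (k + 1) * y^k"
| "ade_dy (D_type k) (x, y) = x^2 + of_nat (k - 1) * y^(k - 2)"
| "ade_dy E6 (x, y) = 4 * y^3"
| "ade_dy E7 (x, y) = 3 * x * y^2"
| "ade_dy E8 (x, y) = 5 * y^4"

text \<open>For A_k the two sides differ by 3 / (k + 1) only, in all other cases by more than
  3.\<close>

lemma mk_number_less_ade_order:
  assumes "ade_index_ok T"
  shows "mk_number T < 3 * ade_order T"
  using assms by (cases T) (auto simp: ade_order_def field_simps)

lemma ade_exponents:
  assumes "ade_index_ok T"
  shows "ade_mult T \<ge> 1" "0 \<le> ade_exp_axis T" "ade_exp_axis T \<le> ade_exp T"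
  using assms by (cases T; auto)+

lemma DERIV_ade_equation:
  assumes "ade_index_ok T" "DERIV x t :> x'" "DERIV y t :> y'"
  shows "DERIV (\<lambda>t. ade_equation T (x t, y t)) t :> ade_dx T (x t, y t) * x' + ade_dy T (x t, y t) * y'"
proof (cases T)
  case (A_type k)
  have "DERIV (\<lambda>t. y t ^ (k + 1)) t :> of_nat (k + 1) * y t ^ k * y'"
    using DERIV_power[OF assms(3), of "k + 1"] by (simp add: mult_ac)
  moreover have "DERIV (\<lambda>t. x t ^ 2) t :> 2 * x t * x'"
    using DERIV_power[OF assms(2), of 2] by (simp add: mult_ac)
  ultimately show ?thesis unfolding A_type ade_equation.simps ade_dx.simps ade_dy.simps by (rule DERIV_add[rotated])
next
  case (D_type k)
  hence "k - 1 - Suc 0 = k - 2" by simp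
  thus ?thesis
    unfolding D_type using assms(2,3)
    by (auto intro!: derivative_eq_intros simp: algebra_simps power2_eq_square)
qed (use assms in \<open>auto intro!: derivative_eq_intros simp: algebra_simps power2_eq_square\<close>)

lemma norm_monomial_le:
  fixes x y :: complex
  assumes "norm x + norm y \<le> 1" "N \<le> i + j"
  shows "norm (x ^ i * y ^ j) \<le> (norm x + norm y) ^ N"
proof -
  have "norm (x ^ i * y ^ j) \<le> (norm x + norm y) ^ i * (norm x + norm y) ^ j"
    unfolding norm_mult norm_power by (intro mult_mono power_mono) auto
  also have "\<dots> = (norm x + norm y) ^ (i + j)" by (simp add: power_add)
  also have "\<dots> \<le> (norm x + norm y) ^ N" using assms by (intro power_decreasing) auto
  finally show ?thesis .
qed

lemma norm_ade_equation_le: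
  assumes T: "ade_index_ok T" and xy: "norm x + norm y \<le> 1"
  shows "norm (ade_equation T (x, y)) \<le> 2 * (norm x + norm y) ^ ade_mult T"
proof -
  have sum: "norm (x ^ i * y ^ j + x ^ i' * y ^ j') \<le> 2 * (norm x + norm y) ^ N"
    if "N \<le> i + j" "N \<le> i' + j'" for i j i' j' N
    using norm_triangle_ineq[of "x ^ i * y ^ j" "x ^ i' * y ^ j'"]
      norm_monomial_le[OF xy that(1)] norm_monomial_le[OF xy that(2)] by linarith
  show ?thesis
  proof (cases T)
    case (A_type k)
    thus ?thesis using sum[of 2 2 0 0 "k + 1"] T by simp
  next
    case (D_type k)
    thus ?thesis using sum[of 3 2 1 0 "k - 1"] T by simp
  next
    case E6
    thus ?thesis using sum[of 3 3 0 0 4] by simp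
  next
    case E7
    thus ?thesis using sum[of 3 3 0 1 3] by simp
  next
    case E8
    thus ?thesis using sum[of 3 3 0 0 5] by simp
  qed
qed

lemma eq_powr_if_power_eq:
  fixes a b :: real
  assumes "a \<ge> 0" "b > 0" "a ^ p = b ^ q" "p > 0"
  shows "a = b powr (real q / real p)"
proof -
  have "a > 0" using assms by (metis less_eq_real_def power_not_zero less_irrefl zero_less_power power_0_left neq0_conv)
  hence "a = (a powr real p) powr (1 / real p)" using assms(4) by (simp add: powr_powr)
  also have "a powr real p = b powr real q"
    using \<open>a > 0\<close> assms(2,3) by (simp add: powr_realpow)
  finally show ?thesis by (simp add: powr_powr)
qed

text \<open>For nonzero y the equation fixes or bounds \<open>norm x\<close> by a power of
  \<open>norm y\<close>, so the gradient is estimated in \<open>norm y\<close> alone, which is at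
  most \<open>norm x + norm y\<close>.\<close>

lemma norm_ade_gradient_le:
  assumes T: "ade_index_ok T"
  shows "\<exists>C\<ge>0. \<forall>x y. norm x + norm y \<le> 1 \<longrightarrow> ade_equation T (x, y) = 0 \<longrightarrow>
    norm (ade_dx T (x, y)) + norm (ade_dy T (x, y)) \<le>
      C * (norm x + norm y) powr (if y = 0 then ade_exp_axis T else ade_exp T)"
proof -
  \<comment> \<open>These constants dominate the sums of the coefficients in the two partial
    derivatives; 3 + 5 for E8 is the largest among the exceptional types.\<close>
  define C where "C = (case T of A_type k \<Rightarrow> real k + 3 | D_type k \<Rightarrow> real k + 3 | _ \<Rightarrow> 8)"
  have "norm (ade_dx T (x, y)) + norm (ade_dy T (x, y)) \<le>
      C * (norm x + norm y) powr (if y = 0 then ade_exp_axis T else ade_exp T)"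
    if le: "norm x + norm y \<le> 1" and g: "ade_equation T (x, y) = 0" for x y
  proof (cases "y = 0")
    \<comment> \<open>Only D_k has a branch here, with gradient (0, x^2); for the other types
      \<open>y = 0\<close> forces the origin.\<close>
    case y: True
    show ?thesis
    proof (cases T)
      case (A_type k)
      thus ?thesis using T g y by simp
    next
      case (D_type k)
      have "norm x ^ 2 = norm x powr 2" by (cases "x = 0") (auto simp: powr_realpow[of _ 2, simplified])
      moreover have "1 * norm x powr 2 \<le> C * norm x powr 2"
        using D_type by (intro mult_right_mono) (auto simp: C_def)
      ultimately show ?thesis using D_type T y by (simp add: norm_power power_0_left)
    qed (use T g y in auto)
  next
    case y: False
    define b where "b = norm y"
    have b: "0 < b" "b \<le> 1" using y le norm_ge_zero[of x] unfolding b_def by (auto simp del: norm_ge_zero)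
    have pow: "b ^ i \<le> b powr s" if "s \<le> real i" for i s
      using powr_mono'[OF that, of b] b by (simp add: powr_realpow)
    have fin: ?thesis if "norm (ade_dx T (x, y)) + norm (ade_dy T (x, y)) \<le> C * b powr ade_exp T"
    proof -
      have "C \<ge> 0" by (cases T) (auto simp: C_def)
      moreover have "ade_exp T \<ge> 0" using ade_exponents[OF T] by linarith
      ultimately have "C * b powr ade_exp T \<le> C * (norm x + norm y) powr ade_exp T"
        using b by (intro mult_left_mono powr_mono2) (auto simp: b_def)
      thus ?thesis using that y by simp
    qed
    show ?thesis
    proof (rule fin, cases T)
      case (A_type k)
      have "x ^ 2 = - (y ^ (k + 1))" using g A_type by (simp add: eq_neg_iff_add_eq_0)
      hence "norm (x ^ 2) = norm (y ^ (k + 1))" by (simp only: norm_minus_cancel)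
      hence "norm x ^ 2 = b ^ (k + 1)" by (simp only: norm_power b_def)
      from eq_powr_if_power_eq[OF _ b(1) this]
      have x: "norm x = b powr ((real k + 1) / 2)" by (simp add: add.commute)
      have "norm (ade_dx T (x, y)) + norm (ade_dy T (x, y)) = 2 * norm x + (real k + 1) * b ^ k"
        using norm_of_nat[of "k + 1", where ?'a = complex]
        unfolding A_type by (simp add: norm_mult norm_power b_def add.commute)
      also have "\<dots> \<le> 2 * b powr ((real k + 1) / 2) + (real k + 1) * b powr ((real k + 1) / 2)"
        using T A_type x by (intro add_mono mult_left_mono pow) auto
      also have "\<dots> = C * b powr ade_exp T" by (simp add: C_def A_type algebra_simps)
      finally show "norm (ade_dx T (x, y)) + norm (ade_dy T (x, y)) \<le> C * b powr ade_exp T" .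
    next
      case (D_type k)
      have k: "k \<ge> 4" using T D_type by simp
      have "y * (x ^ 2 + y ^ (k - 2)) = 0"
      proof -
        have "k - 1 = Suc (k - 2)" using k by simp
        hence "y ^ (k - 1) = y * y ^ (k - 2)" by simp
        thus ?thesis using g D_type by (simp add: algebra_simps)
      qed
      hence x2: "x ^ 2 = - (y ^ (k - 2))" using y by (simp add: eq_neg_iff_add_eq_0)
      hence "norm (x ^ 2) = norm (y ^ (k - 2))" by (simp only: norm_minus_cancel)
      hence nx2: "norm x ^ 2 = b ^ (k - 2)" by (simp only: norm_power b_def)
      from eq_powr_if_power_eq[OF _ b(1) this]
      have x: "norm x = b powr ((real k - 2) / 2)" using k by (simp add: of_nat_diff)
      have "norm x * b = b powr ((real k - 2) / 2 + 1)"
        using b unfolding x powr_add by simp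
      also have "(real k - 2) / 2 + 1 = real k / 2" by (simp add: field_simps)
      finally have xb: "norm x * b = b powr (real k / 2)" .
      have "norm (ade_dx T (x, y)) = 2 * (norm x * b)"
        unfolding D_type by (simp add: norm_mult b_def)
      moreover have "norm (ade_dy T (x, y)) \<le> norm x ^ 2 + real (k - 1) * b ^ (k - 2)"
        unfolding D_type ade_dy.simps
        by (rule order.trans[OF norm_triangle_ineq]) (simp add: norm_mult norm_power b_def)
      ultimately have "norm (ade_dx T (x, y)) + norm (ade_dy T (x, y)) \<le>
          2 * b powr (real k / 2) + (b ^ (k - 2) + real (k - 1) * b ^ (k - 2))"
        unfolding xb nx2 by linarith
      also have "\<dots> \<le> 2 * b powr (real k / 2) + (b powr (real k / 2) + real (k - 1) * b powr (real k / 2))"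
        using k by (intro add_mono mult_left_mono pow order.refl) (auto simp: of_nat_diff)
      also have "\<dots> = (real k + 2) * b powr (real k / 2)" using k by (simp add: of_nat_diff algebra_simps)
      also have "\<dots> \<le> C * b powr (real k / 2)"
        using D_type by (intro mult_right_mono) (auto simp: C_def)
      finally show "norm (ade_dx T (x, y)) + norm (ade_dy T (x, y)) \<le> C * b powr ade_exp T"
        by (simp add: D_type)
    next
      case E6
      have "x ^ 3 = - (y ^ 4)" using g E6 by (simp add: eq_neg_iff_add_eq_0)
      hence "norm (x ^ 3) = norm (y ^ 4)" by (simp only: norm_minus_cancel)
      hence "norm x ^ 3 = b ^ 4" by (simp only: norm_power b_def)
      from eq_powr_if_power_eq[OF _ b(1) this] have x: "norm x = b powr (4 / 3)" by simp
      have "norm x ^ 2 = b powr (8 / 3)" using b by (simp add: x power2_eq_square flip: powr_add)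
      moreover have "b ^ 3 \<le> b powr (8 / 3)" by (rule pow) simp
      ultimately have "3 * norm x ^ 2 + 4 * b ^ 3 \<le> 8 * b powr (8 / 3)"
        using powr_ge_zero[of b "8 / 3"] by linarith
      thus "norm (ade_dx T (x, y)) + norm (ade_dy T (x, y)) \<le> C * b powr ade_exp T"
        by (simp add: E6 C_def norm_mult norm_power flip: b_def)
    next
      case E7
      \<comment> \<open>Both components, x = 0 and the cusp x^2 = -y^3, satisfy the bound
        \<open>x2\<close> and are then treated together.\<close>
      have cases: "x = 0 \<or> x ^ 2 = - (y ^ 3)"
      proof -
        have "x * (x ^ 2 + y ^ 3) = 0" using g E7 by (simp add: algebra_simps power3_eq_cube power2_eq_square)
        thus ?thesis by (simp add: eq_neg_iff_add_eq_0)
      qed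
      have b3: "b ^ 3 = b powr 3" using b powr_realpow[of b 3] by simp
      have x2: "norm x ^ 2 \<le> b ^ 3"
        using cases b by (auto simp: norm_power[symmetric] b_def)
      have x1: "norm x \<le> 1" using le norm_ge_zero[of y] by linarith
      \<comment> \<open>Squaring replaces the fractional power of \<open>b\<close> that bounds
        \<open>norm x\<close> by the cube in \<open>x2\<close>.\<close>
      have xle: "norm x * b ^ 2 \<le> b ^ 3"
      proof (rule power2_le_imp_le)
        have "(norm x * b ^ 2) ^ 2 \<le> b ^ 3 * (b ^ 2) ^ 2"
          unfolding power_mult_distrib using x2 by (intro mult_right_mono) auto
        also have "\<dots> = b ^ 7" by (simp flip: power_mult power_add)
        also have "\<dots> \<le> b ^ 6" using b by (intro power_decreasing) auto
        also have "\<dots> = (b ^ 3) ^ 2" by (simp flip: power_mult)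
        finally show "(norm x * b ^ 2) ^ 2 \<le> (b ^ 3) ^ 2" .
      qed (use b in auto)
      have "norm (3 * x ^ 2 + y ^ 3) \<le> 3 * norm x ^ 2 + b ^ 3"
        by (rule order.trans[OF norm_triangle_ineq]) (simp add: norm_mult norm_power b_def)
      moreover have "norm (3 * x * y ^ 2) = 3 * (norm x * b ^ 2)"
        by (simp add: norm_mult norm_power b_def)
      ultimately have "norm (ade_dx T (x, y)) + norm (ade_dy T (x, y)) \<le> 7 * b ^ 3"
        using x2 xle by (simp add: E7)
      also have "\<dots> \<le> 8 * b ^ 3" using b by (intro mult_right_mono) auto
      finally show "norm (ade_dx T (x, y)) + norm (ade_dy T (x, y)) \<le> C * b powr ade_exp T"
        by (simp add: E7 C_def flip: b3)
    next
      case E8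
      have "x ^ 3 = - (y ^ 5)" using g E8 by (simp add: eq_neg_iff_add_eq_0)
      hence "norm (x ^ 3) = norm (y ^ 5)" by (simp only: norm_minus_cancel)
      hence "norm x ^ 3 = b ^ 5" by (simp only: norm_power b_def)
      from eq_powr_if_power_eq[OF _ b(1) this] have x: "norm x = b powr (5 / 3)" by simp
      have "norm x ^ 2 = b powr (10 / 3)" using b by (simp add: x power2_eq_square flip: powr_add)
      moreover have "b ^ 4 \<le> b powr (10 / 3)" by (rule pow) simp
      ultimately show "norm (ade_dx T (x, y)) + norm (ade_dy T (x, y)) \<le> C * b powr ade_exp T"
        by (simp add: E8 C_def norm_mult norm_power flip: b_def)
    qed
  qed
  moreover have "C \<ge> 0" by (cases T) (auto simp: C_def)
  ultimately show ?thesis by blast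
qed

text \<open>The limit is the value of the lowest homogeneous part of the normal form in a direction
  off the tangent cone: (1, 1) for D_k and (1, 0) for the other types.\<close>

lemma ade_tangent_direction:
  assumes T: "ade_index_ok T"
  shows "\<exists>\<alpha> \<beta> L. L \<noteq> 0 \<and> (\<forall>X Y. ((\<lambda>t. X t / t) \<longlongrightarrow> \<alpha>) (at 0) \<longrightarrow> ((\<lambda>t. Y t / t) \<longlongrightarrow> \<beta>) (at 0) \<longrightarrow>
    ((\<lambda>t. ade_equation T (X t, Y t) / t ^ ade_mult T) \<longlongrightarrow> L) (at (0 :: complex)))"
proof -
  \<comment> \<open>The normal form has two monomials; \<open>l\<close> and \<open>l'\<close> are
    their degrees in excess of the multiplicity, so that \<open>0 ^ l\<close> and
    \<open>0 ^ l'\<close> keep exactly the lowest-degree part.\<close>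
  have main: "\<exists>\<alpha> \<beta> L. L \<noteq> 0 \<and> (\<forall>X Y. ((\<lambda>t. X t / t) \<longlongrightarrow> \<alpha>) (at 0) \<longrightarrow> ((\<lambda>t. Y t / t) \<longlongrightarrow> \<beta>) (at 0) \<longrightarrow>
      ((\<lambda>t. ade_equation T (X t, Y t) / t ^ ade_mult T) \<longlongrightarrow> L) (at (0 :: complex)))"
    if L: "L \<noteq> 0" "L = \<alpha> ^ i * \<beta> ^ j * 0 ^ l + \<alpha> ^ i' * \<beta> ^ j' * 0 ^ l'"
      and eq: "\<And>x y t. ade_equation T (t * x, t * y) = t ^ ade_mult T * (x ^ i * y ^ j * t ^ l + x ^ i' * y ^ j' * t ^ l')"
    for \<alpha> \<beta> L :: complex and i j l i' j' l'
  proof (rule exI[of _ \<alpha>], rule exI[of _ \<beta>], rule exI[of _ L], intro conjI allI impI)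
    show "L \<noteq> 0" by (rule L(1))
    fix X Y :: "complex \<Rightarrow> complex"
    assume "((\<lambda>t. X t / t) \<longlongrightarrow> \<alpha>) (at 0)" "((\<lambda>t. Y t / t) \<longlongrightarrow> \<beta>) (at 0)"
    hence "((\<lambda>t. (X t / t) ^ i * (Y t / t) ^ j * t ^ l + (X t / t) ^ i' * (Y t / t) ^ j' * t ^ l') \<longlongrightarrow> L) (at 0)"
      unfolding L(2) by (intro tendsto_intros)
    moreover have "\<forall>\<^sub>F t in at 0. (X t / t) ^ i * (Y t / t) ^ j * t ^ l + (X t / t) ^ i' * (Y t / t) ^ j' * t ^ l' =
        ade_equation T (X t, Y t) / t ^ ade_mult T"
    proof (rule eventually_mono[OF eventually_at_ball'[of 1 0 UNIV]])
      fix t :: complex assume "t \<in> ball 0 1 \<and> t \<noteq> 0 \<and> t \<in> UNIV"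
      thus "(X t / t) ^ i * (Y t / t) ^ j * t ^ l + (X t / t) ^ i' * (Y t / t) ^ j' * t ^ l' =
          ade_equation T (X t, Y t) / t ^ ade_mult T"
        using eq[of t "X t / t" "Y t / t"] by simp
    qed simp
    ultimately show "((\<lambda>t. ade_equation T (X t, Y t) / t ^ ade_mult T) \<longlongrightarrow> L) (at 0)"
      by (rule Lim_transform_eventually)
  qed
  show ?thesis
  proof (cases T)
    case (A_type k)
    have "t ^ (k + 1) = t ^ 2 * t ^ (k - 1)" for t :: complex
      using T A_type by (simp flip: power_add)
    hence "ade_equation T (t * x, t * y) = t ^ ade_mult T * (x ^ 2 * y ^ 0 * t ^ 0 + x ^ 0 * y ^ (k + 1) * t ^ (k - 1))" for x y t
      by (simp only: A_type ade_equation.simps ade_mult.simps power_mult_distrib power_0 mult_1_left mult_1_right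
          distrib_left mult_ac)
    from main[OF _ _ this, of 1 1 0] show ?thesis by simp
  next
    case (D_type k)
    have k: "k - 1 = 3 + (k - 4)" using T D_type by simp
    hence "t ^ (k - 1) = t ^ 3 * t ^ (k - 4)" for t :: complex
      by (metis power_add)
    hence "ade_equation T (t * x, t * y) = t ^ 3 * x ^ 2 * y + t ^ 3 * t ^ (k - 4) * y ^ (k - 1)" for x y t
      unfolding D_type ade_equation.simps power_mult_distrib by (simp add: power2_eq_square power3_eq_cube)
    hence "ade_equation T (t * x, t * y) = t ^ ade_mult T * (x ^ 2 * y ^ 1 * t ^ 0 + x ^ 0 * y ^ (k - 1) * t ^ (k - 4))" for x y t
      by (simp only: D_type ade_mult.simps power_0 power_one_right mult_1_left mult_1_right distrib_left mult_ac)
    \<comment> \<open>For D_4 both monomials are cubic, which the term \<open>0 ^ (k - 4)\<close>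
      takes into account.\<close>
    from main[OF _ _ this, of "1 + 0 ^ (k - 4)" 1 1] show ?thesis by (cases "k - 4 = 0") (simp_all add: power_0_left)
  next
    case E6
    have "ade_equation T (t * x, t * y) = t ^ ade_mult T * (x ^ 3 * y ^ 0 * t ^ 0 + x ^ 0 * y ^ 4 * t ^ 1)" for x y t
      by (simp add: E6 power_numeral_reduce algebra_simps)
    from main[OF _ _ this, of 1 1 0] show ?thesis by simp
  next
    case E7
    have "ade_equation T (t * x, t * y) = t ^ ade_mult T * (x ^ 3 * y ^ 0 * t ^ 0 + x ^ 1 * y ^ 3 * t ^ 1)" for x y t
      by (simp add: E7 power_numeral_reduce algebra_simps)
    from main[OF _ _ this, of 1 1 0] show ?thesis by simp
  next
    case E8
    have "ade_equation T (t * x, t * y) = t ^ ade_mult T * (x ^ 3 * y ^ 0 * t ^ 0 + x ^ 0 * y ^ 5 * t ^ 2)" for x y t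
      by (simp add: E8 power_numeral_reduce algebra_simps)
    from main[OF _ _ this, of 1 1 0] show ?thesis by simp
  qed
qed

subsection \<open>Analytic charts at an ADE point\<close>

lemma DERIV_compose_holomorphic2:
  assumes f: "(f has_derivative (\<lambda>(h, k). a * h + b * k)) (at (x t, y t))"
    and xy: "DERIV x t :> x'" "DERIV y t :> y'"
  shows "DERIV (\<lambda>t. f (x t, y t)) t :> a * x' + b * (y' :: complex)"
proof -
  have "((\<lambda>t. (x t, y t)) has_derivative (\<lambda>h. (x' * h, y' * h))) (at t)"
    using xy unfolding has_field_derivative_def by (rule has_derivative_Pair)
  from has_derivative_compose[OF this f]
  have "((\<lambda>t. f (x t, y t)) has_derivative (\<lambda>h. a * (x' * h) + b * (y' * h))) (at t)" by simp
  also have "(\<lambda>h. a * (x' * h) + b * (y' * h)) = (*) (a * x' + b * y')"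
    by (rule ext) (simp add: algebra_simps)
  finally show ?thesis unfolding has_field_derivative_def .
qed

lemma has_derivative_0_linear_bound:
  fixes f :: "complex \<times> complex \<Rightarrow> complex"
  assumes "(f has_derivative f') (at 0)" "f 0 = 0"
  obtains C \<delta> where "C > 0" "\<delta> > 0" "\<And>v. norm v < \<delta> \<Longrightarrow> norm (f v) \<le> C * norm v"
proof -
  have "bounded_linear f'" using assms(1) by (rule has_derivative_bounded_linear)
  then obtain K where K: "K \<ge> 0" "\<And>v. norm (f' v) \<le> norm v * K"
    using bounded_linear.nonneg_bounded by blast
  have "\<forall>e>0. \<exists>d>0. \<forall>y. norm (y - 0) < d \<longrightarrow> norm (f y - f 0 - f' (y - 0)) \<le> e * norm (y - 0)"
    using assms(1) unfolding has_derivative_at_alt by (rule conjunct2)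
  from this[rule_format, of 1] obtain \<delta> where
    \<delta>: "\<delta> > 0" "\<And>v. norm v < \<delta> \<Longrightarrow> norm (f v - f' v) \<le> 1 * norm v"
    using assms(2) by auto
  have "norm (f v) \<le> (K + 1) * norm v" if "norm v < \<delta>" for v
    using norm_triangle_ineq[of "f v - f' v" "f' v"] \<delta>(2)[OF that] K(2)[of v] by (simp add: algebra_simps)
  thus ?thesis using that[of "K + 1" \<delta>] K(1) \<delta>(1) by simp
qed

text \<open>Keeps the witnesses of \<open>has_ade_type\<close>, including the inverse chart
  \<open>\<psi>\<close>, in one predicate, so that the same chart can pass through a linear change
  of coordinates and through several estimates.\<close>

definition ade_chart :: "poly3 \<Rightarrow> (complex^3) set \<Rightarrow> ade \<Rightarrow> complex^3^3 \<Rightarrow> (complex \<times> complex \<Rightarrow> complex \<times> complex) \<Rightarrow>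
    (complex \<times> complex \<Rightarrow> complex \<times> complex) \<Rightarrow> (complex \<times> complex \<Rightarrow> complex) \<Rightarrow> (complex \<times> complex) set \<Rightarrow> (complex \<times> complex) set \<Rightarrow> bool" where
  "ade_chart F p T A \<phi> \<psi> u U V \<longleftrightarrow> ade_index_ok T \<and> invertible A \<and> p = vec.span {A *v e\<^sub>3} \<and>
    open U \<and> open V \<and> 0 \<in> U \<and> 0 \<in> V \<and> homeomorphism U V \<phi> \<psi> \<and>
    holomorphic2_on (fst \<circ> \<phi>) U \<and> holomorphic2_on (snd \<circ> \<phi>) U \<and>
    holomorphic2_on (fst \<circ> \<psi>) V \<and> holomorphic2_on (snd \<circ> \<psi>) V \<and> \<phi> 0 = 0 \<and> holomorphic2_on u U \<and>
    (\<forall>s t. (s, t) \<in> U \<longrightarrow> u (s, t) \<noteq> 0 \<and> eval3 F (A *v vector [s, t, 1]) = u (s, t) * ade_equation T (\<phi> (s, t)))"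

lemma has_ade_type_chart:
  assumes "has_ade_type F p T"
  obtains A \<phi> \<psi> u U V where "ade_chart F p T A \<phi> \<psi> u U V"
proof -
  obtain A U V \<phi> \<psi> u where h: "ade_index_ok T" "invertible A" "p = vec.span {A *v e\<^sub>3}"
    "open U" "open V" "0 \<in> U" "0 \<in> V" "homeomorphism U V \<phi> \<psi>"
    "holomorphic2_on (fst \<circ> \<phi>) U" "holomorphic2_on (snd \<circ> \<phi>) U"
    "holomorphic2_on (fst \<circ> \<psi>) V" "holomorphic2_on (snd \<circ> \<psi>) V" "\<phi> 0 = 0" "holomorphic2_on u U"
    and eq: "\<forall>z\<in>U. u z \<noteq> 0 \<and> (\<lambda>(s, t). eval3 F (A *v vector [s, t, 1])) z = u z * ade_equation T (\<phi> z)"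
    using assms unfolding has_ade_type_def analytically_equivalent_def biholomorphism_def e\<^sub>3_def[symmetric] by metis
  have "ade_chart F p T A \<phi> \<psi> u U V" unfolding ade_chart_def using h eq by auto
  thus ?thesis by (rule that)
qed

lemma ade_chart_linear_subst:
  assumes chart: "ade_chart F p T A \<phi> \<psi> u U V"
    and MM: "M ** M' = Finite_Cartesian_Product.mat 1" "M' ** M = Finite_Cartesian_Product.mat 1"
  shows "ade_chart (linear_subst M F) (vec.span {M' *v (A *v e\<^sub>3)}) T (M' ** A) \<phi> \<psi> u U V"
proof -
  have "invertible M'" using MM unfolding invertible_def by blast
  hence "invertible (M' ** A)" using chart unfolding ade_chart_def by (simp add: invertible_mult)
  moreover have "M *v (M' ** A *v v) = A *v v" for v
    using MM(1) by (metis matrix_mul_assoc matrix_mul_lid matrix_vector_mul_assoc)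
  ultimately show ?thesis
    using chart unfolding ade_chart_def by (simp add: matrix_vector_mul_assoc)
qed

text \<open>The last two identities come from differentiating \<open>\<phi> (\<psi> v) = v\<close>
  along lines through 0. They make the derivative of \<open>\<psi>\<close> injective, so the axis y
  = 0 has a nonzero image direction.\<close>

lemma ade_chart_derivatives:
  assumes chart: "ade_chart F p T A \<phi> \<psi> u U V"
  obtains a\<^sub>1 b\<^sub>1 a\<^sub>2 b\<^sub>2 c\<^sub>1 d\<^sub>1 c\<^sub>2 d\<^sub>2 where
    "((fst \<circ> \<psi>) has_derivative (\<lambda>(h, k). a\<^sub>1 * h + b\<^sub>1 * k)) (at 0)"
    "((snd \<circ> \<psi>) has_derivative (\<lambda>(h, k). a\<^sub>2 * h + b\<^sub>2 * k)) (at 0)"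
    "((fst \<circ> \<phi>) has_derivative (\<lambda>(h, k). c\<^sub>1 * h + d\<^sub>1 * k)) (at 0)"
    "((snd \<circ> \<phi>) has_derivative (\<lambda>(h, k). c\<^sub>2 * h + d\<^sub>2 * k)) (at 0)"
    "\<forall>\<alpha> \<beta>. c\<^sub>1 * (a\<^sub>1 * \<alpha> + b\<^sub>1 * \<beta>) + d\<^sub>1 * (a\<^sub>2 * \<alpha> + b\<^sub>2 * \<beta>) = \<alpha>"
    "\<forall>\<alpha> \<beta>. c\<^sub>2 * (a\<^sub>1 * \<alpha> + b\<^sub>1 * \<beta>) + d\<^sub>2 * (a\<^sub>2 * \<alpha> + b\<^sub>2 * \<beta>) = \<beta>"
proof -
  have UV: "open V" "0 \<in> U" "0 \<in> V" "homeomorphism U V \<phi> \<psi>" "\<phi> 0 = 0"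
    using chart unfolding ade_chart_def by auto
  have \<psi>0: "\<psi> 0 = 0" using UV by (metis homeomorphism_apply1)
  obtain a\<^sub>1 b\<^sub>1 a\<^sub>2 b\<^sub>2 c\<^sub>1 d\<^sub>1 c\<^sub>2 d\<^sub>2 where
    D: "((fst \<circ> \<psi>) has_derivative (\<lambda>(h, k). a\<^sub>1 * h + b\<^sub>1 * k)) (at 0)"
    "((snd \<circ> \<psi>) has_derivative (\<lambda>(h, k). a\<^sub>2 * h + b\<^sub>2 * k)) (at 0)"
    "((fst \<circ> \<phi>) has_derivative (\<lambda>(h, k). c\<^sub>1 * h + d\<^sub>1 * k)) (at 0)"
    "((snd \<circ> \<phi>) has_derivative (\<lambda>(h, k). c\<^sub>2 * h + d\<^sub>2 * k)) (at 0)"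
    using chart unfolding ade_chart_def holomorphic2_on_def by metis
  have key: "DERIV (\<lambda>\<tau>. f (\<psi> (\<tau> * \<alpha>, \<tau> * \<beta>))) 0 :> c * (a\<^sub>1 * \<alpha> + b\<^sub>1 * \<beta>) + d * (a\<^sub>2 * \<alpha> + b\<^sub>2 * \<beta>)"
    if f: "(f has_derivative (\<lambda>(h, k). c * h + d * k)) (at 0)" for f :: "complex \<times> complex \<Rightarrow> complex" and c d \<alpha> \<beta>
  proof -
    have lin: "DERIV (\<lambda>\<tau>. \<tau> * \<alpha>) 0 :> \<alpha>" "DERIV (\<lambda>\<tau>. \<tau> * \<beta>) 0 :> \<beta>"
      by (auto intro!: derivative_eq_intros)
    have 1: "DERIV (\<lambda>\<tau>. (fst \<circ> \<psi>) (\<tau> * \<alpha>, \<tau> * \<beta>)) 0 :> a\<^sub>1 * \<alpha> + b\<^sub>1 * \<beta>"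
      by (rule DERIV_compose_holomorphic2[of "fst \<circ> \<psi>", OF _ lin]) (use D(1) in \<open>simp add: zero_prod_def\<close>)
    have 2: "DERIV (\<lambda>\<tau>. (snd \<circ> \<psi>) (\<tau> * \<alpha>, \<tau> * \<beta>)) 0 :> a\<^sub>2 * \<alpha> + b\<^sub>2 * \<beta>"
      by (rule DERIV_compose_holomorphic2[of "snd \<circ> \<psi>", OF _ lin]) (use D(2) in \<open>simp add: zero_prod_def\<close>)
    have "DERIV (\<lambda>\<tau>. f ((fst \<circ> \<psi>) (\<tau> * \<alpha>, \<tau> * \<beta>), (snd \<circ> \<psi>) (\<tau> * \<alpha>, \<tau> * \<beta>))) 0 :>
        c * (a\<^sub>1 * \<alpha> + b\<^sub>1 * \<beta>) + d * (a\<^sub>2 * \<alpha> + b\<^sub>2 * \<beta>)"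
      by (rule DERIV_compose_holomorphic2[OF _ 1 2]) (use f \<psi>0 in \<open>simp add: zero_prod_def\<close>)
    thus ?thesis by simp
  qed
  have "open {\<tau>. (\<tau> * \<alpha>, \<tau> * \<beta>) \<in> V}" for \<alpha> \<beta>
    using open_vimage[OF UV(1), of "\<lambda>\<tau>. (\<tau> * \<alpha>, \<tau> * \<beta>)"] by (simp add: vimage_def continuous_intros)
  moreover have "0 \<in> {\<tau>. (\<tau> * \<alpha>, \<tau> * \<beta>) \<in> V}" for \<alpha> \<beta> using UV(3) by (simp add: zero_prod_def)
  ultimately have ev: "\<forall>\<^sub>F \<tau> in nhds 0. (\<tau> * \<alpha>, \<tau> * \<beta>) \<in> V" for \<alpha> \<beta>
    using eventually_nhds by blast
  have inv: "\<phi> (\<psi> v) = v" if "v \<in> V" for v using UV(4) that by (rule homeomorphism_apply2)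
  have 1: "c\<^sub>1 * (a\<^sub>1 * \<alpha> + b\<^sub>1 * \<beta>) + d\<^sub>1 * (a\<^sub>2 * \<alpha> + b\<^sub>2 * \<beta>) = \<alpha>" for \<alpha> \<beta>
  proof -
    have "\<forall>\<^sub>F \<tau> in nhds 0. (fst \<circ> \<phi>) (\<psi> (\<tau> * \<alpha>, \<tau> * \<beta>)) = \<tau> * \<alpha>"
      using ev[of \<alpha> \<beta>] by (rule eventually_mono) (simp add: inv)
    hence "DERIV (\<lambda>\<tau>. \<tau> * \<alpha>) 0 :> c\<^sub>1 * (a\<^sub>1 * \<alpha> + b\<^sub>1 * \<beta>) + d\<^sub>1 * (a\<^sub>2 * \<alpha> + b\<^sub>2 * \<beta>)"
      using key[OF D(3), of \<alpha> \<beta>] by (subst (asm) DERIV_cong_ev[OF refl _ refl]) auto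
    moreover have "DERIV (\<lambda>\<tau>. \<tau> * \<alpha>) 0 :> \<alpha>" by (auto intro!: derivative_eq_intros)
    ultimately show ?thesis by (rule DERIV_unique)
  qed
  have 2: "c\<^sub>2 * (a\<^sub>1 * \<alpha> + b\<^sub>1 * \<beta>) + d\<^sub>2 * (a\<^sub>2 * \<alpha> + b\<^sub>2 * \<beta>) = \<beta>" for \<alpha> \<beta>
  proof -
    have "\<forall>\<^sub>F \<tau> in nhds 0. (snd \<circ> \<phi>) (\<psi> (\<tau> * \<alpha>, \<tau> * \<beta>)) = \<tau> * \<beta>"
      using ev[of \<alpha> \<beta>] by (rule eventually_mono) (simp add: inv)
    hence "DERIV (\<lambda>\<tau>. \<tau> * \<beta>) 0 :> c\<^sub>2 * (a\<^sub>1 * \<alpha> + b\<^sub>1 * \<beta>) + d\<^sub>2 * (a\<^sub>2 * \<alpha> + b\<^sub>2 * \<beta>)"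
      using key[OF D(4), of \<alpha> \<beta>] by (subst (asm) DERIV_cong_ev[OF refl _ refl]) auto
    moreover have "DERIV (\<lambda>\<tau>. \<tau> * \<beta>) 0 :> \<beta>" by (auto intro!: derivative_eq_intros)
    ultimately show ?thesis by (rule DERIV_unique)
  qed
  show ?thesis using that[OF D] 1 2 by blast
qed

text \<open>A finite nonzero limit means that the order at 0 is exactly \<open>R\<close>, so the
  coefficient is the value at 0 of the nonvanishing cofactor.\<close>

lemma coeff_nonzero_if_limit:
  fixes k :: "complex poly"
  assumes lim: "((\<lambda>t. poly k t / t ^ R) \<longlongrightarrow> L) (at 0)" and L: "L \<noteq> 0"
  shows "coeff k R \<noteq> 0"
proof -
  have "k \<noteq> 0"
  proof
    assume "k = 0"
    hence "L = 0" using lim tendsto_unique[OF _ lim, of 0] by (simp add: at_neq_bot)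
    thus False using L by simp
  qed
  then obtain q where q: "k = [:- 0, 1:] ^ order 0 k * q" "\<not> [:- 0, 1:] dvd q" using order_decomp by blast
  define m where "m = order 0 k"
  have kq: "poly k t = t ^ m * poly q t" for t by (subst q(1)) (simp add: m_def)
  have q0: "poly q 0 \<noteq> 0" using q(2) by (simp only: poly_eq_0_iff_dvd) simp
  have qlim: "((\<lambda>t. poly q t) \<longlongrightarrow> poly q 0) (at 0)" by (intro tendsto_intros)
  have "m = R"
  proof (rule ccontr)
    assume "m \<noteq> R"
    then consider "m < R" | "m > R" by linarith
    thus False
    proof cases
      case 1
      have "((\<lambda>t. t ^ (R - m) * (poly k t / t ^ R)) \<longlongrightarrow> 0 ^ (R - m) * L) (at 0)"
        by (intro tendsto_intros lim)
      moreover have "\<forall>\<^sub>F t in at 0. t ^ (R - m) * (poly k t / t ^ R) = poly q t"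
        unfolding eventually_at_filter
      proof (intro always_eventually allI impI)
        fix t :: complex assume "t \<noteq> 0"
        moreover have "t ^ R = t ^ (R - m) * t ^ m" using 1 by (simp flip: power_add)
        ultimately show "t ^ (R - m) * (poly k t / t ^ R) = poly q t" by (simp add: kq)
      qed
      ultimately have "((\<lambda>t. poly q t) \<longlongrightarrow> 0 ^ (R - m) * L) (at 0)" by (rule Lim_transform_eventually)
      hence "poly q 0 = 0 ^ (R - m) * L" using tendsto_unique[OF _ qlim] by (simp add: at_neq_bot)
      thus False using q0 1 by (simp add: power_0_left)
    next
      case 2
      have "((\<lambda>t. t ^ (m - R) * poly q t) \<longlongrightarrow> 0 ^ (m - R) * poly q 0) (at 0)" by (intro tendsto_intros)
      moreover have "\<forall>\<^sub>F t in at 0. t ^ (m - R) * poly q t = poly k t / t ^ R"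
        unfolding eventually_at_filter
      proof (intro always_eventually allI impI)
        fix t :: complex assume "t \<noteq> 0"
        moreover have "t ^ m = t ^ (m - R) * t ^ R" using 2 by (simp flip: power_add)
        ultimately show "t ^ (m - R) * poly q t = poly k t / t ^ R" by (simp add: kq)
      qed
      ultimately have "((\<lambda>t. poly k t / t ^ R) \<longlongrightarrow> 0 ^ (m - R) * poly q 0) (at 0)"
        by (rule Lim_transform_eventually)
      hence "L = 0 ^ (m - R) * poly q 0" using tendsto_unique[OF _ lim] by (simp add: at_neq_bot)
      thus False using L 2 by (simp add: power_0_left)
    qed
  qed
  hence "k = monom 1 R * q" using q(1) by (simp add: m_def monom_altdef)
  hence "coeff k R = coeff q 0" by (simp add: coeff_monom_mult)
  thus ?thesis using q0 by (simp add: poly_0_coeff_0)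
qed

lemma DERIV_0_quotient_limit:
  fixes f :: "complex \<Rightarrow> complex"
  assumes "DERIV f 0 :> D" "f 0 = 0"
  shows "((\<lambda>t. f t / t) \<longlongrightarrow> D) (at 0)"
  using assms by (simp add: DERIV_def)

text \<open>Take the line whose direction the derivative of the chart maps to the one of
  \<open>ade_tangent_direction\<close>; there \<open>F\<close> divided by the power of the parameter
  tends to \<open>u 0 * L\<close>, which is nonzero.\<close>

lemma ade_chart_multiplicity:
  assumes chart: "ade_chart F p T A \<phi> \<psi> u U V"
  obtains w where "coeff (line_poly F (A *v e\<^sub>3) w) (ade_mult T) \<noteq> 0"
proof -
  have T: "ade_index_ok T" and U: "open U" "0 \<in> U" and \<phi>0: "\<phi> 0 = 0" and hu: "holomorphic2_on u U"
    and eq: "\<And>s t. (s, t) \<in> U \<Longrightarrow> u (s, t) \<noteq> 0 \<and> eval3 F (A *v vector [s, t, 1]) = u (s, t) * ade_equation T (\<phi> (s, t))"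
    using chart unfolding ade_chart_def by auto
  from ade_tangent_direction[OF T] obtain \<alpha> \<beta> L where L: "L \<noteq> 0"
    "\<forall>X Y. ((\<lambda>t. X t / t) \<longlongrightarrow> \<alpha>) (at 0) \<longrightarrow> ((\<lambda>t. Y t / t) \<longlongrightarrow> \<beta>) (at 0) \<longrightarrow>
      ((\<lambda>t. ade_equation T (X t, Y t) / t ^ ade_mult T) \<longlongrightarrow> L) (at (0 :: complex))"
    by (elim exE conjE)
  note L(2)[rule_format]
  note L = L(1) this
  obtain a\<^sub>1 b\<^sub>1 a\<^sub>2 b\<^sub>2 c\<^sub>1 d\<^sub>1 c\<^sub>2 d\<^sub>2 where
    "((fst \<circ> \<psi>) has_derivative (\<lambda>(h, k). a\<^sub>1 * h + b\<^sub>1 * k)) (at 0)"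
    "((snd \<circ> \<psi>) has_derivative (\<lambda>(h, k). a\<^sub>2 * h + b\<^sub>2 * k)) (at 0)"
    and D: "((fst \<circ> \<phi>) has_derivative (\<lambda>(h, k). c\<^sub>1 * h + d\<^sub>1 * k)) (at 0)"
    "((snd \<circ> \<phi>) has_derivative (\<lambda>(h, k). c\<^sub>2 * h + d\<^sub>2 * k)) (at 0)"
    "\<forall>\<alpha> \<beta>. c\<^sub>1 * (a\<^sub>1 * \<alpha> + b\<^sub>1 * \<beta>) + d\<^sub>1 * (a\<^sub>2 * \<alpha> + b\<^sub>2 * \<beta>) = \<alpha>"
    "\<forall>\<alpha> \<beta>. c\<^sub>2 * (a\<^sub>1 * \<alpha> + b\<^sub>1 * \<beta>) + d\<^sub>2 * (a\<^sub>2 * \<alpha> + b\<^sub>2 * \<beta>) = \<beta>"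
    by (rule ade_chart_derivatives[OF chart])
  define w\<^sub>1 where "w\<^sub>1 = a\<^sub>1 * \<alpha> + b\<^sub>1 * \<beta>"
  define w\<^sub>2 where "w\<^sub>2 = a\<^sub>2 * \<alpha> + b\<^sub>2 * \<beta>"
  define w where "w = A *v vector [w\<^sub>1, w\<^sub>2, 0]"
  have lin: "DERIV (\<lambda>\<tau>. \<tau> * w\<^sub>1) 0 :> w\<^sub>1" "DERIV (\<lambda>\<tau>. \<tau> * w\<^sub>2) 0 :> w\<^sub>2"
    by (auto intro!: derivative_eq_intros)
  have "DERIV (\<lambda>\<tau>. (fst \<circ> \<phi>) (\<tau> * w\<^sub>1, \<tau> * w\<^sub>2)) 0 :> c\<^sub>1 * w\<^sub>1 + d\<^sub>1 * w\<^sub>2"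
    by (rule DERIV_compose_holomorphic2[of "fst \<circ> \<phi>", OF _ lin]) (use D(1) in \<open>simp add: zero_prod_def\<close>)
  hence 1: "((\<lambda>\<tau>. fst (\<phi> (\<tau> * w\<^sub>1, \<tau> * w\<^sub>2)) / \<tau>) \<longlongrightarrow> \<alpha>) (at 0)"
    using DERIV_0_quotient_limit \<phi>0 D(3)[rule_format, of \<alpha> \<beta>] by (simp add: w\<^sub>1_def w\<^sub>2_def zero_prod_def)
  have "DERIV (\<lambda>\<tau>. (snd \<circ> \<phi>) (\<tau> * w\<^sub>1, \<tau> * w\<^sub>2)) 0 :> c\<^sub>2 * w\<^sub>1 + d\<^sub>2 * w\<^sub>2"
    by (rule DERIV_compose_holomorphic2[of "snd \<circ> \<phi>", OF _ lin]) (use D(2) in \<open>simp add: zero_prod_def\<close>)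
  hence 2: "((\<lambda>\<tau>. snd (\<phi> (\<tau> * w\<^sub>1, \<tau> * w\<^sub>2)) / \<tau>) \<longlongrightarrow> \<beta>) (at 0)"
    using DERIV_0_quotient_limit \<phi>0 D(4)[rule_format, of \<alpha> \<beta>] by (simp add: w\<^sub>1_def w\<^sub>2_def zero_prod_def)
  obtain a b where "(u has_derivative (\<lambda>(h, k). a * h + b * k)) (at 0)"
    using hu U(2) unfolding holomorphic2_on_def by blast
  hence "DERIV (\<lambda>\<tau>. u (\<tau> * w\<^sub>1, \<tau> * w\<^sub>2)) 0 :> a * w\<^sub>1 + b * w\<^sub>2"
    by (intro DERIV_compose_holomorphic2 lin) (simp add: zero_prod_def)
  hence "((\<lambda>\<tau>. u (\<tau> * w\<^sub>1, \<tau> * w\<^sub>2)) \<longlongrightarrow> u (0 * w\<^sub>1, 0 * w\<^sub>2)) (at 0)"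
    using DERIV_isCont isCont_def by blast
  from tendsto_mult[OF this L(2)[OF 1 2]]
  have lim: "((\<lambda>\<tau>. u (\<tau> * w\<^sub>1, \<tau> * w\<^sub>2) * (ade_equation T (\<phi> (\<tau> * w\<^sub>1, \<tau> * w\<^sub>2)) / \<tau> ^ ade_mult T)) \<longlongrightarrow> u 0 * L) (at 0)"
    by (simp add: zero_prod_def)
  have "open {\<tau>. (\<tau> * w\<^sub>1, \<tau> * w\<^sub>2) \<in> U}"
    using open_vimage[OF U(1), of "\<lambda>\<tau>. (\<tau> * w\<^sub>1, \<tau> * w\<^sub>2)"] by (simp add: vimage_def continuous_intros)
  moreover have "0 \<in> {\<tau>. (\<tau> * w\<^sub>1, \<tau> * w\<^sub>2) \<in> U}" using U(2) by (simp add: zero_prod_def)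
  ultimately have "\<forall>\<^sub>F \<tau> in nhds 0. (\<tau> * w\<^sub>1, \<tau> * w\<^sub>2) \<in> U"
    using eventually_nhds by blast
  hence "\<forall>\<^sub>F \<tau> in at 0. (\<tau> * w\<^sub>1, \<tau> * w\<^sub>2) \<in> U"
    unfolding eventually_at_filter by (rule eventually_mono) simp
  hence "\<forall>\<^sub>F \<tau> in at 0. u (\<tau> * w\<^sub>1, \<tau> * w\<^sub>2) * (ade_equation T (\<phi> (\<tau> * w\<^sub>1, \<tau> * w\<^sub>2)) / \<tau> ^ ade_mult T) =
      poly (line_poly F (A *v e\<^sub>3) w) \<tau> / \<tau> ^ ade_mult T"
  proof (rule eventually_mono)
    fix \<tau> assume \<tau>: "(\<tau> * w\<^sub>1, \<tau> * w\<^sub>2) \<in> U"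
    have "A *v e\<^sub>3 + \<tau> *s w = A *v vector [\<tau> * w\<^sub>1, \<tau> * w\<^sub>2, 1]"
      unfolding w_def vector_scalar_commute[symmetric] matrix_vector_right_distrib[symmetric]
      by (rule arg_cong[where f = "(*v) A"]) (simp add: e\<^sub>3_def vec3_eq_iff vector_3)
    hence "poly (line_poly F (A *v e\<^sub>3) w) \<tau> = u (\<tau> * w\<^sub>1, \<tau> * w\<^sub>2) * ade_equation T (\<phi> (\<tau> * w\<^sub>1, \<tau> * w\<^sub>2))"
      using eq[OF \<tau>] by (simp add: poly_line_poly)
    thus "u (\<tau> * w\<^sub>1, \<tau> * w\<^sub>2) * (ade_equation T (\<phi> (\<tau> * w\<^sub>1, \<tau> * w\<^sub>2)) / \<tau> ^ ade_mult T) =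
        poly (line_poly F (A *v e\<^sub>3) w) \<tau> / \<tau> ^ ade_mult T" by simp
  qed
  from Lim_transform_eventually[OF lim this]
  have "((\<lambda>\<tau>. poly (line_poly F (A *v e\<^sub>3) w) \<tau> / \<tau> ^ ade_mult T) \<longlongrightarrow> u 0 * L) (at 0)" .
  moreover have "u 0 * L \<noteq> 0" using L(1) eq[of 0 0] U(2) by (simp add: zero_prod_def)
  ultimately show ?thesis using that coeff_nonzero_if_limit by blast
qed

lemma norm_deriv_le_cauchy:
  fixes f :: "complex \<Rightarrow> complex"
  assumes "\<rho> > 0" "\<And>x. dist x z \<le> \<rho> \<Longrightarrow> f field_differentiable at x" "\<And>x. dist x z \<le> \<rho> \<Longrightarrow> norm (f x) \<le> M"
  shows "norm (deriv f z) \<le> M / \<rho>"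
proof -
  have "norm ((deriv ^^ 1) f z) \<le> fact 1 * M / \<rho> ^ 1"
  proof (rule Cauchy_inequality[OF _ _ assms(1)])
    show "f holomorphic_on ball z \<rho>"
      unfolding holomorphic_on_def
      using assms(2) by (auto simp: dist_commute intro: field_differentiable_at_within)
    show "continuous_on (cball z \<rho>) f"
      using assms(2) by (intro continuous_at_imp_continuous_on ballI field_differentiable_imp_continuous_at)
        (simp add: dist_commute)
    show "norm (f x) \<le> M" if "norm (z - x) = \<rho>" for x
      using assms(3)[of x] that by (simp add: dist_norm norm_minus_commute)
  qed
  thus ?thesis by simp
qed

lemma holomorphic2_on_0_linear_bound:
  assumes "holomorphic2_on f U" "0 \<in> U" "f 0 = 0"
  shows "\<exists>C>0. \<exists>\<delta>>0. \<forall>v. norm v < \<delta> \<longrightarrow> norm (f v) \<le> C * norm v"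
proof -
  obtain a b where "(f has_derivative (\<lambda>(h, k). a * h + b * k)) (at 0)"
    using assms(1,2) unfolding holomorphic2_on_def by blast
  from has_derivative_0_linear_bound[OF this assms(3)] show ?thesis by metis
qed

lemma ex_small_radius:
  fixes K :: "nat \<Rightarrow> real"
  assumes "\<And>i. i < N \<Longrightarrow> K i \<ge> 0 \<and> m i > 0"
  shows "\<exists>\<rho>>0. \<forall>i<N. K i * \<rho> < m i"
  using assms
proof (induction N)
  case 0
  show ?case by (intro exI[of _ 1]) simp
next
  case (Suc N)
  then obtain \<rho> where \<rho>: "\<rho> > 0" "\<And>i. i < N \<Longrightarrow> K i * \<rho> < m i" by (metis less_SucI)
  have KN: "K N \<ge> 0" "m N > 0" using Suc.prems by auto
  define \<rho>' where "\<rho>' = min \<rho> (m N / (K N + 1))"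
  have \<rho>': "\<rho>' > 0" "\<rho>' \<le> \<rho>" using \<rho>(1) KN by (auto simp: \<rho>'_def)
  have "K i * \<rho>' < m i" if i: "i < Suc N" for i
  proof (cases "i < N")
    case True
    have "K i * \<rho>' \<le> K i * \<rho>" using \<rho>'(2) Suc.prems i by (intro mult_left_mono) auto
    thus ?thesis using \<rho>(2)[OF True] by linarith
  next
    case False
    hence iN: "i = N" using i by simp
    have "K N * \<rho>' \<le> K N * (m N / (K N + 1))" using KN by (intro mult_left_mono) (auto simp: \<rho>'_def)
    also have "\<dots> < m N" using KN by (simp add: field_simps)
    finally show ?thesis by (simp add: iN)
  qed
  thus ?case using \<rho>'(1) by blast
qed

text \<open>Near the point, \<open>F\<close> on the pencil is a nonvanishing factor \<open>W\<close>
  times the normal form composed with \<open>\<Phi>\<close>, so bounds on the normal form and its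
  gradient transfer to \<open>F\<close>. The exceptional branch is y = 0 in the chart;
  \<open>tan\<close> makes it transversal to the pencil line, so that nearby lines meet it at most
  once.\<close>

lemma (in irreducible_form) ade_point_discriminant_bound:
  assumes e3: "eval3 F e\<^sub>3 \<noteq> 0" and chart: "ade_chart F p T A \<phi> \<psi> u U V"
    and pt: "A *v e\<^sub>3 = \<mu> *s vector [a\<^sub>0, 1, z\<^sub>0]" "\<mu> \<noteq> 0"
    and mult: "coeff (line_poly F (A *v e\<^sub>3) e\<^sub>3) (ade_mult T) \<noteq> 0"
    and \<psi>': "((fst \<circ> \<psi>) has_derivative (\<lambda>(h, k). a\<^sub>1 * h + b\<^sub>1 * k)) (at 0)"
      "((snd \<circ> \<psi>) has_derivative (\<lambda>(h, k). a\<^sub>2 * h + b\<^sub>2 * k)) (at 0)"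
    and tan: "(A *v vector [a\<^sub>1, a\<^sub>2, 0]) $ 1 \<noteq> a\<^sub>0 * (A *v vector [a\<^sub>1, a\<^sub>2, 0]) $ 2"
  shows "\<exists>C \<epsilon>. \<epsilon> > 0 \<and> (\<forall>a. 0 < dist a a\<^sub>0 \<longrightarrow> dist a a\<^sub>0 < \<epsilon> \<longrightarrow>
    norm (poly (pencil_discriminant n F) a) \<le> C * dist a a\<^sub>0 powr ade_order T)"
proof -
  have T: "ade_index_ok T" and inv: "invertible A" and U: "open U" "0 \<in> U" and V: "open V" "0 \<in> V"
    and hom: "homeomorphism U V \<phi> \<psi>" and \<phi>0: "\<phi> 0 = 0" and hu: "holomorphic2_on u U"
    and h\<phi>: "holomorphic2_on (fst \<circ> \<phi>) U" "holomorphic2_on (snd \<circ> \<phi>) U"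
    and h\<psi>: "holomorphic2_on (fst \<circ> \<psi>) V" "holomorphic2_on (snd \<circ> \<psi>) V"
    and eq: "\<And>s t. (s, t) \<in> U \<Longrightarrow> u (s, t) \<noteq> 0"
      "\<And>s t. (s, t) \<in> U \<Longrightarrow> eval3 F (A *v vector [s, t, 1]) = u (s, t) * ade_equation T (\<phi> (s, t))"
    using chart unfolding ade_chart_def by auto
  have \<psi>0: "\<psi> 0 = 0" using hom U(2) \<phi>0 by (metis homeomorphism_apply1)
  obtain B where AB: "A ** B = Finite_Cartesian_Product.mat 1" "B ** A = Finite_Cartesian_Product.mat 1"
    using inv unfolding invertible_def by blast
  have AB': "A *v (B *v v) = v" "B *v (A *v v) = v" for v
    using AB by (simp_all add: matrix_vector_mul_assoc)

  \<comment> \<open>The point (a, 1, z) in the coordinates of the chart; division by the third one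
    gives the affine point \<open>\<sigma>\<close>.\<close>
  define w where "w a z = B *v vector [a, 1, z]" for a z
  have w_comp: "w a z $ i = B $ i $ 1 * a + B $ i $ 2 + B $ i $ 3 * z" for a z i
    by (simp add: w_def matrix_vector_mult_def sum_3 vector_3)
  have w0: "w a\<^sub>0 z\<^sub>0 = (1 / \<mu>) *s e\<^sub>3"
  proof -
    have "vector [a\<^sub>0, 1, z\<^sub>0] = (1 / \<mu>) *s (A *v e\<^sub>3)" using pt by (simp add: vector_smult_assoc)
    thus ?thesis by (simp add: w_def vector_scalar_commute AB')
  qed
  define r where "r a z = dist a a\<^sub>0 + dist z z\<^sub>0" for a z :: complex
  have r0: "r a z \<ge> 0" for a z by (simp add: r_def)
  define b where "b = 1 + (\<Sum>i\<in>UNIV. norm (B $ i $ 1) + norm (B $ i $ 3))"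
  have "norm (B $ i $ 1) + norm (B $ i $ 3) \<le> (\<Sum>i\<in>UNIV. norm (B $ i $ 1) + norm (B $ i $ 3))" for i
    by (rule member_le_sum) auto
  hence b_ge: "norm (B $ i $ 1) \<le> b" "norm (B $ i $ 3) \<le> b" for i
    using norm_ge_zero[of "B $ i $ 1"] norm_ge_zero[of "B $ i $ 3"] unfolding b_def by (smt (verit))+
  have b: "b > 0" unfolding b_def by (intro add_pos_nonneg sum_nonneg) auto
  have w_lip: "norm (w a z $ i - w a\<^sub>0 z\<^sub>0 $ i) \<le> b * r a z" for a z i
  proof -
    have "w a z $ i - w a\<^sub>0 z\<^sub>0 $ i = B $ i $ 1 * (a - a\<^sub>0) + B $ i $ 3 * (z - z\<^sub>0)"
      by (simp add: w_comp algebra_simps)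
    also have "norm \<dots> \<le> norm (B $ i $ 1) * dist a a\<^sub>0 + norm (B $ i $ 3) * dist z z\<^sub>0"
      by (rule order.trans[OF norm_triangle_ineq]) (simp add: norm_mult dist_norm)
    also have "\<dots> \<le> b * dist a a\<^sub>0 + b * dist z z\<^sub>0"
      using b_ge by (intro add_mono mult_right_mono) auto
    finally show ?thesis by (simp add: r_def algebra_simps)
  qed
  define \<sigma> where "\<sigma> a z = (w a z $ 1 / w a z $ 3, w a z $ 2 / w a z $ 3)" for a z
  define \<Phi> where "\<Phi> a z = \<phi> (\<sigma> a z)" for a z

  have lin: "DERIV (\<lambda>X. X) 0 :> (1 :: complex)" "DERIV (\<lambda>X. 0) 0 :> (0 :: complex)"
    by (auto intro!: derivative_eq_intros)
  \<comment> \<open>Parametrises the branch y = 0 by its coordinate X; \<open>\<zeta>\<close> below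
    is the pencil parameter of the line through that point.\<close>
  define N where "N X = A *v vector [fst (\<psi> (X, 0)), snd (\<psi> (X, 0)), 1]" for X
  have N_comp: "N X $ i = A $ i $ 1 * fst (\<psi> (X, 0)) + A $ i $ 2 * snd (\<psi> (X, 0)) + A $ i $ 3" for X i
    by (simp add: N_def matrix_vector_mult_def sum_3 vector_3)
  have N0: "N 0 = \<mu> *s vector [a\<^sub>0, 1, z\<^sub>0]"
  proof -
    have "N 0 = A *v vector [fst (\<psi> 0), snd (\<psi> 0), 1]" by (simp add: N_def zero_prod_def)
    thus ?thesis using pt(1) by (simp add: \<psi>0 e\<^sub>3_def)
  qed
  have D1: "\<exists>d. DERIV (\<lambda>X. (fst \<circ> \<psi>) (X, 0)) X :> d" if "(X, 0) \<in> V" for X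
  proof -
    obtain a b where "((fst \<circ> \<psi>) has_derivative (\<lambda>(h, k). a * h + b * k)) (at (X, 0))"
      using h\<psi>(1) \<open>(X, 0) \<in> V\<close> unfolding holomorphic2_on_def by blast
    from DERIV_compose_holomorphic2[of "fst \<circ> \<psi>" a b "\<lambda>X. X" X "\<lambda>X. 0", OF this] show ?thesis
      using DERIV_ident DERIV_const by blast
  qed
  have D2: "\<exists>d. DERIV (\<lambda>X. (snd \<circ> \<psi>) (X, 0)) X :> d" if "(X, 0) \<in> V" for X
  proof -
    obtain a b where "((snd \<circ> \<psi>) has_derivative (\<lambda>(h, k). a * h + b * k)) (at (X, 0))"
      using h\<psi>(2) \<open>(X, 0) \<in> V\<close> unfolding holomorphic2_on_def by blast
    from DERIV_compose_holomorphic2[of "snd \<circ> \<psi>" a b "\<lambda>X. X" X "\<lambda>X. 0", OF this] show ?thesis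
      using DERIV_ident DERIV_const by blast
  qed
  have \<psi>1: "DERIV (\<lambda>X. (fst \<circ> \<psi>) (X, 0)) 0 :> a\<^sub>1 * 1 + b\<^sub>1 * 0"
    by (rule DERIV_compose_holomorphic2[of "fst \<circ> \<psi>" _ _ "\<lambda>X. X" 0 "\<lambda>X. 0", OF _ lin]) (use \<psi>'(1) in \<open>simp add: zero_prod_def\<close>)
  have \<psi>2: "DERIV (\<lambda>X. (snd \<circ> \<psi>) (X, 0)) 0 :> a\<^sub>2 * 1 + b\<^sub>2 * 0"
    by (rule DERIV_compose_holomorphic2[of "snd \<circ> \<psi>" _ _ "\<lambda>X. X" 0 "\<lambda>X. 0", OF _ lin]) (use \<psi>'(2) in \<open>simp add: zero_prod_def\<close>)
  define \<zeta> where "\<zeta> X = N X $ 1 / N X $ 2" for X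
  obtain r\<^sub>1 where r\<^sub>1: "r\<^sub>1 > 0" "inj_on \<zeta> (ball 0 r\<^sub>1)" "\<And>X. X \<in> ball 0 r\<^sub>1 \<Longrightarrow> (X, 0) \<in> V"
  proof -
    have "open {X. (X, 0) \<in> V}"
      using open_vimage[OF V(1), of "\<lambda>X. (X, 0)"] by (simp add: vimage_def continuous_intros)
    moreover have "0 \<in> {X. (X, 0) \<in> V}" using V(2) by (simp add: zero_prod_def)
    ultimately obtain r\<^sub>2 where r\<^sub>2: "r\<^sub>2 > 0" "ball 0 r\<^sub>2 \<subseteq> {X. (X, 0) \<in> V}"
      using open_contains_ball by blast
    have N_cont: "continuous_on (ball 0 r\<^sub>2) (\<lambda>X. N X $ 2)"
    proof (intro continuous_at_imp_continuous_on ballI)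
      fix X :: complex assume "X \<in> ball 0 r\<^sub>2"
      hence "(X, 0) \<in> V" using r\<^sub>2(2) by blast
      hence "isCont (\<lambda>X. fst (\<psi> (X, 0))) X" "isCont (\<lambda>X. snd (\<psi> (X, 0))) X"
        using D1 D2 DERIV_isCont by fastforce+
      thus "isCont (\<lambda>X. N X $ 2) X" unfolding N_comp by (intro continuous_add continuous_mult continuous_const)
    qed
    define S where "S = {X \<in> ball 0 r\<^sub>2. N X $ 2 \<noteq> 0}"
    have "S = ball 0 r\<^sub>2 \<inter> (\<lambda>X. N X $ 2) -` (- {0})" unfolding S_def by blast
    moreover have "open (ball 0 r\<^sub>2 \<inter> (\<lambda>X. N X $ 2) -` (- {0}))"
      by (rule continuous_open_preimage[OF N_cont]) auto
    ultimately have S: "open S" by simp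
    have S0: "0 \<in> S" using r\<^sub>2(1) N0 pt(2) by (simp add: S_def vector_3)
    have SV: "(X, 0) \<in> V" if "X \<in> S" for X using that r\<^sub>2(2) by (auto simp: S_def)
    have hol: "\<zeta> holomorphic_on S"
      unfolding holomorphic_on_open[OF S]
    proof
      fix X :: complex assume X: "X \<in> S"
      obtain d1 d2 where d: "DERIV (\<lambda>X. (fst \<circ> \<psi>) (X, 0)) X :> d1" "DERIV (\<lambda>X. (snd \<circ> \<psi>) (X, 0)) X :> d2"
        using D1[OF SV[OF X]] D2[OF SV[OF X]] by blast
      have "N X $ 2 \<noteq> 0" using X by (simp add: S_def)
      have DN: "DERIV (\<lambda>X. N X $ i) X :> A $ i $ 1 * d1 + A $ i $ 2 * d2" for i
        unfolding N_comp
        by (rule DERIV_cong[OF DERIV_add[OF DERIV_add[OF DERIV_cmult[OF d(1)[unfolded comp_apply]]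
          DERIV_cmult[OF d(2)[unfolded comp_apply]]] DERIV_const]]) simp
      show "\<exists>f'. DERIV \<zeta> X :> f'"
        using DERIV_divide[OF DN[of 1] DN[of 2] \<open>N X $ 2 \<noteq> 0\<close>] unfolding \<zeta>_def[abs_def] by blast
    qed
    have DN: "DERIV (\<lambda>X. N X $ i) 0 :> A $ i $ 1 * a\<^sub>1 + A $ i $ 2 * a\<^sub>2" for i
      unfolding N_comp
      by (rule DERIV_cong[OF DERIV_add[OF DERIV_add[OF DERIV_cmult[OF \<psi>1[unfolded comp_apply]]
        DERIV_cmult[OF \<psi>2[unfolded comp_apply]]] DERIV_const]]) simp
    have n2': "N 0 $ 2 = \<mu>" "N 0 $ 1 = \<mu> * a\<^sub>0" by (simp_all add: N0 vector_3)
    have A_comp: "(A *v vector [a\<^sub>1, a\<^sub>2, 0]) $ i = A $ i $ 1 * a\<^sub>1 + A $ i $ 2 * a\<^sub>2" for i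
      by (simp add: matrix_vector_mult_def sum_3 vector_3)
    have "N 0 $ 2 \<noteq> 0" using n2' pt(2) by simp
    from DERIV_divide[OF DN[of 1] DN[of 2] this]
    have "deriv \<zeta> 0 = ((A *v vector [a\<^sub>1, a\<^sub>2, 0]) $ 1 * \<mu> - \<mu> * a\<^sub>0 * (A *v vector [a\<^sub>1, a\<^sub>2, 0]) $ 2) / (\<mu> * \<mu>)"
      unfolding \<zeta>_def[abs_def] A_comp n2' by (rule DERIV_imp_deriv)
    moreover have "x * \<mu> - \<mu> * a\<^sub>0 * y = \<mu> * (x - a\<^sub>0 * y)" for x y by (simp add: algebra_simps)
    \<comment> \<open>Up to a nonzero factor this derivative is the difference excluded by
      \<open>tan\<close>.\<close>
    ultimately have "deriv \<zeta> 0 \<noteq> 0" using tan pt(2) by simp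
    from has_complex_derivative_locally_injective[OF hol S0 S this]
    obtain r where "r > 0" "ball 0 r \<subseteq> S" "inj_on \<zeta> (ball 0 r)" by blast
    thus ?thesis using that[of r] SV by blast
  qed

  obtain C\<^sub>1 \<delta>\<^sub>1 where 1: "C\<^sub>1 > 0" "\<delta>\<^sub>1 > 0" "\<And>v. norm v < \<delta>\<^sub>1 \<Longrightarrow> norm ((fst \<circ> \<phi>) v) \<le> C\<^sub>1 * norm v"
    using holomorphic2_on_0_linear_bound[OF h\<phi>(1) U(2)] \<phi>0 by auto
  obtain C\<^sub>2 \<delta>\<^sub>2 where 2: "C\<^sub>2 > 0" "\<delta>\<^sub>2 > 0" "\<And>v. norm v < \<delta>\<^sub>2 \<Longrightarrow> norm ((snd \<circ> \<phi>) v) \<le> C\<^sub>2 * norm v"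
    using holomorphic2_on_0_linear_bound[OF h\<phi>(2) U(2)] \<phi>0 by auto
  obtain \<delta>\<^sub>3 where 3: "\<delta>\<^sub>3 > 0" "\<And>v. norm v < \<delta>\<^sub>3 \<Longrightarrow> norm (u v) < norm (u 0) + 1"
  proof -
    have "isCont u 0" using hu U(2) has_derivative_continuous unfolding holomorphic2_on_def by blast
    hence "isCont (\<lambda>v. norm (u v)) 0" by (intro continuous_intros)
    hence "\<forall>\<^sub>F v in at 0. norm (u v) < norm (u 0) + 1" unfolding isCont_def by (rule order_tendstoD(2)) simp
    then obtain d where "d > 0" "\<And>v. v \<noteq> 0 \<Longrightarrow> dist v 0 < d \<Longrightarrow> norm (u v) < norm (u 0) + 1"
      unfolding eventually_at by blast
    thus ?thesis by (intro that[of d]) (metis dist_0_norm dist_commute less_add_one)+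
  qed
  obtain \<delta>\<^sub>4 where 4: "\<delta>\<^sub>4 > 0" "ball 0 \<delta>\<^sub>4 \<subseteq> U" using U open_contains_ball by blast
  define \<delta> where "\<delta> = min (min \<delta>\<^sub>1 \<delta>\<^sub>2) (min \<delta>\<^sub>3 \<delta>\<^sub>4)"
  have \<delta>: "\<delta> > 0" using 1 2 3 4 by (simp add: \<delta>_def)
  define Cu where "Cu = norm (u 0) + 1"
  have Cu: "Cu > 0" unfolding Cu_def by (simp add: add_nonneg_pos)
  have near0: "v \<in> U" "norm (fst (\<phi> v)) \<le> C\<^sub>1 * norm v" "norm (snd (\<phi> v)) \<le> C\<^sub>2 * norm v" "norm (u v) \<le> Cu"
    if "norm v < \<delta>" for v
    using that 1(3)[of v] 2(3)[of v] 3(2)[of v] 4(2) by (auto simp: \<delta>_def Cu_def less_imp_le)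
  define m where "m = norm \<mu>"
  have m: "m > 0" using pt(2) by (simp add: m_def)
  define Cs where "Cs = 4 * b * m"
  have Cs: "Cs > 0" using b m by (simp add: Cs_def)
  define C\<Phi> where "C\<Phi> = (C\<^sub>1 + C\<^sub>2) * Cs"
  have C\<Phi>: "C\<Phi> > 0" using 1 2 Cs by (simp add: C\<Phi>_def add_pos_pos)
  \<comment> \<open>The three bounds keep the third chart coordinate near \<open>1 / \<mu>\<close>,
    the affine point inside the common domain of the chart estimates, and its image where the normal
    form is controlled and \<open>\<zeta>\<close> is injective.\<close>
  obtain \<rho>\<^sub>1 where \<rho>\<^sub>1: "\<rho>\<^sub>1 > 0" "b * \<rho>\<^sub>1 < 1 / (2 * m)" "Cs * \<rho>\<^sub>1 < \<delta>" "C\<Phi> * \<rho>\<^sub>1 < min 1 r\<^sub>1"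
  proof -
    have "\<exists>\<rho>>0. \<forall>i<3. [b, Cs, C\<Phi>] ! i * \<rho> < [1 / (2 * m), \<delta>, min 1 r\<^sub>1] ! i"
      by (rule ex_small_radius) (use b Cs C\<Phi> m \<delta> r\<^sub>1 in \<open>auto simp: less_Suc_eq numeral_3_eq_3\<close>)
    thus ?thesis using that by (auto simp: less_Suc_eq numeral_3_eq_3)
  qed
  have small: "K * r a z < c" if "K * \<rho>\<^sub>1 < c" "r a z < \<rho>\<^sub>1" "K > 0" for K c a z
    using mult_strict_left_mono[OF that(2,3)] that(1) by linarith
  have w3: "norm (w a z $ 3) \<ge> 1 / (2 * m)" "norm (w a z $ 3) \<le> 2 / m" "w a z $ 3 \<noteq> 0" if "r a z < \<rho>\<^sub>1" for a z
  proof -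
    have "norm (w a z $ 3 - 1 / \<mu>) < 1 / (2 * m)"
      using w_lip[of a z 3] small[OF \<rho>\<^sub>1(2) that b] by (simp add: w0 e\<^sub>3_def vector_3)
    moreover have "norm (1 / \<mu>) = 1 / m" by (simp add: m_def norm_divide)
    moreover have "1 / m = 2 * (1 / (2 * m))" "2 / m = 4 * (1 / (2 * m))" "1 / (2 * m) > 0" using m by (simp_all add: field_simps)
    moreover have "norm (1 / \<mu>) \<le> norm (w a z $ 3) + norm (w a z $ 3 - 1 / \<mu>)"
      using norm_triangle_ineq4[of "w a z $ 3" "w a z $ 3 - 1 / \<mu>"] by simp
    moreover have "norm (w a z $ 3) \<le> norm (1 / \<mu>) + norm (w a z $ 3 - 1 / \<mu>)"
      using norm_triangle_ineq[of "1 / \<mu>" "w a z $ 3 - 1 / \<mu>"] by simp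
    ultimately show "norm (w a z $ 3) \<ge> 1 / (2 * m)" "norm (w a z $ 3) \<le> 2 / m" by linarith+
    with \<open>1 / (2 * m) > 0\<close> show "w a z $ 3 \<noteq> 0" by auto
  qed
  have \<sigma>_le: "norm (\<sigma> a z) \<le> Cs * r a z" "norm (\<sigma> a z) < \<delta>" if near: "r a z < \<rho>\<^sub>1" for a z
  proof -
    have *: "norm (w a z $ i / w a z $ 3) \<le> 2 * b * m * r a z" if "i = 1 \<or> i = 2" for i
    proof -
      have "w a\<^sub>0 z\<^sub>0 $ i = 0" using that by (auto simp: w0 e\<^sub>3_def vector_3)
      hence "norm (w a z $ i) \<le> b * r a z" using w_lip[of a z i] by simp
      hence "norm (w a z $ i / w a z $ 3) \<le> (b * r a z) / (1 / (2 * m))"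
        unfolding norm_divide using w3(1)[OF near] m b r0[of a z] by (intro frac_le) auto
      thus ?thesis by (simp add: mult_ac)
    qed
    have "norm (\<sigma> a z) \<le> norm (w a z $ 1 / w a z $ 3) + norm (w a z $ 2 / w a z $ 3)"
      unfolding \<sigma>_def by (rule norm_Pair_le)
    also have "\<dots> \<le> Cs * r a z" using *[of 1] *[of 2] by (simp add: Cs_def)
    finally show "norm (\<sigma> a z) \<le> Cs * r a z" .
    thus "norm (\<sigma> a z) < \<delta>" using small[OF \<rho>\<^sub>1(3) near Cs] by linarith
  qed
  have \<Phi>_le: "norm (fst (\<Phi> a z)) + norm (snd (\<Phi> a z)) \<le> C\<Phi> * r a z"
      "norm (fst (\<Phi> a z)) + norm (snd (\<Phi> a z)) < min 1 r\<^sub>1" if near: "r a z < \<rho>\<^sub>1" for a z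
  proof -
    have "norm (fst (\<Phi> a z)) + norm (snd (\<Phi> a z)) \<le> (C\<^sub>1 + C\<^sub>2) * norm (\<sigma> a z)"
      using near0(2,3)[OF \<sigma>_le(2)[OF near]] by (simp add: \<Phi>_def algebra_simps)
    also have "\<dots> \<le> (C\<^sub>1 + C\<^sub>2) * (Cs * r a z)"
      using \<sigma>_le(1)[OF near] 1(1) 2(1) by (intro mult_left_mono) auto
    finally show "norm (fst (\<Phi> a z)) + norm (snd (\<Phi> a z)) \<le> C\<Phi> * r a z" by (simp add: C\<Phi>_def mult_ac)
    thus "norm (fst (\<Phi> a z)) + norm (snd (\<Phi> a z)) < min 1 r\<^sub>1" using small[OF \<rho>\<^sub>1(4) near C\<Phi>] by linarith
  qed
  have \<sigma>_U: "\<sigma> a z \<in> U" if "r a z < \<rho>\<^sub>1" for a z using near0(1)[OF \<sigma>_le(2)[OF that]] .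
  have pt_eq: "vector [a, 1, z] = w a z $ 3 *s (A *v vector [fst (\<sigma> a z), snd (\<sigma> a z), 1])" if "r a z < \<rho>\<^sub>1" for a z
  proof -
    have "w a z = w a z $ 3 *s vector [fst (\<sigma> a z), snd (\<sigma> a z), 1]"
      using w3(3)[OF that] by (simp add: vec3_eq_iff vector_3 \<sigma>_def)
    hence "A *v w a z = w a z $ 3 *s (A *v vector [fst (\<sigma> a z), snd (\<sigma> a z), 1])"
      by (metis vector_scalar_commute)
    thus ?thesis by (simp add: w_def AB')
  qed
  define W where "W a z = w a z $ 3 ^ n * u (\<sigma> a z)" for a z
  have F_eq: "eval3 F (vector [a, 1, z]) = W a z * ade_equation T (\<Phi> a z)" "W a z \<noteq> 0" if "r a z < \<rho>\<^sub>1" for a z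
    using eq[of "fst (\<sigma> a z)" "snd (\<sigma> a z)"] \<sigma>_U[OF that] w3(3)[OF that]
    by (simp_all add: pt_eq[OF that] form_eval3[OF form] W_def \<Phi>_def)
  define CW where "CW = (2 / m) ^ n * Cu"
  have CW: "CW > 0" using m Cu by (simp add: CW_def)
  have W_le: "norm (W a z) \<le> CW" if "r a z < \<rho>\<^sub>1" for a z
    unfolding W_def CW_def norm_mult norm_power
    using w3(2)[OF that] near0(4)[OF \<sigma>_le(2)[OF that]] m by (intro mult_mono power_mono) auto
  have D\<sigma>: "\<exists>d1 d2. DERIV (\<lambda>z. fst (\<sigma> a z)) z :> d1 \<and> DERIV (\<lambda>z. snd (\<sigma> a z)) z :> d2"
    if "r a z < \<rho>\<^sub>1" for a z
  proof -
    have Dw: "DERIV (\<lambda>z. w a z $ i) z :> B $ i $ 3" for i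
      unfolding w_comp by (auto intro!: derivative_eq_intros)
    show ?thesis
      unfolding \<sigma>_def fst_conv snd_conv using DERIV_divide[OF Dw Dw w3(3)[OF that]] by blast
  qed
  have D_comp: "\<exists>d. DERIV (\<lambda>z. f (\<sigma> a z)) z :> d" if f: "holomorphic2_on f U" and near: "r a z < \<rho>\<^sub>1" for f a z
  proof -
    obtain c d where "(f has_derivative (\<lambda>(h, k). c * h + d * k)) (at (fst (\<sigma> a z), snd (\<sigma> a z)))"
      using f \<sigma>_U[OF near] unfolding holomorphic2_on_def by (metis prod.collapse)
    moreover obtain d1 d2 where "DERIV (\<lambda>z. fst (\<sigma> a z)) z :> d1" "DERIV (\<lambda>z. snd (\<sigma> a z)) z :> d2"
      using D\<sigma>[OF near] by blast
    ultimately have "DERIV (\<lambda>z. f (fst (\<sigma> a z), snd (\<sigma> a z))) z :> c * d1 + d * d2"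
      by (rule DERIV_compose_holomorphic2)
    thus ?thesis by auto
  qed
  have D\<Phi>1: "\<exists>d. DERIV (\<lambda>z. fst (\<Phi> a z)) z :> d" if "r a z < \<rho>\<^sub>1" for a z
    using D_comp[OF h\<phi>(1) that] by (simp add: \<Phi>_def)
  have D\<Phi>2: "\<exists>d. DERIV (\<lambda>z. snd (\<Phi> a z)) z :> d" if "r a z < \<rho>\<^sub>1" for a z
    using D_comp[OF h\<phi>(2) that] by (simp add: \<Phi>_def)
  have DW: "\<exists>d. DERIV (\<lambda>z. W a z) z :> d" if near: "r a z < \<rho>\<^sub>1" for a z
  proof -
    have Dw: "DERIV (\<lambda>z. w a z $ 3) z :> B $ 3 $ 3"
      unfolding w_comp by (auto intro!: derivative_eq_intros)
    obtain d where "DERIV (\<lambda>z. u (\<sigma> a z)) z :> d" using D_comp[OF hu near] by blast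
    from DERIV_mult[OF DERIV_power[OF Dw] this] show ?thesis unfolding W_def by blast
  qed

  \<comment> \<open>A quarter leaves room for the two distances and for one more disc of radius
    \<open>\<rho>\<close>, on which Cauchy's estimate bounds the derivatives of
    \<open>\<Phi>\<close>.\<close>
  define \<rho> where "\<rho> = \<rho>\<^sub>1 / 4"
  have \<rho>: "\<rho> > 0" using \<rho>\<^sub>1(1) by (simp add: \<rho>_def)
  have near: "r a z < \<rho>\<^sub>1" if "dist a a\<^sub>0 < \<rho>" "dist z z\<^sub>0 < \<rho>" for a z
    using that \<rho> by (simp add: r_def \<rho>_def)
  have near': "r a x < \<rho>\<^sub>1" if "dist a a\<^sub>0 < \<rho>" "dist z z\<^sub>0 < \<rho>" "dist x z \<le> \<rho>" for a z x
    using that dist_triangle[of x z\<^sub>0 z] \<rho> by (simp add: r_def \<rho>_def)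
  have D_bound: "norm (deriv f z) \<le> 1 / \<rho>"
    if "f = (\<lambda>z. fst (\<Phi> a z)) \<or> f = (\<lambda>z. snd (\<Phi> a z))" "dist a a\<^sub>0 < \<rho>" "dist z z\<^sub>0 < \<rho>" for f a z
  proof (rule norm_deriv_le_cauchy[OF \<rho>])
    fix x assume "dist x z \<le> \<rho>"
    hence x: "r a x < \<rho>\<^sub>1" using near' that(2,3) by blast
    show "f field_differentiable at x"
      using that(1) D\<Phi>1[OF x] D\<Phi>2[OF x] unfolding field_differentiable_def by blast
    have "norm (fst (\<Phi> a x)) + norm (snd (\<Phi> a x)) < 1" using \<Phi>_le(2)[OF x] by simp
    hence "norm (fst (\<Phi> a x)) \<le> 1" "norm (snd (\<Phi> a x)) \<le> 1"
      using norm_ge_zero[of "fst (\<Phi> a x)"] norm_ge_zero[of "snd (\<Phi> a x)"] by linarith+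
    thus "norm (f x) \<le> 1" using that(1) by auto
  qed

  obtain Cg where Cg: "Cg \<ge> 0" "\<And>x y. norm x + norm y \<le> 1 \<Longrightarrow> ade_equation T (x, y) = 0 \<Longrightarrow>
    norm (ade_dx T (x, y)) + norm (ade_dy T (x, y)) \<le>
      Cg * (norm x + norm y) powr (if y = 0 then ade_exp_axis T else ade_exp T)"
    using norm_ade_gradient_le[OF T] by blast
  define e where "e = ade_exp T"
  define e' where "e' = ade_exp_axis T"
  have ee: "0 \<le> e'" "e' \<le> e" using ade_exponents[OF T] by (simp_all add: e_def e'_def)
  define R where "R = ade_mult T"
  define Ca where "Ca = CW * (2 * C\<Phi> ^ R)"
  define Cb where "Cb = CW * (Cg / \<rho>) * (C\<Phi> powr e + C\<Phi> powr e')"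
  have Ca: "Ca \<ge> 0" using CW C\<Phi> by (simp add: Ca_def)
  have Cb: "Cb \<ge> 0" using CW Cg(1) \<rho> by (simp add: Cb_def)
  have "\<exists>C \<epsilon>. \<epsilon> > 0 \<and> (\<forall>a. 0 < dist a a\<^sub>0 \<longrightarrow> dist a a\<^sub>0 < \<epsilon> \<longrightarrow>
    norm (poly (pencil_discriminant n F) a) \<le> C * dist a a\<^sub>0 powr ((real R - 1) * e + e'))"
  proof (rule pencil_discriminant_local_bound[where E = "\<lambda>a z. snd (\<Phi> a z) = 0" and \<rho> = \<rho> and C = "Ca + Cb" and z\<^sub>0 = z\<^sub>0])
    show "eval3 F e\<^sub>3 \<noteq> 0" "\<rho> > 0" "0 \<le> e'" "e' \<le> e" by fact+
    show "1 \<le> R" using ade_exponents(1)[OF T] by (simp add: R_def)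
    show "0 \<le> Ca + Cb" using Ca Cb by simp
  next
    fix a z assume "dist a a\<^sub>0 < \<rho>" "dist z z\<^sub>0 < \<rho>"
    hence az: "r a z < \<rho>\<^sub>1" by (rule near)
    have "norm (ade_equation T (\<Phi> a z)) \<le> 2 * (norm (fst (\<Phi> a z)) + norm (snd (\<Phi> a z))) ^ R"
      using norm_ade_equation_le[OF T, of "fst (\<Phi> a z)" "snd (\<Phi> a z)"] \<Phi>_le(2)[OF az] by (simp add: R_def)
    also have "\<dots> \<le> 2 * (C\<Phi> * r a z) ^ R"
      using \<Phi>_le(1)[OF az] by (intro mult_left_mono power_mono) auto
    finally have "norm (W a z) * norm (ade_equation T (\<Phi> a z)) \<le> CW * (2 * (C\<Phi> * r a z) ^ R)"
      using W_le[OF az] CW by (intro mult_mono) auto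
    also have "\<dots> = Ca * r a z ^ R" by (simp add: Ca_def power_mult_distrib)
    also have "\<dots> \<le> (Ca + Cb) * r a z ^ R" using Cb r0 by (intro mult_right_mono) auto
    finally show "norm (eval3 F (vector [a, 1, z])) \<le> (Ca + Cb) * (dist a a\<^sub>0 + dist z z\<^sub>0) ^ R"
      by (simp add: F_eq(1)[OF az] norm_mult r_def)
  next
    fix a z assume d: "dist a a\<^sub>0 < \<rho>" "dist z z\<^sub>0 < \<rho>" and root: "eval3 F (vector [a, 1, z]) = 0"
    have az: "r a z < \<rho>\<^sub>1" using d by (rule near)
    have g0: "ade_equation T (\<Phi> a z) = 0" using root F_eq[OF az] by simp
    obtain W' where W': "DERIV (\<lambda>z. W a z) z :> W'" using DW[OF az] by blast
    define p1 where "p1 = deriv (\<lambda>z. fst (\<Phi> a z)) z"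
    define p2 where "p2 = deriv (\<lambda>z. snd (\<Phi> a z)) z"
    have p: "DERIV (\<lambda>z. fst (\<Phi> a z)) z :> p1" "DERIV (\<lambda>z. snd (\<Phi> a z)) z :> p2"
      using D\<Phi>1[OF az] D\<Phi>2[OF az] DERIV_imp_deriv unfolding p1_def p2_def by blast+
    have pn: "norm p1 \<le> 1 / \<rho>" "norm p2 \<le> 1 / \<rho>" unfolding p1_def p2_def using D_bound d by blast+
    define dx where "dx = ade_dx T (\<Phi> a z)"
    define dy where "dy = ade_dy T (\<Phi> a z)"
    have "DERIV (\<lambda>z. ade_equation T (fst (\<Phi> a z), snd (\<Phi> a z))) z :> dx * p1 + dy * p2"
      using DERIV_ade_equation[OF T p] by (simp add: dx_def dy_def)
    \<comment> \<open>The term with the derivative of \<open>W\<close> drops out since the normal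
      form vanishes at a root.\<close>
    from DERIV_mult[OF W' this]
    have Wg: "DERIV (\<lambda>z. W a z * ade_equation T (\<Phi> a z)) z :> W a z * (dx * p1 + dy * p2)"
      using g0 by (simp add: mult.commute)
    have "DERIV (\<lambda>z. poly (pencil_poly F a) z) z :> gradient F (vector [a, 1, z]) $ 3"
      using poly_DERIV[of "pencil_poly F a" z] by (simp add: poly_pderiv_pencil_poly)
    moreover have "\<forall>\<^sub>F x in nhds z. poly (pencil_poly F a) x = W a x * ade_equation T (\<Phi> a x)"
      unfolding eventually_nhds_metric
      by (intro exI[of _ \<rho>] conjI \<rho> allI impI) (simp add: poly_pencil_poly F_eq(1)[OF near'[OF d]])
    note DERIV_cong_ev[OF refl this refl]
    ultimately have "DERIV (\<lambda>z. W a z * ade_equation T (\<Phi> a z)) z :> gradient F (vector [a, 1, z]) $ 3" by blast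
    hence "gradient F (vector [a, 1, z]) $ 3 = W a z * (dx * p1 + dy * p2)" using Wg by (rule DERIV_unique)
    moreover have "norm (dx * p1 + dy * p2) \<le> (norm dx + norm dy) * (1 / \<rho>)"
    proof -
      have "norm (dx * p1 + dy * p2) \<le> norm dx * norm p1 + norm dy * norm p2"
        by (rule order.trans[OF norm_triangle_ineq]) (simp add: norm_mult)
      also have "\<dots> \<le> norm dx * (1 / \<rho>) + norm dy * (1 / \<rho>)"
        using pn by (intro add_mono mult_left_mono) auto
      finally show ?thesis by (simp only: distrib_right)
    qed
    moreover have "norm (W a z * y) \<le> CW * Y" if "norm y \<le> Y" for y Y
      unfolding norm_mult using W_le[OF az] CW that by (intro mult_mono) auto
    ultimately have grad: "norm (gradient F (vector [a, 1, z]) $ 3) \<le> CW * ((norm dx + norm dy) * (1 / \<rho>))"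
      by metis
    define x where "x = (if snd (\<Phi> a z) = 0 then e' else e)"
    have x: "x \<ge> 0" using ee by (simp add: x_def)
    have "norm dx + norm dy \<le> Cg * (norm (fst (\<Phi> a z)) + norm (snd (\<Phi> a z))) powr x"
    proof -
      have "norm (fst (\<Phi> a z)) + norm (snd (\<Phi> a z)) \<le> 1" using \<Phi>_le(2)[OF az] by simp
      from Cg(2)[OF this, unfolded prod.collapse, OF g0] show ?thesis
        unfolding dx_def dy_def x_def e_def e'_def .
    qed
    also have "\<dots> \<le> Cg * (C\<Phi> * r a z) powr x"
      using \<Phi>_le(1)[OF az] Cg(1) x by (intro mult_left_mono powr_mono2) auto
    also have "\<dots> = Cg * (C\<Phi> powr x * r a z powr x)" using C\<Phi> r0 by (simp add: powr_mult)
    also have "\<dots> \<le> Cg * ((C\<Phi> powr e + C\<Phi> powr e') * r a z powr x)"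
      using Cg(1) by (intro mult_left_mono mult_right_mono) (auto simp: x_def)
    finally have g: "norm dx + norm dy \<le> Cg * ((C\<Phi> powr e + C\<Phi> powr e') * r a z powr x)" .
    have "norm (gradient F (vector [a, 1, z]) $ 3) \<le> CW * ((norm dx + norm dy) * (1 / \<rho>))" by (rule grad)
    also have "\<dots> \<le> CW * ((Cg * ((C\<Phi> powr e + C\<Phi> powr e') * r a z powr x)) * (1 / \<rho>))"
      using g CW \<rho> by (intro mult_left_mono mult_right_mono) auto
    also have "\<dots> = Cb * r a z powr x" by (simp add: Cb_def)
    also have "\<dots> \<le> (Ca + Cb) * r a z powr x" using Ca by (intro mult_right_mono) auto
    finally show "norm (gradient F (vector [a, 1, z]) $ 3) \<le>
        (Ca + Cb) * (dist a a\<^sub>0 + dist z z\<^sub>0) powr (if snd (\<Phi> a z) = 0 then e' else e)"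
      by (simp only: x_def r_def)
  next
    fix a z z' assume d: "dist a a\<^sub>0 < \<rho>" "dist z z\<^sub>0 < \<rho>" "dist z' z\<^sub>0 < \<rho>"
      and "snd (\<Phi> a z) = 0" "snd (\<Phi> a z') = 0"
    \<comment> \<open>Both roots lie on the branch y = 0 and on the line with parameter
      \<open>a\<close>, so injectivity of \<open>\<zeta>\<close> identifies their points.\<close>
    have *: "\<zeta> (fst (\<Phi> a z)) = a \<and> fst (\<Phi> a z) \<in> ball 0 r\<^sub>1 \<and> \<psi> (fst (\<Phi> a z), 0) = \<sigma> a z"
      if az: "r a z < \<rho>\<^sub>1" and y: "snd (\<Phi> a z) = 0" for z
    proof -
      have \<Phi>: "(fst (\<Phi> a z), 0) = \<phi> (\<sigma> a z)" using y by (simp add: \<Phi>_def prod_eq_iff)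
      have \<psi>\<phi>: "\<psi> (\<phi> (\<sigma> a z)) = \<sigma> a z" using hom \<sigma>_U[OF az] by (rule homeomorphism_apply1)
      have "vector [a, 1, z] = w a z $ 3 *s N (fst (\<Phi> a z))"
        unfolding N_def \<Phi> \<psi>\<phi> by (rule pt_eq[OF az])
      hence "w a z $ 3 * N (fst (\<Phi> a z)) $ 1 = a" "w a z $ 3 * N (fst (\<Phi> a z)) $ 2 = 1"
        by (simp_all add: vec3_eq_iff vector_3)
      hence "\<zeta> (fst (\<Phi> a z)) = a" unfolding \<zeta>_def
        by (metis mult_divide_mult_cancel_left div_by_1 mult_zero_left zero_neq_one)
      moreover have "fst (\<Phi> a z) \<in> ball 0 r\<^sub>1" using \<Phi>_le(2)[OF az] y by simp
      ultimately show ?thesis using \<Phi> \<psi>\<phi> by simp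
    qed
    have az: "r a z < \<rho>\<^sub>1" "r a z' < \<rho>\<^sub>1" using near d by blast+
    have "fst (\<Phi> a z) = fst (\<Phi> a z')"
      using *[OF az(1)] *[OF az(2)] \<open>snd (\<Phi> a z) = 0\<close> \<open>snd (\<Phi> a z') = 0\<close> inj_onD[OF r\<^sub>1(2)] by metis
    hence "\<sigma> a z = \<sigma> a z'"
      using *[OF az(1)] *[OF az(2)] \<open>snd (\<Phi> a z) = 0\<close> \<open>snd (\<Phi> a z') = 0\<close> by metis
    define v where "v = A *v vector [fst (\<sigma> a z), snd (\<sigma> a z), 1]"
    have "vector [a, 1, z] = w a z $ 3 *s v" "vector [a, 1, z'] = w a z' $ 3 *s v"
      using pt_eq[OF az(1)] pt_eq[OF az(2)] \<open>\<sigma> a z = \<sigma> a z'\<close> by (simp_all add: v_def)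
    hence "w a z $ 3 * v $ 2 = 1" "w a z' $ 3 * v $ 2 = 1" "z = w a z $ 3 * v $ 3" "z' = w a z' $ 3 * v $ 3"
      by (simp_all add: vec3_eq_iff vector_3)
    thus "z = z'" by (metis mult_right_cancel mult_zero_right zero_neq_one)
  next
    \<comment> \<open>The base points differ by the factor \<open>\<mu>\<close>, so the two
      restrictions are related by a scaling of the parameter.\<close>
    have "poly (line_poly F (A *v e\<^sub>3) e\<^sub>3) t =
        poly (Polynomial.smult (\<mu> ^ n) (pcompose (line_poly F (vector [a\<^sub>0, 1, z\<^sub>0]) e\<^sub>3) [:0, 1 / \<mu>:])) t" for t
    proof -
      have "A *v e\<^sub>3 + t *s e\<^sub>3 = \<mu> *s (vector [a\<^sub>0, 1, z\<^sub>0] + (t / \<mu>) *s e\<^sub>3)"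
        using pt by (simp add: vec3_eq_iff)
      hence "eval3 F (A *v e\<^sub>3 + t *s e\<^sub>3) = \<mu> ^ n * eval3 F (vector [a\<^sub>0, 1, z\<^sub>0] + (t / \<mu>) *s e\<^sub>3)"
        by (simp only: form_eval3[OF form])
      thus ?thesis by (simp add: poly_line_poly poly_pcompose)
    qed
    hence "line_poly F (A *v e\<^sub>3) e\<^sub>3 =
        Polynomial.smult (\<mu> ^ n) (pcompose (line_poly F (vector [a\<^sub>0, 1, z\<^sub>0]) e\<^sub>3) [:0, 1 / \<mu>:])"
      by (simp only: poly_eq_poly_eq_iff[symmetric] ext)
    thus "coeff (line_poly F (vector [a\<^sub>0, 1, z\<^sub>0]) e\<^sub>3) R \<noteq> 0"
      using mult by (auto simp: coeff_pcompose_linear R_def)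
  qed
  thus ?thesis by (simp only: ade_order_def R_def e_def e'_def)
qed

subsection \<open>Frames\<close>

text \<open>The complex bilinear cross product, giving the coordinates of the line joining two
  points.\<close>

definition cprod :: "complex^3 \<Rightarrow> complex^3 \<Rightarrow> complex^3" where
  "cprod u v = vector [u $ 2 * v $ 3 - u $ 3 * v $ 2, u $ 3 * v $ 1 - u $ 1 * v $ 3, u $ 1 * v $ 2 - u $ 2 * v $ 1]"

text \<open>The cofactor identity, describing how the joining line changes under a linear
  map.\<close>

lemma transpose_mult_cprod:
  "transpose A *v cprod (A *v u) (A *v v) = Determinants.det A *s cprod u v"
  unfolding vec3_eq_iff
  by (simp add: cprod_def vector_3 matrix_vector_mult_def transpose_def sum_3 det_3) (simp add: algebra_simps)

lemma dot_transpose: "dot (transpose A *v u) v = dot u (A *v v)"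
  by (simp add: dot_def matrix_vector_mult_def transpose_def sum_3 algebra_simps)

lemma dot_smult_left: "dot (c *s u) v = c * dot u v"
  by (simp add: dot_def algebra_simps)

lemma dot_cprod_mult: "dot (cprod (A *v u) (A *v v)) (A *v w) = Determinants.det A * dot (cprod u v) w"
  by (metis dot_transpose dot_smult_left transpose_mult_cprod)

lemma cprod_smult_left: "cprod (c *s u) v = c *s cprod u v"
  by (simp add: cprod_def vec3_eq_iff vector_3 algebra_simps)

lemma dot_axis: "dot u (axis i 1) = u $ i"
  using exhaust_3[of i] by (auto simp: dot_def axis_def)

lemma cprod_eq_0D:
  assumes "cprod u v = 0" "u \<noteq> 0"
  shows "\<exists>c. v = c *s u"
proof -
  obtain i where i: "u $ i \<noteq> 0" using assms(2) by (metis Finite_Cartesian_Product.vec_eq_iff zero_index)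
  have eqs: "u $ 2 * v $ 3 = u $ 3 * v $ 2" "u $ 3 * v $ 1 = u $ 1 * v $ 3" "u $ 1 * v $ 2 = u $ 2 * v $ 1"
    using assms(1) by (simp_all add: cprod_def vec3_eq_iff vector_3)
  have "v = (v $ i / u $ i) *s u"
    using exhaust_3[of i] i eqs by (elim disjE) (simp_all add: vec3_eq_iff field_simps)
  thus ?thesis by blast
qed

lemma ex_cprod_nonzero:
  assumes "v \<noteq> 0"
  shows "\<exists>u. cprod u v \<noteq> 0"
proof (rule ccontr)
  assume "\<not> ?thesis"
  hence "cprod (axis 1 1) v = 0" "cprod (axis 2 1) v = 0" by blast+
  thus False using assms by (simp add: cprod_def vec3_eq_iff vector_3 axis_def)
qed

lemma frame_ex:
  assumes "cprod e q \<noteq> 0"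
  obtains A B where "A ** B = Finite_Cartesian_Product.mat 1" "B ** A = Finite_Cartesian_Product.mat 1"
    "A *v vector [1, 0, 0] = e" "A *v e\<^sub>3 = q" "Determinants.det A \<noteq> 0"
proof -
  obtain i where i: "cprod e q $ i \<noteq> 0" using assms by (metis Finite_Cartesian_Product.vec_eq_iff zero_index)
  define f where "f = (axis i 1 :: complex^3)"
  define A :: "complex^3^3" where "A = (\<chi> k j. if j = 1 then e $ k else if j = 2 then f $ k else q $ k)"
  have cols: "A *v vector [1, 0, 0] = e" "A *v e\<^sub>3 = q"
    by (simp_all add: vec3_eq_iff matrix_vector_mult_def sum_3 A_def e\<^sub>3_def vector_3)
  have "Determinants.det A = - dot (cprod e q) f"
    by (simp add: det_3 A_def dot_def cprod_def vector_3 algebra_simps)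
  hence det: "Determinants.det A \<noteq> 0" using i by (simp add: f_def dot_axis)
  hence "invertible A" by (simp add: invertible_det_nz)
  then obtain B where "A ** B = Finite_Cartesian_Product.mat 1" "B ** A = Finite_Cartesian_Product.mat 1"
    unfolding invertible_def by blast
  thus ?thesis using that cols det by blast
qed

lemma irreducible_linear_form:
  assumes "w \<noteq> 0"
  shows "irreducible (linear_form w)"
proof -
  obtain e where "cprod e w \<noteq> 0" using ex_cprod_nonzero[OF assms] by blast
  then obtain A B where AB: "A ** B = Finite_Cartesian_Product.mat 1" "B ** A = Finite_Cartesian_Product.mat 1" "A *v e\<^sub>3 = w"
    using frame_ex by metis
  have t: "transpose B ** transpose A = Finite_Cartesian_Product.mat 1"
    "transpose A ** transpose B = Finite_Cartesian_Product.mat 1"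
    using AB by (simp_all add: matrix_transpose_mul[symmetric])
  have "irreducible (coord 3)"
  proof -
    have "irreducible ([:0, 1:] :: poly3)" by (rule irreducible_linear_poly) auto
    thus ?thesis by (simp add: coord_def)
  qed
  hence "irreducible (linear_subst (transpose A) (coord 3))"
    using t by (intro irreducible_linear_subst)
  also have "linear_subst (transpose A) (coord 3) = linear_form w"
  proof (rule poly3_eqI)
    fix v
    have "(transpose A *v v) $ 3 = dot v w"
      using dot_transpose[of A v e\<^sub>3] AB(3) by (simp add: dot_def e\<^sub>3_def vector_3)
    thus "eval3 (linear_subst (transpose A) (coord 3)) v = eval3 (linear_form w) v"
      by (simp add: dot_def mult.commute)
  qed
  finally show ?thesis .
qed

lemma eval3_linear_form_dot: "eval3 (linear_form w) v = dot w v"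
  by (simp add: dot_def)

lemma linear_form_nonzero: "w \<noteq> 0 \<Longrightarrow> linear_form w \<noteq> 0"
  using irreducible_linear_form by (metis not_irreducible_zero)

text \<open>A product of nonzero polynomials is nonzero, so finitely many open conditions can be met
  at once. This is how general position is obtained.\<close>

lemma ex_common_nonzero:
  assumes "finite \<Q>" "\<And>Q. Q \<in> \<Q> \<Longrightarrow> Q \<noteq> 0"
  obtains v where "\<And>Q. Q \<in> \<Q> \<Longrightarrow> eval3 Q v \<noteq> 0"
proof -
  have "(\<Prod>Q\<in>\<Q>. Q) \<noteq> 0" using assms by simp
  then obtain v where "eval3 (\<Prod>Q\<in>\<Q>. Q) v \<noteq> 0" using eval3_nonzero_ex by blast
  hence "\<forall>Q\<in>\<Q>. eval3 Q v \<noteq> 0" using assms(1) by (simp add: eval3_prod)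
  thus ?thesis using that by blast
qed

lemma cprod_polynomial: "\<exists>H. \<forall>v. eval3 H v = eval3 G (cprod v p)"
proof
  show "\<forall>v. eval3 (psubst const3 (const3 (p $ 3) * coord 2 - const3 (p $ 2) * coord 3)
      (const3 (p $ 1) * coord 3 - const3 (p $ 3) * coord 1)
      (const3 (p $ 2) * coord 1 - const3 (p $ 1) * coord 2) G) v = eval3 G (cprod v p)"
    by (simp add: eval3_psubst cprod_def mult.commute)
qed

lemma ex_cprod_if_dot_0:
  assumes "dot p l = 0" "p \<noteq> 0"
  shows "\<exists>v. l = cprod v p"
proof -
  obtain i where i: "p $ i \<noteq> 0" using assms(2) by (metis Finite_Cartesian_Product.vec_eq_iff zero_index)
  have "l = cprod ((1 / p $ i) *s cprod (axis i 1) l) p"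
  proof -
    \<comment> \<open>The expansion of a double cross product; its last term vanishes because
      \<open>p\<close> lies on the line \<open>l\<close>.\<close>
    have "p $ i *s l = cprod (cprod (axis i 1) l) p + dot p l *s axis i 1"
      using exhaust_3[of i] by (elim disjE) (simp_all add: vec3_eq_iff cprod_def vector_3 axis_def dot_def algebra_simps)
    hence "p $ i *s l = cprod (cprod (axis i 1) l) p" by (simp add: assms(1))
    hence "(1 / p $ i) *s (p $ i *s l) = (1 / p $ i) *s cprod (cprod (axis i 1) l) p" by simp
    thus ?thesis using i by (simp add: vector_smult_assoc cprod_smult_left)
  qed
  thus ?thesis by blast
qed

section \<open>General position and the Pluecker inequality\<close>

context irreducible_form
begin

text \<open>A point off the curve is moved to \<open>e\<^sub>3\<close>, and the dual equation found
  there is carried back contragrediently.\<close>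

lemma ex_dual_equation: "\<exists>G. dual_equation F G"
proof -
  obtain v where v: "eval3 F v \<noteq> 0" using eval3_nonzero_ex[of F] prime by auto
  hence "v \<noteq> 0" using eval3_0 by auto
  then obtain e where "cprod e v \<noteq> 0" using ex_cprod_nonzero by blast
  then obtain A B where AB: "A ** B = Finite_Cartesian_Product.mat 1" "B ** A = Finite_Cartesian_Product.mat 1" "A *v e\<^sub>3 = v"
    using frame_ex by metis
  interpret A: irreducible_form "linear_subst A F" n
    by unfold_locales (use irreducible_linear_subst[OF AB(1,2) irr] form_linear_subst[OF form AB(1)] n2 in auto)
  have "eval3 (linear_subst A F) e\<^sub>3 \<noteq> 0" using v AB(3) by simp
  then obtain G where "dual_equation (linear_subst A F) G" by (rule A.ex_dual_equation_if_eval3_e3)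
  from dual_equation_linear_subst[OF AB(2,1) this]
  show ?thesis using AB by (auto simp: linear_subst_linear_subst)
qed

text \<open>Otherwise \<open>G\<close> would vanish on every line through \<open>p\<close>, hence be
  the linear form of \<open>p\<close> up to a constant; then all tangents would pass through
  \<open>p\<close>.\<close>

lemma dual_equation_pencil_nonzero:
  assumes G: "dual_equation F G" and p: "p \<noteq> 0"
  shows "\<exists>v. eval3 G (cprod v p) \<noteq> 0"
proof (rule ccontr)
  assume "\<not> ?thesis"
  hence "eval3 G l = 0" if "dot p l = 0" for l using ex_cprod_if_dot_0[OF that p] by auto
  hence "linear_form p dvd G"
    by (intro study_lemma irreducible_linear_form[OF p]) (simp only: eval3_linear_form_dot)
  then obtain K where K: "G = linear_form p * K" by (rule dvdE)
  have "irreducible G" using G by (simp add: dual_equation_def)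
  hence "is_unit K" using K irreducibleD irreducible_not_unit[OF irreducible_linear_form[OF p]] by blast
  hence "G dvd linear_form p" unfolding K by (simp add: mult_unit_dvd_iff)
  hence "vanishes_on_dual F (linear_form p)" using G by (simp add: dual_equation_def)
  hence "F dvd const3 (p $ 1) * partial3 F 1 + const3 (p $ 2) * partial3 F 2 + const3 (p $ 3) * partial3 F 3"
    by (intro study_lemma[OF irr]) (simp add: vanishes_on_dual_def)
  thus False using partial_combination_not_dvd[OF p] by contradiction
qed

text \<open>A linear change of coordinates puts the curve, its singular points and its dual in
  general position with respect to the pencil; the local bounds then apply at distinct finite
  parameters and can be added.\<close>

lemma dual_degree_plus_ade_orders:
  assumes fin: "finite (singular_points F)" and ne: "singular_points F \<noteq> {}"
    and ade: "\<And>p. p \<in> singular_points F \<Longrightarrow> has_ade_type F p (T p)"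
  shows "real (curve_degree (dual_curve F)) + (\<Sum>p\<in>singular_points F. ade_order (T p)) \<le> real (n * (n - 1))"
proof -
  define S where "S = singular_points F"
  obtain G where G: "dual_equation F G" using ex_dual_equation by blast
  obtain d where d: "form d G" "d > 0" using dual_equation_form[OF G] by blast
  have G0: "eval3 G 0 = 0" using form_eval3[OF d(1), of 0 0] d(2) by (simp add: power_0_left)
  have G_scale: "eval3 G (c *s v) \<noteq> 0" if "c \<noteq> 0" "eval3 G v \<noteq> 0" for c v
    using that by (simp add: form_eval3[OF d(1)])
  \<comment> \<open>\<open>D\<close> is the derivative of \<open>\<psi>\<close> along the first
    axis, that is, the tangent direction of the branch y = 0 in the chart.\<close>
  have "\<forall>p\<in>S. \<exists>A. \<exists>D :: complex^3. \<exists>\<phi> \<psi> u U V a\<^sub>1 b\<^sub>1 a\<^sub>2 b\<^sub>2. ade_chart F p (T p) A \<phi> \<psi> u U V \<and>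
    ((fst \<circ> \<psi>) has_derivative (\<lambda>(h, k). a\<^sub>1 * h + b\<^sub>1 * k)) (at 0) \<and>
    ((snd \<circ> \<psi>) has_derivative (\<lambda>(h, k). a\<^sub>2 * h + b\<^sub>2 * k)) (at 0) \<and> D = vector [a\<^sub>1, a\<^sub>2, 0] \<and> D \<noteq> 0"
  proof
    fix p assume "p \<in> S"
    then obtain A \<phi> \<psi> u U V where chart: "ade_chart F p (T p) A \<phi> \<psi> u U V"
      using ade has_ade_type_chart unfolding S_def by metis
    from chart obtain a\<^sub>1 b\<^sub>1 a\<^sub>2 b\<^sub>2 c\<^sub>1 d\<^sub>1 where D:
      "((fst \<circ> \<psi>) has_derivative (\<lambda>(h, k). a\<^sub>1 * h + b\<^sub>1 * k)) (at 0)"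
      "((snd \<circ> \<psi>) has_derivative (\<lambda>(h, k). a\<^sub>2 * h + b\<^sub>2 * k)) (at 0)"
      "\<forall>\<alpha> \<beta>. c\<^sub>1 * (a\<^sub>1 * \<alpha> + b\<^sub>1 * \<beta>) + d\<^sub>1 * (a\<^sub>2 * \<alpha> + b\<^sub>2 * \<beta>) = \<alpha>"
      by (rule ade_chart_derivatives)
    have "(vector [a\<^sub>1, a\<^sub>2, 0] :: complex^3) \<noteq> 0"
      using D(3)[rule_format, of 1 0] by (auto simp: vec3_eq_iff vector_3)
    thus "\<exists>A. \<exists>D :: complex^3. \<exists>\<phi> \<psi> u U V a\<^sub>1 b\<^sub>1 a\<^sub>2 b\<^sub>2. ade_chart F p (T p) A \<phi> \<psi> u U V \<and>
      ((fst \<circ> \<psi>) has_derivative (\<lambda>(h, k). a\<^sub>1 * h + b\<^sub>1 * k)) (at 0) \<and>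
      ((snd \<circ> \<psi>) has_derivative (\<lambda>(h, k). a\<^sub>2 * h + b\<^sub>2 * k)) (at 0) \<and> D = vector [a\<^sub>1, a\<^sub>2, 0] \<and> D \<noteq> 0"
      using chart D(1,2) by blast
  qed
  then obtain A' :: "(complex^3) set \<Rightarrow> complex^3^3" and D :: "(complex^3) set \<Rightarrow> complex^3" where
    A': "\<forall>p\<in>S. \<exists>\<phi> \<psi> u U V a\<^sub>1 b\<^sub>1 a\<^sub>2 b\<^sub>2. ade_chart F p (T p) (A' p) \<phi> \<psi> u U V \<and>
    ((fst \<circ> \<psi>) has_derivative (\<lambda>(h, k). a\<^sub>1 * h + b\<^sub>1 * k)) (at 0) \<and>
    ((snd \<circ> \<psi>) has_derivative (\<lambda>(h, k). a\<^sub>2 * h + b\<^sub>2 * k)) (at 0) \<and> D p = vector [a\<^sub>1, a\<^sub>2, 0] \<and> D p \<noteq> 0"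
    by (elim bchoice[THEN exE] bchoice[THEN exE]) blast
  define v where "v p = A' p *v e\<^sub>3" for p
  define t where "t p = A' p *v D p" for p
  have chart: "invertible (A' p)" "p = vec.span {v p}" "\<exists>w. coeff (line_poly F (v p) w) (ade_mult (T p)) \<noteq> 0"
    "D p \<noteq> 0" "D p $ 3 = 0" if p: "p \<in> S" for p
  proof -
    obtain \<phi> \<psi> u U V a\<^sub>1 a\<^sub>2 where c: "ade_chart F p (T p) (A' p) \<phi> \<psi> u U V" "D p = vector [a\<^sub>1, a\<^sub>2, 0]" "D p \<noteq> 0"
      using A' p by blast
    show "invertible (A' p)" "p = vec.span {v p}" using c(1) by (simp_all add: ade_chart_def v_def)
    show "\<exists>w. coeff (line_poly F (v p) w) (ade_mult (T p)) \<noteq> 0"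
      using ade_chart_multiplicity[OF c(1)] unfolding v_def by blast
    show "D p \<noteq> 0" "D p $ 3 = 0" using c(2,3) by (simp_all add: vector_3)
  qed
  have cancel: "u = u'" if "p \<in> S" "A' p *v u = A' p *v u'" for p u u'
    using chart(1)[OF that(1)] that(2) unfolding invertible_def
    by (metis matrix_vector_mul_assoc matrix_vector_mul_lid)
  have v0: "v p \<noteq> 0" if "p \<in> S" for p
    using cancel[OF that, of e\<^sub>3 0] by (auto simp: v_def e\<^sub>3_def vec3_eq_iff vector_3)
  have vt: "cprod (v p) (t p) \<noteq> 0" if p: "p \<in> S" for p
  proof
    assume "cprod (v p) (t p) = 0"
    then obtain c where "t p = c *s v p" using cprod_eq_0D v0[OF p] by blast
    hence "A' p *v D p = A' p *v (c *s e\<^sub>3)" by (simp add: t_def v_def vector_scalar_commute)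
    hence "D p = c *s e\<^sub>3" by (rule cancel[OF p])
    hence "D p = 0" using chart(5)[OF p] by (auto simp: e\<^sub>3_def vec3_eq_iff vector_3)
    thus False using chart(4)[OF p] by contradiction
  qed
  have vv: "cprod (v p) (v p') \<noteq> 0" if p: "p \<in> S" "p' \<in> S" "p \<noteq> p'" for p p'
  proof
    assume "cprod (v p) (v p') = 0"
    then obtain c where c: "v p' = c *s v p" using cprod_eq_0D v0[OF p(1)] by blast
    hence "c \<noteq> 0" using v0[OF p(2)] by auto
    hence "v p = (1 / c) *s v p'" using c by (simp add: vector_smult_assoc)
    hence "v p \<in> vec.span {v p'}" "v p' \<in> vec.span {v p}" using c unfolding mem_span_singleton by blast+
    hence "vec.span {v p} = vec.span {v p'}"
      by (intro equalityI vec.span_minimal) (simp_all add: vec.subspace_span)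
    thus False using chart(2)[OF p(1)] chart(2)[OF p(2)] p(3) by simp
  qed

  obtain M where M: "\<And>p w. eval3 (M p) w = coeff (line_poly F (v p) w) (ade_mult (T p))"
  proof -
    have "\<forall>p. \<exists>H. \<forall>w. eval3 H w = coeff (line_poly F (v p) w) (ade_mult (T p))"
      using coeff_line_poly_polynomial_right by metis
    thus ?thesis using that by metis
  qed
  obtain H where H: "\<And>p w. eval3 (H p) w = eval3 G (cprod w (v p))"
  proof -
    have "\<forall>p. \<exists>H. \<forall>w. eval3 H w = eval3 G (cprod w (v p))" using cprod_polynomial by blast
    thus ?thesis using that by metis
  qed
  \<comment> \<open>Conditions on the centre \<open>q\<close>: it is off the curve; the line to each
    \<open>p\<close> meets the curve there with the exact multiplicity, is not in the dual curve and
    is not tangent to the branch y = 0; different \<open>p\<close> lie on different lines.\<close>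
  define \<Q> where "\<Q> = {F} \<union> M ` S \<union> H ` S \<union> (\<lambda>p. linear_form (cprod (v p) (t p))) ` S \<union>
    (\<Union>p\<in>S. (\<lambda>p'. linear_form (cprod (v p) (v p'))) ` (S - {p}))"
  have "finite \<Q>" using fin by (simp add: \<Q>_def S_def)
  moreover have "\<forall>Q\<in>\<Q>. Q \<noteq> 0"
  proof -
    have Q1: "F \<noteq> 0" using irr by auto
    have Q2: "\<forall>p\<in>S. M p \<noteq> 0"
    proof
      fix p assume "p \<in> S"
      then obtain w where "eval3 (M p) w \<noteq> 0" using chart(3) M by metis
      thus "M p \<noteq> 0" by auto
    qed
    have Q3: "\<forall>p\<in>S. H p \<noteq> 0"
    proof
      fix p assume "p \<in> S"
      then obtain w where "eval3 (H p) w \<noteq> 0" using dual_equation_pencil_nonzero[OF G v0] H by metis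
      thus "H p \<noteq> 0" by auto
    qed
    have Q4: "\<forall>p\<in>S. linear_form (cprod (v p) (t p)) \<noteq> 0"
      by (intro ballI linear_form_nonzero vt)
    have Q5: "\<forall>p\<in>S. \<forall>p'\<in>S - {p}. linear_form (cprod (v p) (v p')) \<noteq> 0"
      by (intro ballI linear_form_nonzero vv) (simp_all only: Diff_iff singleton_iff, metis)
    show ?thesis
      unfolding \<Q>_def ball_Un ball_UN ball_simps(9) by (intro conjI Q2 Q3 Q4 Q5) (simp add: Q1)
  qed
  ultimately obtain q where q: "\<And>Q. Q \<in> \<Q> \<Longrightarrow> eval3 Q q \<noteq> 0"
    using ex_common_nonzero by metis
  have qF: "eval3 F q \<noteq> 0" using q[of F] by (simp add: \<Q>_def)
  have qM: "coeff (line_poly F (v p) q) (ade_mult (T p)) \<noteq> 0" if "p \<in> S" for p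
    using q[of "M p"] that M by (simp add: \<Q>_def)
  have qH: "eval3 G (cprod q (v p)) \<noteq> 0" if "p \<in> S" for p
    using q[of "H p"] that H by (simp add: \<Q>_def)
  have qt: "dot (cprod (v p) (t p)) q \<noteq> 0" if p: "p \<in> S" for p
    unfolding eval3_linear_form_dot[symmetric]
    by (rule q, unfold \<Q>_def) (rule UnI1, rule UnI2, rule imageI, rule p)
  have qv: "dot (cprod (v p) (v p')) q \<noteq> 0" if p: "p \<in> S" "p' \<in> S" "p \<noteq> p'" for p p'
  proof -
    have "p' \<in> S - {p}" using p by (metis Diff_iff singletonD)
    thus ?thesis
      unfolding eval3_linear_form_dot[symmetric] by (intro q, unfold \<Q>_def) (rule UnI2, rule UN_I[OF p(1)], rule imageI)
  qed

  obtain H' where H': "\<And>w. eval3 H' w = eval3 G (cprod w q)" using cprod_polynomial by metis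
  \<comment> \<open>Conditions on \<open>e\<close>: the line joining it to \<open>q\<close>, which
    becomes the member at infinite parameter, is not in the dual curve and contains no singular
    point.\<close>
  define \<Q>' where "\<Q>' = insert H' ((\<lambda>p. linear_form (cprod q (v p))) ` S)"
  have "finite \<Q>'" using fin by (simp add: \<Q>'_def S_def)
  moreover have "\<forall>Q\<in>\<Q>'. Q \<noteq> 0"
  proof -
    \<comment> \<open>A singular point itself witnesses that \<open>H'\<close> is nonzero.\<close>
    obtain p where p: "p \<in> S" using ne unfolding S_def by blast
    have "cprod (v p) q = (- 1) *s cprod q (v p)" by (simp add: cprod_def vec3_eq_iff vector_3)
    hence "eval3 H' (v p) \<noteq> 0" unfolding H' using G_scale[OF _ qH[OF p], of "- 1"] by simp
    hence "H' \<noteq> 0" by auto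
    moreover have "cprod q (v p) \<noteq> 0" if "p \<in> S" for p using qH[OF that] G0 by auto
    ultimately show ?thesis by (simp add: \<Q>'_def linear_form_nonzero)
  qed
  ultimately obtain e where e: "\<And>Q. Q \<in> \<Q>' \<Longrightarrow> eval3 Q e \<noteq> 0"
    using ex_common_nonzero by metis
  have eG: "eval3 G (cprod e q) \<noteq> 0" using e[of H'] H' by (simp add: \<Q>'_def)
  have ev: "dot (cprod q (v p)) e \<noteq> 0" if p: "p \<in> S" for p
    unfolding eval3_linear_form_dot[symmetric]
    by (rule e, unfold \<Q>'_def) (rule insertI2, rule imageI, rule p)
  have "cprod e q \<noteq> 0" using eG G0 by auto
  then obtain A B where AB: "A ** B = Finite_Cartesian_Product.mat 1" "B ** A = Finite_Cartesian_Product.mat 1"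
    and cols: "A *v vector [1, 0, 0] = e" "A *v e\<^sub>3 = q" and det: "Determinants.det A \<noteq> 0"
    using frame_ex by blast
  have AB': "A *v (B *v x) = x" "B *v (A *v x) = x" for x
    using AB by (simp_all add: matrix_vector_mul_assoc)
  define F' where "F' = linear_subst A F"
  define G' where "G' = linear_subst (transpose B) G"
  interpret F': irreducible_form F' n
    unfolding F'_def
    by unfold_locales (use irreducible_linear_subst[OF AB(1,2) irr] form_linear_subst[OF form AB(1)] n2 in auto)
  have G': "dual_equation F' G'" unfolding F'_def G'_def by (rule dual_equation_linear_subst[OF AB G])
  have tAB: "transpose B ** transpose A = Finite_Cartesian_Product.mat 1"
    using AB by (simp add: matrix_transpose_mul[symmetric])
  have formG': "form d G'" unfolding G'_def by (rule form_linear_subst[OF d(1) tAB])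
  note transpose_matrix_vector [simp del]
  have tB: "transpose B *v cprod x y = (1 / Determinants.det A) *s cprod (A *v x) (A *v y)" for x y
  proof -
    have "transpose B *v (transpose A *v cprod (A *v x) (A *v y)) = Determinants.det A *s (transpose B *v cprod x y)"
      by (simp only: transpose_mult_cprod vector_scalar_commute)
    hence "cprod (A *v x) (A *v y) = Determinants.det A *s (transpose B *v cprod x y)"
      by (simp only: matrix_vector_mul_assoc tAB matrix_vector_mul_lid)
    thus ?thesis using det by (simp add: vector_smult_assoc)
  qed
  define a where "a p = (B *v v p) $ 1 / (B *v v p) $ 2" for p
  define z where "z p = (B *v v p) $ 3 / (B *v v p) $ 2" for p
  have y0: "(B *v v p) $ 2 \<noteq> 0" if "p \<in> S" for p
  proof -
    have "dot (cprod q (v p)) e = dot (cprod (A *v e\<^sub>3) (A *v (B *v v p))) (A *v vector [1, 0, 0])"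
      by (simp add: cols AB')
    also have "\<dots> = Determinants.det A * (- ((B *v v p) $ 2))"
      unfolding dot_cprod_mult by (simp add: dot_def cprod_def e\<^sub>3_def vector_3)
    finally show ?thesis using ev[OF that] by auto
  qed
  have Bv: "B *v v p = (B *v v p) $ 2 *s vector [a p, 1, z p]" if "p \<in> S" for p
    using y0[OF that] by (simp add: vec3_eq_iff vector_3 a_def z_def)
  have inj: "inj_on a S"
  proof (rule inj_onI, rule ccontr)
    fix p p' assume p: "p \<in> S" "p' \<in> S" "a p = a p'" "p \<noteq> p'"
    have "dot (cprod (v p) (v p')) q = dot (cprod (A *v (B *v v p)) (A *v (B *v v p'))) (A *v e\<^sub>3)"
      by (simp add: cols AB')
    also have "\<dots> = Determinants.det A * ((B *v v p) $ 1 * (B *v v p') $ 2 - (B *v v p) $ 2 * (B *v v p') $ 1)"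
      unfolding dot_cprod_mult by (simp add: dot_def cprod_def e\<^sub>3_def vector_3)
    also have "(B *v v p) $ 1 * (B *v v p') $ 2 = (B *v v p) $ 2 * (B *v v p') $ 1"
      using p(3) y0[OF p(1)] y0[OF p(2)] by (simp add: a_def field_simps)
    finally show False using qv[OF p(1,2,4)] by simp
  qed
  have pencil: "eval3 G' (vector [1, - a p, 0]) \<noteq> 0" if "p \<in> S" for p
  proof -
    have "vector [1, - a p, 0] = (- 1 / (B *v v p) $ 2) *s cprod e\<^sub>3 (B *v v p)"
      using y0[OF that] by (simp add: vec3_eq_iff vector_3 cprod_def e\<^sub>3_def a_def)
    hence "transpose B *v vector [1, - a p, 0] =
        (- 1 / (B *v v p) $ 2 * (1 / Determinants.det A)) *s cprod q (v p)"
      by (simp only: vector_scalar_commute tB vector_smult_assoc cols AB')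
    thus ?thesis
      using G_scale[OF _ qH[OF that], of "- 1 / (B *v v p) $ 2 * (1 / Determinants.det A)"] det y0[OF that]
      by (simp add: G'_def)
  qed
  \<comment> \<open>In the new coordinates (0, 1, 0) is the line joining \<open>e\<close> and
    \<open>q\<close>.\<close>
  have "eval3 G' (vector [0, 1, 0]) \<noteq> 0"
  proof -
    have "vector [0, 1, 0] = (- 1) *s cprod (vector [1, 0, 0]) e\<^sub>3"
      by (simp add: vec3_eq_iff vector_3 cprod_def e\<^sub>3_def)
    hence "transpose B *v vector [0, 1, 0] = (- 1 * (1 / Determinants.det A)) *s cprod e q"
      by (simp only: vector_scalar_commute tB vector_smult_assoc cols)
    thus ?thesis using G_scale[OF _ eG, of "- 1 * (1 / Determinants.det A)"] det by (simp add: G'_def)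
  qed
  moreover have e3: "eval3 F' e\<^sub>3 \<noteq> 0" using qF by (simp add: F'_def cols)
  moreover have "\<exists>C \<epsilon>. \<epsilon> > 0 \<and> (\<forall>x. 0 < dist x (a p) \<longrightarrow> dist x (a p) < \<epsilon> \<longrightarrow>
      norm (poly (pencil_discriminant n F') x) \<le> C * dist x (a p) powr ade_order (T p))" if p: "p \<in> S" for p
  proof -
    obtain \<phi> \<psi> u U V a\<^sub>1 b\<^sub>1 a\<^sub>2 b\<^sub>2 where c: "ade_chart F p (T p) (A' p) \<phi> \<psi> u U V"
      "((fst \<circ> \<psi>) has_derivative (\<lambda>(h, k). a\<^sub>1 * h + b\<^sub>1 * k)) (at 0)"
      "((snd \<circ> \<psi>) has_derivative (\<lambda>(h, k). a\<^sub>2 * h + b\<^sub>2 * k)) (at 0)" "D p = vector [a\<^sub>1, a\<^sub>2, 0]"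
      using A' p by blast
    have e3': "(B ** A' p) *v e\<^sub>3 = B *v v p" by (simp add: v_def matrix_vector_mul_assoc)
    have t': "(B ** A' p) *v vector [a\<^sub>1, a\<^sub>2, 0] = B *v t p" by (simp add: t_def c(4) matrix_vector_mul_assoc)
    show ?thesis
    proof (rule F'.ade_point_discriminant_bound[OF e3 _ _ y0[OF p] _ c(2,3)])
      show "ade_chart F' (vec.span {B *v (A' p *v e\<^sub>3)}) (T p) (B ** A' p) \<phi> \<psi> u U V"
        unfolding F'_def by (rule ade_chart_linear_subst[OF c(1) AB])
      show "(B ** A' p) *v e\<^sub>3 = (B *v v p) $ 2 *s vector [a p, 1, z p]" unfolding e3' by (rule Bv[OF p])
      have "line_poly F' (B *v v p) e\<^sub>3 = line_poly F (v p) q"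
      proof -
        have "poly (line_poly F' (B *v v p) e\<^sub>3) x = poly (line_poly F (v p) q) x" for x
          by (simp add: poly_line_poly F'_def matrix_vector_right_distrib vector_scalar_commute AB' cols)
        thus ?thesis by (simp only: poly_eq_poly_eq_iff[symmetric] ext)
      qed
      thus "coeff (line_poly F' ((B ** A' p) *v e\<^sub>3) e\<^sub>3) (ade_mult (T p)) \<noteq> 0"
        unfolding e3' using qM[OF p] by simp
      have "dot (cprod (v p) (t p)) q = dot (cprod (A *v (B *v v p)) (A *v (B *v t p))) (A *v e\<^sub>3)"
        by (simp add: cols AB')
      also have "\<dots> = Determinants.det A * ((B *v v p) $ 1 * (B *v t p) $ 2 - (B *v v p) $ 2 * (B *v t p) $ 1)"
        unfolding dot_cprod_mult by (simp add: dot_def cprod_def e\<^sub>3_def vector_3)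
      finally have "(B *v v p) $ 1 * (B *v t p) $ 2 \<noteq> (B *v v p) $ 2 * (B *v t p) $ 1"
        using qt[OF p] by auto
      thus "((B ** A' p) *v vector [a\<^sub>1, a\<^sub>2, 0]) $ 1 \<noteq> a p * ((B ** A' p) *v vector [a\<^sub>1, a\<^sub>2, 0]) $ 2"
        unfolding t' a_def using y0[OF p] by (auto simp: field_simps)
    qed
  qed
  ultimately have "real d + (\<Sum>x\<in>a ` S. ade_order (T (inv_into S a x))) \<le> real (n * (n - 1))"
    using fin inj pencil G' formG' by (intro F'.dual_degree_bound) (auto simp: S_def)
  also have "(\<Sum>x\<in>a ` S. ade_order (T (inv_into S a x))) = (\<Sum>p\<in>S. ade_order (T p))"
    using inj by (simp add: sum.reindex)
  finally show ?thesis using curve_degree_dual_curve[OF G d(1)] by (simp add: S_def)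
qed

end

section \<open>The numerical balance for MK-curves\<close>

theorem corollary4p1:
  fixes F :: poly3 and m :: nat
  assumes "MK_curve (2 * m) F"
    and "irreducible F"
  shows "real (curve_degree (dual_curve F)) < 2 * (real m)\<^sup>2 / 3"
proof -
  let ?n = "2 * m"
  have MK: "form ?n F" "?n \<ge> 6" "\<And>p. p \<in> singular_points F \<Longrightarrow> \<exists>T. has_ade_type F p T"
    "(\<Sum>p\<in>singular_points F. mk_number (ade_type F p)) = real ?n / 2 * (5 * real ?n - 6)"
    using assms(1) unfolding MK_curve_def reduced_curve_def by auto
  interpret irreducible_form F ?n using assms(2) MK(1,2) by unfold_locales auto
  have T: "has_ade_type F p (ade_type F p)" if "p \<in> singular_points F" for p
    unfolding ade_type_def using MK(3)[OF that] by (rule someI_ex)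
  \<comment> \<open>Positivity of the sum yields finiteness, since a sum over an infinite set is 0
    by convention, and it rules out a smooth curve.\<close>
  have "real ?n / 2 * (5 * real ?n - 6) > 0" using MK(2) by simp
  hence sum: "(\<Sum>p\<in>singular_points F. mk_number (ade_type F p)) > 0" using MK(4) by simp
  have fin: "finite (singular_points F)" using sum by (metis less_irrefl sum.infinite)
  have ne: "singular_points F \<noteq> {}" using sum by auto
  have "(\<Sum>p\<in>singular_points F. mk_number (ade_type F p)) < (\<Sum>p\<in>singular_points F. 3 * ade_order (ade_type F p))"
    using T by (intro sum_strict_mono fin ne mk_number_less_ade_order) (auto simp: has_ade_type_def)
  hence "real m * (10 * real m - 6) < 3 * (\<Sum>p\<in>singular_points F. ade_order (ade_type F p))"
    unfolding MK(4) sum_distrib_left[symmetric] by simp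
  moreover have "real (curve_degree (dual_curve F)) + (\<Sum>p\<in>singular_points F. ade_order (ade_type F p)) \<le> real (?n * (?n - 1))"
    using fin ne T by (rule dual_degree_plus_ade_orders)
  moreover have "real (?n * (?n - 1)) = 2 * real m * (2 * real m - 1)"
    using MK(2) by (simp add: of_nat_diff)
  \<comment> \<open>In terms of the degree n the right side is 3n(n - 1) - n(5n - 6)/2, whose linear
    terms cancel.\<close>
  ultimately have "3 * real (curve_degree (dual_curve F)) < 3 * (2 * real m * (2 * real m - 1)) - real m * (10 * real m - 6)"
    by linarith
  also have "\<dots> = 2 * (real m)\<^sup>2" by (simp add: algebra_simps power2_eq_square)
  finally show ?thesis by simp
qed

end
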